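(* Let $\mathcal{H}_S,\mathcal{H}_E$ be finite-dimensional Hilbert spaces and $\mathcal{S}$ a nonempty set of density operators on $\mathcal{H}_S\otimes\mathcal{H}_E$. Let $\mathcal{S}'=\{\rho_{SE}^{(1)},\dots,\rho_{SE}^{(M)}\}\subseteq\mathcal{S}$ be a maximal linearly independent subset of $\mathcal{S}$, ordered so that for some $m\le M$ the reduced states $\rho_S^{(i)}=\mathrm{Tr}_E(\rho_{SE}^{(i)})$, $i=1,\dots,m$, are linearly independent and span $\mathcal{V}_S:=\mathrm{Tr}_E\mathcal{V}$, where $\mathcal{V}=\mathrm{Span}_{\mathbb{C}}\mathcal{S}$. Let $\hat{\mathcal{V}}=\mathrm{Span}_{\mathbb{C}}\{\rho_{SE}^{(1)},\dots,\rho_{SE}^{(m)}\}$. Let $\mathcal{G}$ be the set of unitaries $U$ on $\mathcal{H}_S\otimes\mathcal{H}_E$ such that $\mathcal{V}$ is $U$-consistent, i.e. for all $X,Y\in\mathcal{V}$ with $\mathrm{Tr}_EX=\mathrm{Tr}_EY$ one has $\mathrm{Tr}_E(UXU^\dagger)=\mathrm{Tr}_E(UYU^\dagger)$. Define the reference state $$\omega_{RSE}=\sum_{l=1}^m\frac1m\,|l_R\rangle\langle l_R|\otimes\rho_{SE}^{(l)},$$ with $\{|l_R\rangle\}_{l=1}^m$ an orthonormal basis of an auxiliary Hilbert space $\mathcal{H}_R$. Suppose there exists a linear, trace-preserving, positive map $\Lambda_S^{(P)}:\mathcal{L}(\mathcal{H}_S)\to\mathcal{L}(\mathcal{H}_S\otimes\mathcal{H}_E)$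 mapping $\mathcal{V}_S$ to $\hat{\mathcal{V}}$, i.e. $\Lambda_S^{(P)}(\rho_S^{(i)})=\rho_{SE}^{(i)}$ for $i=1,\dots,m$. Then: (i) $\omega_{RSE}$ is a Markov state; (ii) there exists a linear, trace-preserving, completely positive map $\Lambda_S^{(CP)}:\mathcal{L}(\mathcal{H}_S)\to\mathcal{L}(\mathcal{H}_S\otimes\mathcal{H}_E)$ with $\Lambda_S^{(CP)}(\rho_S^{(i)})=\rho_{SE}^{(i)}$ for $i=1,\dots,m$; (iii) $\mathrm{Tr}_E(\mathcal{D}(\mathcal{H}_S\otimes\mathcal{H}_E)\cap\mathcal{V})=\mathcal{D}(\mathcal{H}_S)\cap\mathcal{V}_S$, and for every $U\in\mathcal{G}$ the map $\mathcal{E}_S=\mathrm{Tr}_E\circ\mathrm{Ad}_U\circ\Lambda_S^{(CP)}$ (with $\mathrm{Ad}_U(X)=UXU^\dagger$) is completely positive and satisfies $\mathcal{E}_S(\mathrm{Tr}_E\rho_{SE})=\mathrm{Tr}_E(U\rho_{SE}U^\dagger)$ for every $\rho_{SE}\in\mathcal{D}(\mathcal{H}_S\otimes\mathcal{H}_E)\cap\mathcal{V}$.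
   Context: $\mathcal{L}(\mathcal{H})$ denotes the linear operators on $\mathcal{H}$ and $\mathcal{D}(\mathcal{H})$ the density operators. A positive map sends positive semidefinite operators to positive semidefinite operators; completely positive means $\mathrm{id}_k\otimes\Phi$ is positive for all $k$. A tripartite state $\sigma_{RSE}$ is a Markov state if there is a decomposition $\mathcal{H}_S=\bigoplus_k\mathcal{H}_{s_k^L}\otimes\mathcal{H}_{s_k^R}$ (orthogonal direct sum) such that $\sigma_{RSE}=\bigoplus_k\lambda_k\,\sigma_{Rs_k^L}\otimes\sigma_{s_k^RE}$ with $\{\lambda_k\}$ a probability distribution, $\sigma_{Rs_k^L}\in\mathcal{D}(\mathcal{H}_R\otimes\mathcal{H}_{s_k^L})$ and $\sigma_{s_k^RE}\in\mathcal{D}(\mathcal{H}_{s_k^R}\otimes\mathcal{H}_E)$. *)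

theory Defs
  imports "Jordan_Normal_Form.Schur_Decomposition"
begin

text \<open>Operators on C^d are d x d complex matrices (Jordan_Normal_Form).
  The tensor product C^a (x) C^b is identified with C^(a*b) via (i,j) |-> i*b + j.\<close>

definition mtrace :: "complex mat \<Rightarrow> complex" where
  "mtrace A = (\<Sum>i<dim_row A. A $$ (i,i))"

definition tensor_mat :: "complex mat \<Rightarrow> complex mat \<Rightarrow> complex mat" where
  "tensor_mat A B = mat (dim_row A * dim_row B) (dim_col A * dim_col B)
     (\<lambda>(i,j). A $$ (i div dim_row B, j div dim_col B) * B $$ (i mod dim_row B, j mod dim_col B))"

definition ptrace_E :: "nat \<Rightarrow> nat \<Rightarrow> complex mat \<Rightarrow> complex mat" where
  "ptrace_E dS dE X = mat dS dS (\<lambda>(i,j). \<Sum>k<dE. X $$ (i*dE + k, j*dE + k))"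

definition msum :: "nat \<Rightarrow> ('i \<Rightarrow> complex mat) \<Rightarrow> 'i set \<Rightarrow> complex mat" where
  "msum d f I = mat d d (\<lambda>ij. \<Sum>i\<in>I. f i $$ ij)"

definition cspan :: "nat \<Rightarrow> complex mat set \<Rightarrow> complex mat set" where
  "cspan d A = {msum d (\<lambda>Y. c Y \<cdot>\<^sub>m Y) F | F c. finite F \<and> F \<subseteq> A}"

definition lin_indep_set :: "nat \<Rightarrow> complex mat set \<Rightarrow> bool" where
  "lin_indep_set d A \<longleftrightarrow> (\<forall>F c. finite F \<longrightarrow> F \<subseteq> A \<longrightarrow>
      msum d (\<lambda>Y. c Y \<cdot>\<^sub>m Y) F = 0\<^sub>m d d \<longrightarrow> (\<forall>Y\<in>F. c Y = 0))"

definition lin_indep_fam :: "nat \<Rightarrow> ('i \<Rightarrow> complex mat) \<Rightarrow> 'i set \<Rightarrow> bool" where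
  "lin_indep_fam d f I \<longleftrightarrow> (\<forall>c. msum d (\<lambda>i. c i \<cdot>\<^sub>m f i) I = 0\<^sub>m d d \<longrightarrow> (\<forall>i\<in>I. c i = 0))"

text \<open>Positive semidefinite operators on C^d (complex order: 0 \<le> z iff z real and nonnegative).\<close>
definition psd :: "nat \<Rightarrow> complex mat \<Rightarrow> bool" where
  "psd d A \<longleftrightarrow> A \<in> carrier_mat d d \<and> (\<forall>v\<in>carrier_vec d. 0 \<le> (A *\<^sub>v v) \<bullet>c v)"

definition density :: "nat \<Rightarrow> complex mat set" where
  "density d = {A. psd d A \<and> mtrace A = 1}"

definition unitary_mat :: "nat \<Rightarrow> complex mat \<Rightarrow> bool" where
  "unitary_mat d U \<longleftrightarrow> U \<in> carrier_mat d d \<and> U * mat_adjoint U = 1\<^sub>m d \<and> mat_adjoint U * U = 1\<^sub>m d"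

definition linear_map :: "nat \<Rightarrow> nat \<Rightarrow> (complex mat \<Rightarrow> complex mat) \<Rightarrow> bool" where
  "linear_map n p \<Phi> \<longleftrightarrow> (\<forall>X\<in>carrier_mat n n. \<Phi> X \<in> carrier_mat p p) \<and>
     (\<forall>X\<in>carrier_mat n n. \<forall>Y\<in>carrier_mat n n. \<forall>a b.
        \<Phi> (a \<cdot>\<^sub>m X + b \<cdot>\<^sub>m Y) = a \<cdot>\<^sub>m \<Phi> X + b \<cdot>\<^sub>m \<Phi> Y)"

definition trace_preserving :: "nat \<Rightarrow> (complex mat \<Rightarrow> complex mat) \<Rightarrow> bool" where
  "trace_preserving n \<Phi> \<longleftrightarrow> (\<forall>X\<in>carrier_mat n n. mtrace (\<Phi> X) = mtrace X)"

definition positive_map :: "nat \<Rightarrow> nat \<Rightarrow> (complex mat \<Rightarrow> complex mat) \<Rightarrow> bool" where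
  "positive_map n p \<Phi> \<longleftrightarrow> (\<forall>X. psd n X \<longrightarrow> psd p (\<Phi> X))"

definition ampliation :: "nat \<Rightarrow> nat \<Rightarrow> nat \<Rightarrow> (complex mat \<Rightarrow> complex mat) \<Rightarrow> complex mat \<Rightarrow> complex mat" where
  "ampliation k n p \<Phi> X = mat (k*p) (k*p) (\<lambda>(r,c).
      \<Phi> (mat n n (\<lambda>(i,j). X $$ ((r div p)*n + i, (c div p)*n + j))) $$ (r mod p, c mod p))"

definition completely_positive :: "nat \<Rightarrow> nat \<Rightarrow> (complex mat \<Rightarrow> complex mat) \<Rightarrow> bool" where
  "completely_positive n p \<Phi> \<longleftrightarrow> (\<forall>k. positive_map (k*n) (k*p) (ampliation k n p \<Phi>))"

text \<open>Markov states on C^dR (x) C^dS (x) C^dE. The orthogonal direct sum decomposition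
  H_S = \<Oplus>_k H_{s_k^L} (x) H_{s_k^R} is given by isometries W_k : C^(aL k) (x) C^(aR k) -> C^dS
  with mutually orthogonal ranges that together span C^dS.\<close>
definition markov_state :: "nat \<Rightarrow> nat \<Rightarrow> nat \<Rightarrow> complex mat \<Rightarrow> bool" where
  "markov_state dR dS dE \<sigma> \<longleftrightarrow>
    (\<exists>(K::nat) (lam::nat \<Rightarrow> real) (aL::nat \<Rightarrow> nat) (aR::nat \<Rightarrow> nat) W \<sigma>L \<sigma>R.
       (\<forall>k<K. W k \<in> carrier_mat dS (aL k * aR k)) \<and>
       (\<forall>k<K. \<forall>l<K. mat_adjoint (W k) * W l =
           (if k = l then 1\<^sub>m (aL k * aR k) else 0\<^sub>m (aL k * aR k) (aL l * aR l))) \<and>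
       msum dS (\<lambda>k. W k * mat_adjoint (W k)) {..<K} = 1\<^sub>m dS \<and>
       (\<forall>k<K. lam k \<ge> 0) \<and> (\<Sum>k<K. lam k) = 1 \<and>
       (\<forall>k<K. \<sigma>L k \<in> density (dR * aL k) \<and> \<sigma>R k \<in> density (aR k * dE)) \<and>
       \<sigma> = msum (dR * dS * dE) (\<lambda>k.
              let Wt = tensor_mat (tensor_mat (1\<^sub>m dR) (W k)) (1\<^sub>m dE) in
              complex_of_real (lam k) \<cdot>\<^sub>m (Wt * tensor_mat (\<sigma>L k) (\<sigma>R k) * mat_adjoint Wt)) {..<K})"

definition ketbra :: "nat \<Rightarrow> nat \<Rightarrow> complex mat" where
  "ketbra d l = mat d d (\<lambda>(i,j). if i = l \<and> j = l then 1 else 0)"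

end

theory Submission
  imports Defs "HOL-Computational_Algebra.Fundamental_Theorem_Algebra"
begin

text \<open>Write \<open>A\<^sub>l\<close> for the reduced states, \<open>B\<^sub>l\<close> for the joint ones, \<open>a = \<Sum>A\<^sub>l\<close>, \<open>b = \<Sum>B\<^sub>l\<close>. The quantity
  \<open>tr (b\<^sup>-\<^sup>1\<^sup>/\<^sup>2 B b\<^sup>-\<^sup>1\<^sup>/\<^sup>2 B)\<close> cannot increase under a positive trace-preserving map. Applied to the given map
  and to the Petz map of the partial trace, this forces the Petz recovery
  \<open>B\<^sub>l = b\<^sup>1\<^sup>/\<^sup>2 (X\<^sub>l \<otimes> 1) b\<^sup>1\<^sup>/\<^sup>2\<close> with \<open>X\<^sub>l = a\<^sup>-\<^sup>1\<^sup>/\<^sup>2 A\<^sub>l a\<^sup>-\<^sup>1\<^sup>/\<^sup>2\<close>, so the Petz map is the required completely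
  positive map. The \<open>X\<^sub>l\<close> are then fixed by a unital completely positive map with invariant state \<open>a\<close>,
  hence commute with its Kraus operators, which are the blocks of \<open>b\<^sup>1\<^sup>/\<^sup>2 (a\<^sup>-\<^sup>1\<^sup>/\<^sup>2 \<otimes> 1)\<close>. The commutant of these
  operators is a star-algebra stable under conjugation by \<open>a\<^sup>1\<^sup>/\<^sup>2\<close>; its decomposition into full matrix algebras,
  with matrix units that are eigenvectors of that conjugation, is the Markov decomposition.\<close>

subsection \<open>The star-algebra of finitely supported matrices\<close>

text \<open>The given map is only positive, so there is no dilation and no Schwarz inequality for
  arbitrary operators to rest on. The quantity of the overview therefore splits
  \<open>b\<^sup>-\<^sup>1\<close> evenly into two roots: in this symmetric form the rescaled map
  and its adjoint both preserve an order interval, and order preservation in both directions is all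
  that the contraction estimate uses. The sums \<open>a\<close> and \<open>b\<close> serve as
  weights because they dominate every single term and are exchanged by the given map and the partial
  trace by linearity. The second obstacle is that membership of the \<open>X\<^sub>l\<close> in an
  algebra does not yet split the joint states: between the Kraus operators and
  \<open>X\<^sub>l\<close> stands the weight \<open>a\<^sup>1\<^sup>/\<^sup>2\<close>, which need
  not commute with matrix units. Stability under conjugation by it supplies matrix units that the
  weight merely rescales by positive numbers, and these are absorbed into the left factors. Finally
  \<open>a\<close> and \<open>b\<close> may be singular, so inverses are pseudo-inverses and most
  identities hold relative to supports.\<close>

text \<open>Matrices of all shapes, padded by zeros, live in one ring, so that products need no side
  conditions on dimensions.\<close>

typedef fsmat = "{f :: nat \<Rightarrow> nat \<Rightarrow> complex. \<exists>N. \<forall>i j. N \<le> i \<or> N \<le> j \<longrightarrow> f i j = 0}"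
  morphisms entry Abs_fsmat
  by (rule exI[of _ "\<lambda>_ _. 0"]) simp

setup_lifting type_definition_fsmat

definition bounded_by :: "nat \<Rightarrow> fsmat \<Rightarrow> bool" where
  "bounded_by N A \<longleftrightarrow> (\<forall>i j. N \<le> i \<or> N \<le> j \<longrightarrow> entry A i j = 0)"

lemma bounded_byD: "bounded_by N A \<Longrightarrow> N \<le> i \<or> N \<le> j \<Longrightarrow> entry A i j = 0"
  unfolding bounded_by_def by blast

lemma bounded_by_exists: "\<exists>N. bounded_by N A"
  using entry[of A] unfolding bounded_by_def by auto

lemma bounded_by_mono: "bounded_by N A \<Longrightarrow> N \<le> N' \<Longrightarrow> bounded_by N' A"
  unfolding bounded_by_def by force

lemma bounded_by_exists2: "\<exists>N. bounded_by N A \<and> bounded_by N B"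
proof -
  obtain N1 N2 where "bounded_by N1 A" "bounded_by N2 B"
    using bounded_by_exists by blast
  then have "bounded_by (max N1 N2) A \<and> bounded_by (max N1 N2) B"
    by (auto intro: bounded_by_mono)
  then show ?thesis ..
qed

lemma fsmat_eqI: "(\<And>i j. entry A i j = entry B i j) \<Longrightarrow> A = B"
  by (metis entry_inject ext)

lift_definition fsmat_of :: "nat \<Rightarrow> nat \<Rightarrow> (nat \<Rightarrow> nat \<Rightarrow> complex) \<Rightarrow> fsmat" is
  "\<lambda>n p f i j. if i < n \<and> j < p then f i j else 0"
proof -
  fix n p :: nat and f :: "nat \<Rightarrow> nat \<Rightarrow> complex"
  show "\<exists>N. \<forall>i j. N \<le> i \<or> N \<le> j \<longrightarrow> (if i < n \<and> j < p then f i j else 0) = 0"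
    by (intro exI[of _ "max n p"]) auto
qed

lemma entry_fsmat_of: "entry (fsmat_of n p f) i j = (if i < n \<and> j < p then f i j else 0)"
  by (simp add: fsmat_of.rep_eq)

instantiation fsmat :: ring
begin

lift_definition zero_fsmat :: fsmat is "\<lambda>_ _. 0" by simp

lift_definition plus_fsmat :: "fsmat \<Rightarrow> fsmat \<Rightarrow> fsmat" is "\<lambda>f g i j. f i j + g i j"
proof -
  fix f g :: "nat \<Rightarrow> nat \<Rightarrow> complex"
  assume "\<exists>N. \<forall>i j. N \<le> i \<or> N \<le> j \<longrightarrow> f i j = 0" "\<exists>N. \<forall>i j. N \<le> i \<or> N \<le> j \<longrightarrow> g i j = 0"
  then obtain N M where "\<forall>i j. N \<le> i \<or> N \<le> j \<longrightarrow> f i j = 0" "\<forall>i j. M \<le> i \<or> M \<le> j \<longrightarrow> g i j = 0"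
    by blast
  then show "\<exists>N. \<forall>i j. N \<le> i \<or> N \<le> j \<longrightarrow> f i j + g i j = 0"
    by (intro exI[of _ "max N M"]) auto
qed

lift_definition uminus_fsmat :: "fsmat \<Rightarrow> fsmat" is "\<lambda>f i j. - f i j" by auto

definition minus_fsmat :: "fsmat \<Rightarrow> fsmat \<Rightarrow> fsmat" where "minus_fsmat A B = A + - B"

text \<open>The sum runs over the support of a row of the left factor, which is finite, so the
  product needs no common inner dimension; \<open>entry_times\<close> trades this range for any
  bound on either factor.\<close>

lift_definition times_fsmat :: "fsmat \<Rightarrow> fsmat \<Rightarrow> fsmat" is
  "\<lambda>f g i j. \<Sum>k | f i k \<noteq> 0. f i k * g k j"
proof -
  fix f g :: "nat \<Rightarrow> nat \<Rightarrow> complex"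
  assume "\<exists>N. \<forall>i j. N \<le> i \<or> N \<le> j \<longrightarrow> f i j = 0" "\<exists>N. \<forall>i j. N \<le> i \<or> N \<le> j \<longrightarrow> g i j = 0"
  then obtain N M where "\<forall>i j. N \<le> i \<or> N \<le> j \<longrightarrow> f i j = 0" "\<forall>i j. M \<le> i \<or> M \<le> j \<longrightarrow> g i j = 0"
    by blast
  then show "\<exists>N. \<forall>i j. N \<le> i \<or> N \<le> j \<longrightarrow> (\<Sum>k | f i k \<noteq> 0. f i k * g k j) = 0"
    by (intro exI[of _ "max N M"]) auto
qed

lemma entry_times:
  assumes "bounded_by N A \<or> bounded_by N B"
  shows "entry (A * B) i j = (\<Sum>k<N. entry A i k * entry B k j)"
proof -
  obtain M where M: "bounded_by M A" using bounded_by_exists by blast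
  have "entry (A * B) i j = (\<Sum>k | entry A i k \<noteq> 0. entry A i k * entry B k j)"
    by (simp add: times_fsmat.rep_eq)
  also have "\<dots> = (\<Sum>k<max M N. entry A i k * entry B k j)"
    using bounded_byD[OF M] by (intro sum.mono_neutral_left) (auto simp: less_max_iff_disj not_le[symmetric])
  also have "\<dots> = (\<Sum>k<N. entry A i k * entry B k j)"
    using assms by (intro sum.mono_neutral_right) (auto dest: bounded_byD)
  finally show ?thesis .
qed

instance
proof
  fix A B C :: fsmat
  show "A + B + C = A + (B + C)" by transfer (simp add: add.assoc)
  show "A + B = B + A" by transfer (simp add: add.commute)
  show "0 + A = A" by transfer simp
  show "- A + A = 0" by transfer simp
  show "A - B = A + - B" by (simp add: minus_fsmat_def)
  obtain N where N: "bounded_by N A" using bounded_by_exists by blast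
  obtain M where M: "bounded_by M B" "bounded_by M C" using bounded_by_exists2 by blast
  have eM: "entry (X * C) i j = (\<Sum>k<M. entry X i k * entry C k j)" for X i j
    by (rule entry_times) (simp add: M)
  have eN: "entry (A * X) i j = (\<Sum>k<N. entry A i k * entry X k j)" for X i j
    by (rule entry_times) (simp add: N)
  show "A * B * C = A * (B * C)"
  proof (rule fsmat_eqI)
    fix i j
    have "entry (A * B * C) i j = (\<Sum>k<M. (\<Sum>l<N. entry A i l * entry B l k) * entry C k j)"
      by (simp add: eM eN)
    also have "\<dots> = (\<Sum>l<N. \<Sum>k<M. entry A i l * entry B l k * entry C k j)"
      by (subst sum.swap) (simp add: sum_distrib_right)
    also have "\<dots> = entry (A * (B * C)) i j"
      by (simp add: eM eN sum_distrib_left mult.assoc)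
    finally show "entry (A * B * C) i j = entry (A * (B * C)) i j" .
  qed
  show "(A + B) * C = A * C + B * C"
    by (rule fsmat_eqI) (simp add: eM plus_fsmat.rep_eq sum.distrib distrib_right)
  show "A * (B + C) = A * B + A * C"
    by (rule fsmat_eqI) (simp add: eN plus_fsmat.rep_eq sum.distrib distrib_left)
qed

end

lemma entry_0 [simp]: "entry 0 i j = 0" by (simp add: zero_fsmat.rep_eq)
lemma entry_add: "entry (A + B) i j = entry A i j + entry B i j" by (simp add: plus_fsmat.rep_eq)
lemma entry_uminus: "entry (- A) i j = - entry A i j" by (simp add: uminus_fsmat.rep_eq)
lemma entry_diff: "entry (A - B) i j = entry A i j - entry B i j"
  unfolding minus_fsmat_def entry_add entry_uminus by simp
lemma entry_sum: "entry (sum f S) i j = (\<Sum>x\<in>S. entry (f x) i j)"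
  by (induction S rule: infinite_finite_induct) (auto simp: entry_add)

lift_definition sc :: "complex \<Rightarrow> fsmat \<Rightarrow> fsmat" (infixr "*\<^sub>C" 75) is "\<lambda>c f i j. c * f i j"
  by auto

lemma entry_sc: "entry (c *\<^sub>C A) i j = c * entry A i j" by (simp add: sc.rep_eq)

interpretation fsvs: vector_space sc
  by unfold_locales (auto intro!: fsmat_eqI simp: entry_sc entry_add algebra_simps)

lemma sc_mult_left [simp]: "(c *\<^sub>C A) * B = c *\<^sub>C (A * B)"
proof -
  obtain N where "bounded_by N B" using bounded_by_exists by blast
  then show ?thesis
    by (intro fsmat_eqI) (simp add: entry_times[of N] entry_sc sum_distrib_left mult.assoc)
qed

lemma sc_mult_right [simp]: "A * (c *\<^sub>C B) = c *\<^sub>C (A * B)"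
proof -
  obtain N where "bounded_by N A" using bounded_by_exists by blast
  then show ?thesis
    by (intro fsmat_eqI) (simp add: entry_times[of N] entry_sc sum_distrib_left algebra_simps)
qed

lift_definition adj :: "fsmat \<Rightarrow> fsmat" is "\<lambda>f i j. cnj (f j i)" by auto

lemma entry_adj: "entry (adj A) i j = cnj (entry A j i)" by (simp add: adj.rep_eq)

lemma bounded_by_adj [simp]: "bounded_by N (adj A) = bounded_by N A"
  unfolding bounded_by_def entry_adj by auto

lemma adj_adj [simp]: "adj (adj A) = A" by (rule fsmat_eqI) (simp add: entry_adj)
lemma adj_0 [simp]: "adj 0 = 0" by (rule fsmat_eqI) (simp add: entry_adj)
lemma adj_add [simp]: "adj (A + B) = adj A + adj B" by (rule fsmat_eqI) (simp add: entry_adj entry_add)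
lemma adj_diff [simp]: "adj (A - B) = adj A - adj B" by (rule fsmat_eqI) (simp add: entry_adj entry_diff)
lemma adj_sc [simp]: "adj (c *\<^sub>C A) = cnj c *\<^sub>C adj A" by (rule fsmat_eqI) (simp add: entry_adj entry_sc)
lemma adj_sum [simp]: "adj (sum f S) = (\<Sum>x\<in>S. adj (f x))"
  by (rule fsmat_eqI) (simp add: entry_adj entry_sum)
lemma adj_mult [simp]: "adj (A * B) = adj B * adj A"
proof -
  obtain N where "bounded_by N A" using bounded_by_exists by blast
  then show ?thesis
    by (intro fsmat_eqI) (simp add: entry_times[of N] entry_adj mult.commute)
qed

lemma adj_inject: "adj A = adj B \<longleftrightarrow> A = B"
  by (metis adj_adj)

section \<open>Trace and the Hilbert-Schmidt norm\<close>

definition tr :: "fsmat \<Rightarrow> complex" where "tr A = (\<Sum>i | entry A i i \<noteq> 0. entry A i i)"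

lemma tr_eq: "bounded_by N A \<Longrightarrow> tr A = (\<Sum>i<N. entry A i i)"
  unfolding tr_def
  by (rule sum.mono_neutral_left) (auto simp: not_le[symmetric] dest: bounded_byD)

lemma bounded_by_add: "bounded_by N A \<Longrightarrow> bounded_by N B \<Longrightarrow> bounded_by N (A + B)"
  unfolding bounded_by_def by (auto simp: entry_add)
lemma bounded_by_sc: "bounded_by N A \<Longrightarrow> bounded_by N (c *\<^sub>C A)"
  unfolding bounded_by_def by (auto simp: entry_sc)
lemma bounded_by_mult: "bounded_by N A \<Longrightarrow> bounded_by N B \<Longrightarrow> bounded_by N (A * B)"
  unfolding bounded_by_def by (auto simp: entry_times[of N] bounded_by_def)
lemma bounded_by_fsmat_of: "n \<le> N \<Longrightarrow> p \<le> N \<Longrightarrow> bounded_by N (fsmat_of n p f)"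
  unfolding bounded_by_def by (auto simp: entry_fsmat_of)

lemma tr_0 [simp]: "tr 0 = 0" by (simp add: tr_def)
lemma tr_add: "tr (A + B) = tr A + tr B"
proof -
  obtain N where "bounded_by N A" "bounded_by N B" using bounded_by_exists2 by blast
  then show ?thesis by (simp add: tr_eq[of N] bounded_by_add entry_add sum.distrib)
qed
lemma tr_sc: "tr (c *\<^sub>C A) = c * tr A"
proof -
  obtain N where "bounded_by N A" using bounded_by_exists by blast
  then show ?thesis by (simp add: tr_eq[of N] bounded_by_sc entry_sc sum_distrib_left)
qed
lemma tr_uminus: "tr (- A) = - tr A"
  using tr_add[of A "- A"] by (simp add: eq_neg_iff_add_eq_0 add.commute)
lemma tr_diff: "tr (A - B) = tr A - tr B"
  using tr_add[of A "- B"] by (simp add: tr_uminus)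
lemma tr_sum: "tr (sum f S) = (\<Sum>x\<in>S. tr (f x))"
  by (induction S rule: infinite_finite_induct) (auto simp: tr_add)
lemma tr_mult_commute: "tr (A * B) = tr (B * A)"
proof -
  obtain N where N: "bounded_by N A" "bounded_by N B" using bounded_by_exists2 by blast
  have "tr (A * B) = (\<Sum>i<N. \<Sum>k<N. entry A i k * entry B k i)"
    by (simp add: tr_eq[OF bounded_by_mult[OF N]] entry_times[of N] N)
  also have "\<dots> = (\<Sum>k<N. \<Sum>i<N. entry B k i * entry A i k)"
    by (subst sum.swap) (simp add: mult.commute)
  also have "\<dots> = tr (B * A)"
    by (simp add: tr_eq[OF bounded_by_mult[OF N(2,1)]] entry_times[of N] N)
  finally show ?thesis .
qed
lemma tr_adj: "tr (adj A) = cnj (tr A)"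
proof -
  obtain N where "bounded_by N A" using bounded_by_exists by blast
  then show ?thesis by (simp add: tr_eq[of N] entry_adj)
qed

lemma tr_adj_mult_self:
  assumes "bounded_by N A"
  shows "tr (adj A * A) = complex_of_real (\<Sum>i<N. \<Sum>k<N. (cmod (entry A k i))\<^sup>2)"
proof -
  have "tr (adj A * A) = (\<Sum>i<N. \<Sum>k<N. cnj (entry A k i) * entry A k i)"
    using assms by (subst tr_eq[of N]) (auto simp: bounded_by_mult entry_times[of N] entry_adj)
  also have "\<dots> = complex_of_real (\<Sum>i<N. \<Sum>k<N. (cmod (entry A k i))\<^sup>2)"
    by (simp add: complex_norm_square mult.commute del: of_real_power)
  finally show ?thesis .
qed

lemma tr_adj_mult_self_nonneg: "0 \<le> tr (adj A * A)"
proof -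
  obtain N where "bounded_by N A" using bounded_by_exists by blast
  then show ?thesis by (simp add: tr_adj_mult_self less_eq_complex_def sum_nonneg)
qed

lemma tr_adj_mult_self_eq_0: "tr (adj A * A) = 0 \<longleftrightarrow> A = 0"
proof
  assume z: "tr (adj A * A) = 0"
  obtain N where N: "bounded_by N A" using bounded_by_exists by blast
  have "(\<Sum>i<N. \<Sum>k<N. (cmod (entry A k i))\<^sup>2) = 0"
    using z tr_adj_mult_self[OF N] of_real_eq_0_iff by metis
  then have "entry A k i = 0" if "i < N" "k < N" for i k
    using that by (simp add: sum_nonneg_eq_0_iff sum_nonneg)
  then show "A = 0" using N by (intro fsmat_eqI) (metis bounded_byD entry_0 not_le)
qed simp

lemma adj_mult_self_eq_0: "adj A * A = 0 \<longleftrightarrow> A = 0"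
  using tr_adj_mult_self_eq_0 by fastforce

lemma mult_adj_self_eq_0: "A * adj A = 0 \<longleftrightarrow> A = 0"
  using adj_mult_self_eq_0[of "adj A"] adj_inject[of A 0] by simp

section \<open>Matrix units and corner identities\<close>

definition mu :: "nat \<Rightarrow> nat \<Rightarrow> fsmat" where
  "mu i j = fsmat_of (Suc i) (Suc j) (\<lambda>k l. if k = i \<and> l = j then 1 else 0)"

lemma entry_mu: "entry (mu i j) k l = (if k = i \<and> l = j then 1 else 0)"
  unfolding mu_def entry_fsmat_of by auto

lemma adj_mu [simp]: "adj (mu i j) = mu j i"
  by (rule fsmat_eqI) (auto simp: entry_adj entry_mu)

lemma entry_mu_mult: "entry (mu i j * A) k l = (if k = i then entry A j l else 0)"
proof -
  have "bounded_by (Suc (max i j)) (mu i j)" unfolding mu_def by (rule bounded_by_fsmat_of) auto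
  then show ?thesis by (simp add: entry_times[of "Suc (max i j)"] entry_mu if_distrib[of "\<lambda>x. x * _"] if_distribR cong: if_cong)
qed

lemma entry_mult_mu: "entry (A * mu i j) k l = (if l = j then entry A k i else 0)"
proof -
  have "bounded_by (Suc (max i j)) (mu i j)" unfolding mu_def by (rule bounded_by_fsmat_of) auto
  then show ?thesis by (simp add: entry_times[of "Suc (max i j)"] entry_mu if_distrib[of "\<lambda>x. _ * x"] if_distribR cong: if_cong)
qed

lemma mu_mult_mu: "mu i j * mu k l = (if j = k then mu i l else 0)"
  by (rule fsmat_eqI) (auto simp: entry_mult_mu entry_mu)

lemma tr_mu: "tr (mu i j) = (if i = j then 1 else 0)"
proof -
  have "bounded_by (Suc (max i j)) (mu i j)" unfolding mu_def by (rule bounded_by_fsmat_of) auto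
  then show ?thesis by (simp add: tr_eq entry_mu)
qed

lemma tr_mult_mu: "tr (A * mu i j) = entry A j i"
proof -
  obtain N where N: "bounded_by N A" using bounded_by_exists by blast
  let ?M = "max N (Suc (max i j))"
  have "bounded_by ?M A" "bounded_by ?M (mu i j)"
    using N unfolding mu_def by (auto intro: bounded_by_mono bounded_by_fsmat_of)
  then have "bounded_by ?M (A * mu i j)" by (rule bounded_by_mult)
  then show ?thesis by (simp add: tr_eq entry_mult_mu)
qed

text \<open>The ring has no unit. \<open>idp n\<close> is the identity of the corner of n x n
  matrices, and being fixed by it on both sides replaces a carrier condition.\<close>

definition idp :: "nat \<Rightarrow> fsmat" where "idp n = fsmat_of n n (\<lambda>i j. if i = j then 1 else 0)"

lemma entry_idp: "entry (idp n) i j = (if i = j \<and> i < n then 1 else 0)"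
  unfolding idp_def entry_fsmat_of by auto

lemma bounded_by_idp: "bounded_by n (idp n)" by (simp add: bounded_by_def entry_idp)

lemma entry_idp_mult: "entry (idp n * A) i j = (if i < n then entry A i j else 0)"
  by (simp add: entry_times[of n] bounded_by_idp entry_idp if_distrib[of "\<lambda>x. x * _"] if_distribR cong: if_cong)
lemma entry_mult_idp: "entry (A * idp n) i j = (if j < n then entry A i j else 0)"
  by (simp add: entry_times[of n] bounded_by_idp entry_idp if_distrib[of "\<lambda>x. _ * x"] if_distribR cong: if_cong)

lemma adj_idp [simp]: "adj (idp n) = idp n" by (rule fsmat_eqI) (auto simp: entry_adj entry_idp)
lemma idp_idp [simp]: "idp n * idp n = idp n" by (rule fsmat_eqI) (auto simp: entry_idp_mult entry_idp)
lemma tr_idp: "tr (idp n) = of_nat n" by (simp add: tr_eq[OF bounded_by_idp] entry_idp)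
lemma bounded_by_iff_idp: "bounded_by n A \<longleftrightarrow> idp n * A = A \<and> A * idp n = A"
proof
  assume "bounded_by n A"
  then show "idp n * A = A \<and> A * idp n = A"
    by (auto intro!: fsmat_eqI simp: entry_idp_mult entry_mult_idp bounded_byD)
next
  assume h: "idp n * A = A \<and> A * idp n = A"
  show "bounded_by n A"
    unfolding bounded_by_def by (metis entry_idp_mult entry_mult_idp h not_le)
qed

lemma idp_eq_sum_mu: "idp n = (\<Sum>i<n. mu i i)"
  by (rule fsmat_eqI) (auto simp: entry_idp entry_sum entry_mu if_distrib[of "\<lambda>x. _ \<and> x"] cong: if_cong intro!: sum.neutral)

lemma bounded_by_eq_sum_mu:
  assumes "bounded_by n A"
  shows "A = (\<Sum>i<n. \<Sum>j<n. entry A i j *\<^sub>C mu i j)"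
proof (rule fsmat_eqI)
  fix k l
  have "entry (\<Sum>i<n. \<Sum>j<n. entry A i j *\<^sub>C mu i j) k l
      = (\<Sum>i<n. \<Sum>j<n. if l = j then (if k = i then entry A i j else 0) else 0)"
    unfolding entry_sum entry_sc entry_mu by (intro sum.cong refl) auto
  also have "\<dots> = (if k < n \<and> l < n then entry A k l else 0)"
    by (cases "l < n"; cases "k < n") (simp_all cong: if_cong)
  finally show "entry A k l = entry (\<Sum>i<n. \<Sum>j<n. entry A i j *\<^sub>C mu i j) k l"
    using assms by (auto simp: bounded_by_def)
qed

subsection \<open>Positivity and the spectral theorem\<close>

text \<open>\<open>tr (adj B * A * B)\<close> is the sum of the quadratic form of \<open>A\<close>
  over the columns of \<open>B\<close>, so this is positive semidefiniteness expressed without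
  vectors.\<close>

definition pos :: "fsmat \<Rightarrow> bool" where
  "pos A \<longleftrightarrow> adj A = A \<and> (\<forall>B. 0 \<le> tr (adj B * A * B))"

definition proj :: "fsmat \<Rightarrow> bool" where "proj p \<longleftrightarrow> adj p = p \<and> p * p = p"

lemma pos_adj: "pos A \<Longrightarrow> adj A = A" by (simp add: pos_def)
lemma proj_adj: "proj p \<Longrightarrow> adj p = p" by (simp add: proj_def)
lemma proj_idem: "proj p \<Longrightarrow> p * p = p" by (simp add: proj_def)

lemma pos_conj: "pos A \<Longrightarrow> pos (adj C * A * C)"
  unfolding pos_def by (metis adj_adj adj_mult mult.assoc)

lemma pos_conj': "pos A \<Longrightarrow> pos (C * A * adj C)"
  using pos_conj[of A "adj C"] by simp

lemma pos_adj_mult: "pos (adj C * C)"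
  unfolding pos_def by (metis adj_adj adj_mult mult.assoc tr_adj_mult_self_nonneg)

lemma pos_mult_adj: "pos (C * adj C)"
  using pos_adj_mult[of "adj C"] by simp

lemma pos_0 [simp]: "pos 0" by (simp add: pos_def)

lemma pos_add: "pos A \<Longrightarrow> pos B \<Longrightarrow> pos (A + B)"
  unfolding pos_def by (simp add: distrib_left distrib_right tr_add)

lemma pos_sum: "(\<And>x. x \<in> S \<Longrightarrow> pos (f x)) \<Longrightarrow> pos (sum f S)"
  by (induction S rule: infinite_finite_induct) (auto intro: pos_add)

lemma pos_sc: "pos A \<Longrightarrow> 0 \<le> r \<Longrightarrow> pos (complex_of_real r *\<^sub>C A)"
  unfolding pos_def by (simp add: tr_sc less_eq_complex_def)

lemma pos_proj: "proj p \<Longrightarrow> pos p"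
  using pos_adj_mult[of p] by (simp add: proj_def)

lemma pos_tr: "pos A \<Longrightarrow> 0 \<le> tr A"
proof -
  assume A: "pos A"
  obtain N where N: "bounded_by N A" using bounded_by_exists by blast
  have "0 \<le> tr (adj (idp N) * A * idp N)" using A unfolding pos_def by blast
  then show ?thesis using N unfolding bounded_by_iff_idp by simp
qed

lemma proj_diff:
  assumes "proj p" "proj q" "q * p = p"
  shows "proj (q - p)"
proof -
  have "p * q = p" using assms by (metis adj_mult proj_def)
  then show ?thesis using assms by (simp add: proj_def left_diff_distrib right_diff_distrib)
qed

lemma tr_proj_nonneg: "proj p \<Longrightarrow> 0 \<le> tr p"
  by (simp add: pos_proj pos_tr)

lemma tr_proj_eq_0: "proj p \<Longrightarrow> tr p = 0 \<longleftrightarrow> p = 0"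
  using tr_adj_mult_self_eq_0[of p] by (simp add: proj_def)

section \<open>Orthonormal systems and spectral decomposition\<close>

lemma mu_sandwich: "mu i i * A * mu j j = entry A i j *\<^sub>C mu i j"
  by (rule fsmat_eqI) (auto simp: entry_mu_mult entry_mult_mu entry_mu entry_sc)

text \<open>Vectors are matrices supported in column 0, that is \<open>u * mu 0 0 = u\<close>. Then
  \<open>adj u * w\<close> is the inner product times \<open>mu 0 0\<close> and
  \<open>u * adj w\<close> is the outer product, all inside one ring.\<close>

definition orthonormal :: "nat \<Rightarrow> (nat \<Rightarrow> fsmat) \<Rightarrow> bool" where
  "orthonormal n u \<longleftrightarrow> (\<forall>i<n. u i * mu 0 0 = u i) \<and>
     (\<forall>i<n. \<forall>j<n. adj (u i) * u j = (if i = j then mu 0 0 else 0))"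

text \<open>There are \<open>card T + 1\<close> indices for a span of dimension at most
  \<open>card T\<close>. Dependence is a property of sets, so a family that repeats a value is
  handled apart, by the difference of two equal terms.\<close>

lemma linear_relation:
  assumes T: "finite T" and x: "\<And>i. x i \<in> fsvs.span T"
  shows "\<exists>c. (\<exists>i\<le>card T. c i \<noteq> 0) \<and> (\<Sum>i\<le>card T. c i *\<^sub>C x i) = 0"
proof (cases "inj_on x {..card T}")
  case True
  have "card (x ` {..card T}) = Suc (card T)" using True by (simp add: card_image)
  then have "fsvs.dependent (x ` {..card T})"
    using fsvs.independent_span_bound[OF T, of "x ` {..card T}"] x by fastforce
  then obtain u where u: "\<exists>v\<in>x ` {..card T}. u v \<noteq> 0" "(\<Sum>v\<in>x ` {..card T}. u v *\<^sub>C v) = 0"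
    by (subst (asm) fsvs.dependent_finite) auto
  then show ?thesis
    by (intro exI[of _ "\<lambda>i. u (x i)"]) (auto simp: sum.reindex[OF True])
next
  case False
  then obtain i j where ij: "i \<le> card T" "j \<le> card T" "i \<noteq> j" "x i = x j"
    unfolding inj_on_def by auto
  define c where "c k = (if k = i then 1 else if k = j then -1 else (0::complex))" for k
  have "(\<Sum>k\<le>card T. c k *\<^sub>C x k) = (\<Sum>k\<in>{i,j}. c k *\<^sub>C x k)"
    by (rule sum.mono_neutral_right) (use ij in \<open>auto simp: c_def\<close>)
  also have "\<dots> = 0" using ij by (simp add: c_def)
  finally show ?thesis using ij by (intro exI[of _ c]) (auto simp: c_def)
qed

text \<open>A root \<open>z\<close> of the annihilator gives \<open>q = (X - z) r\<close>. Either
  \<open>r\<close> already annihilates the sequence, with smaller degree, or \<open>r(h) p 0\<close>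
  is a nonzero eigenvector for \<open>z\<close>. Degree 0 is excluded because \<open>p 0\<close> is
  nonzero.\<close>

lemma eigenvector_of_annihilator:
  fixes p :: "nat \<Rightarrow> fsmat" and h :: fsmat and q :: "complex poly"
  assumes "q \<noteq> 0" "(\<Sum>i\<le>degree q. coeff q i *\<^sub>C p i) = 0"
    and "\<And>i. p (Suc i) = h * p i" and "p 0 \<noteq> 0"
  shows "\<exists>(c::nat \<Rightarrow> complex) n z. h * (\<Sum>i\<le>n. c i *\<^sub>C p i) = z *\<^sub>C (\<Sum>i\<le>n. c i *\<^sub>C p i) \<and>
    (\<Sum>i\<le>(n::nat). c i *\<^sub>C p i) \<noteq> 0"
  using assms(1,2)
proof (induction "degree q" arbitrary: q rule: less_induct)
  case (less q)
  show ?case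
  proof (cases "degree q = 0")
    case True
    with less.prems have "coeff q 0 \<noteq> 0" by (metis leading_coeff_0_iff)
    with less.prems True assms(4) show ?thesis by simp
  next
    case False
    then have "\<not> constant (poly q)" by (simp add: constant_degree)
    then obtain z where "poly q z = 0" using fundamental_theorem_of_algebra by blast
    then obtain r where r: "q = [:- z, 1:] * r" by (auto simp: poly_eq_0_iff_dvd)
    have r0: "r \<noteq> 0" using r less.prems by auto
    then have dq: "degree q = Suc (degree r)" unfolding r by (subst degree_mult_eq) auto
    let ?w = "\<Sum>i\<le>degree r. coeff r i *\<^sub>C p i"
    have q: "q = smult (- z) r + pCons 0 r" using r by simp
    have "0 = (\<Sum>i\<le>Suc (degree r). coeff q i *\<^sub>C p i)" using less.prems dq by simp
    also have "\<dots> = (\<Sum>i\<le>Suc (degree r). (- z * coeff r i) *\<^sub>C p i)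
        + (\<Sum>i\<le>Suc (degree r). coeff (pCons 0 r) i *\<^sub>C p i)"
      unfolding q by (simp only: coeff_add coeff_smult fsvs.scale_left_distrib sum.distrib)
    also have "(\<Sum>i\<le>Suc (degree r). (- z * coeff r i) *\<^sub>C p i) = - z *\<^sub>C ?w"
      by (simp add: coeff_eq_0 fsvs.scale_sum_right)
    also have "(\<Sum>i\<le>Suc (degree r). coeff (pCons 0 r) i *\<^sub>C p i) = h * ?w"
      by (subst sum.atMost_Suc_shift) (simp add: assms(3) sum_distrib_left)
    finally have "0 = - z *\<^sub>C ?w + h * ?w" .
    from minus_unique[OF this[symmetric]] have ev: "h * ?w = z *\<^sub>C ?w"
      unfolding fsvs.scale_minus_left minus_minus by (rule sym)
    show ?thesis
    proof (cases "?w = 0")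
      case True
      then show ?thesis using less.hyps[of r] r0 dq by simp
    next
      case False
      then show ?thesis using ev by blast
    qed
  qed
qed

text \<open>The Krylov sequence starts at \<open>h * v\<close> instead of \<open>v\<close>, so every
  combination of its members has the form \<open>h * x\<close>. An eigenvector
  \<open>w = h * x\<close> with eigenvalue 0 would satisfy
  \<open>adj w * w = adj x * h * w = 0\<close>. Nonzero eigenvalues are what is wanted, since a
  finitely supported matrix has an infinite-dimensional kernel.\<close>

lemma hermitian_eigenvector:
  assumes h: "adj h = h" "h \<noteq> 0"
  shows "\<exists>(d::real) w. d \<noteq> 0 \<and> w * mu 0 0 = w \<and> adj w * w = mu 0 0 \<and> h * w = complex_of_real d *\<^sub>C w"
proof -
  obtain i0 j0 where ij: "entry h i0 j0 \<noteq> 0" using h(2) fsmat_eqI by (metis entry_0)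
  define v where "v = mu j0 0"
  define y where "y k = ((*) h ^^ k) v" for k
  define p where "p k = h * y k" for k
  have pS: "p (Suc k) = h * p k" for k by (simp add: p_def y_def)
  have "entry (p 0) i0 0 = entry h i0 j0" by (simp add: p_def y_def v_def entry_mult_mu)
  then have p0: "p 0 \<noteq> 0" using ij by auto
  obtain N where N: "bounded_by N h" "bounded_by N v" using bounded_by_exists2 by blast
  have yb: "bounded_by N (y k)" for k
    by (induction k) (auto simp: y_def N bounded_by_mult)
  define T where "T = (\<lambda>(i,j). mu i j) ` ({..<N} \<times> {..<N})"
  have T: "finite T" by (simp add: T_def)
  have "p k \<in> fsvs.span T" for k
  proof -
    have "bounded_by N (p k)" unfolding p_def using yb N by (blast intro: bounded_by_mult)
    then show ?thesis
      by (subst bounded_by_eq_sum_mu, assumption)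
         (intro fsvs.span_sum fsvs.span_scale fsvs.span_base, auto simp: T_def)
  qed
  then have "\<exists>c. (\<exists>i\<le>card T. c i \<noteq> 0) \<and> (\<Sum>i\<le>card T. c i *\<^sub>C p i) = 0"
    by (rule linear_relation[OF T])
  then obtain c where c: "\<exists>i\<le>card T. c i \<noteq> 0" "(\<Sum>i\<le>card T. c i *\<^sub>C p i) = 0"
    by (elim exE[where P = "\<lambda>c. (\<exists>i\<le>card T. c i \<noteq> 0) \<and> _ c"] conjE) (rule that)
  define q where "q = (\<Sum>i\<le>card T. monom (c i) i)"
  have cq: "coeff q i = (if i \<le> card T then c i else 0)" for i
    by (simp add: q_def coeff_sum)
  have q0: "q \<noteq> 0" using c(1) cq by (metis coeff_0)
  have dq: "degree q \<le> card T" by (rule degree_le) (simp add: cq)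
  have "(\<Sum>i\<le>degree q. coeff q i *\<^sub>C p i) = (\<Sum>i\<le>card T. coeff q i *\<^sub>C p i)"
    by (rule sum.mono_neutral_left) (use dq in \<open>auto simp: coeff_eq_0\<close>)
  also have "\<dots> = 0" using c(2) by (simp add: cq)
  finally have "(\<Sum>i\<le>degree q. coeff q i *\<^sub>C p i) = 0" .
  from eigenvector_of_annihilator[OF q0 this pS p0] obtain c' n z where w: "h * (\<Sum>i\<le>n. c' i *\<^sub>C p i) = z *\<^sub>C (\<Sum>i\<le>n. c' i *\<^sub>C p i)"
    "(\<Sum>i\<le>n. c' i *\<^sub>C p i) \<noteq> 0"
    by (elim exE conjE) (rule that)
  define w where "w = (\<Sum>i\<le>n. c' i *\<^sub>C p i)"
  have hw: "h * w = z *\<^sub>C w" and w0: "w \<noteq> 0" using w by (auto simp: w_def)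
  define x where "x = (\<Sum>i\<le>n. c' i *\<^sub>C y i)"
  have wx: "w = h * x" by (simp add: w_def x_def p_def sum_distrib_left)
  have yv: "y k * mu 0 0 = y k" for k
    by (induction k) (auto simp: y_def v_def mu_mult_mu mult.assoc)
  have wv: "w * mu 0 0 = w" unfolding w_def p_def by (simp add: sum_distrib_right mult.assoc yv)
  have z0: "z \<noteq> 0"
  proof
    assume "z = 0"
    then have "adj w * w = 0" using hw wx h by (metis adj_mult fsvs.scale_zero_left mult.assoc mult_zero_right)
    then show False using w0 adj_mult_self_eq_0 by blast
  qed
  define k where "k = tr (adj w * w)"
  have k: "k \<noteq> 0" "0 \<le> k" using w0 tr_adj_mult_self_eq_0 tr_adj_mult_self_nonneg by (auto simp: k_def)
  have "tr (adj w * (h * w)) = z * k" by (simp add: hw tr_sc k_def)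
  moreover have "cnj (tr (adj w * (h * w))) = tr (adj w * (h * w))"
    unfolding tr_adj[symmetric] by (simp add: h mult.assoc)
  moreover have "cnj k = k" using k by (simp add: less_eq_complex_def complex_eq_iff)
  ultimately have "cnj z = z" using k by (metis complex_cnj_mult mult_cancel_right)
  then have zr: "z = complex_of_real (Re z)" by (simp add: complex_eq_iff)
  have "adj w * w = mu 0 0 * (adj w * w) * mu 0 0"
    by (metis adj_mu adj_mult mult.assoc wv)
  then have ww: "adj w * w = entry (adj w * w) 0 0 *\<^sub>C mu 0 0" by (metis mu_sandwich)
  then have "k = entry (adj w * w) 0 0" unfolding k_def by (metis mult.right_neutral tr_mu tr_sc)
  with ww have ww: "adj w * w = k *\<^sub>C mu 0 0" by simp
  define r where "r = complex_of_real (1 / sqrt (Re k))"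
  have Rk: "k = complex_of_real (Re k)" "Re k > 0"
    using k by (auto simp: less_eq_complex_def complex_eq_iff less_le)
  have "cnj r * r * k = 1"
  proof -
    have "1 / sqrt (Re k) * (1 / sqrt (Re k)) = 1 / Re k" using Rk by simp
    then have "cnj r * r = complex_of_real (1 / Re k)"
      unfolding r_def complex_cnj_complex_of_real of_real_mult[symmetric] by simp
    moreover have "complex_of_real (1 / Re k) * complex_of_real (Re k) = 1"
      unfolding of_real_mult[symmetric] using Rk(2) by simp
    ultimately have "cnj r * r * k = 1" using Rk(1) by simp
    then show ?thesis .
  qed
  then have "adj (r *\<^sub>C w) * (r *\<^sub>C w) = mu 0 0" using ww by (simp add: mult.assoc mult.left_commute)
  then show ?thesis
    by (intro exI[of _ "Re z"] exI[of _ "r *\<^sub>C w"]) (use z0 zr hw wv in \<open>auto simp: mult.commute\<close>)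
qed

lemma orthonormal_proj:
  assumes "orthonormal n u"
  defines "P \<equiv> \<Sum>i<n. u i * adj (u i)"
  shows "proj P" "tr P = of_nat n" "\<And>i. i < n \<Longrightarrow> P * u i = u i"
proof -
  have u: "u i * mu 0 0 = u i" if "i < n" for i using assms that by (auto simp: orthonormal_def)
  have uu: "adj (u i) * u j = (if i = j then mu 0 0 else 0)" if "i < n" "j < n" for i j
    using assms that by (auto simp: orthonormal_def)
  show Pu: "P * u i = u i" if "i < n" for i
  proof -
    have "P * u i = (\<Sum>j<n. u j * (adj (u j) * u i))"
      unfolding P_def by (simp add: sum_distrib_right mult.assoc)
    also have "\<dots> = (\<Sum>j<n. if j = i then u i else 0)"
      by (rule sum.cong) (use that uu u in auto)
    also have "\<dots> = u i" using that by simp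
    finally show ?thesis .
  qed
  have "P * P = (\<Sum>i<n. P * u i * adj (u i))"
    by (subst (2) P_def) (simp add: sum_distrib_left mult.assoc)
  also have "\<dots> = (\<Sum>i<n. u i * adj (u i))" by (simp add: Pu)
  also have "\<dots> = P" by (simp only: P_def)
  finally show "proj P" by (simp add: proj_def P_def)
  have "tr P = (\<Sum>i<n. tr (adj (u i) * u i))"
    unfolding P_def tr_sum by (rule sum.cong) (auto simp: tr_mult_commute[of "u _"])
  also have "\<dots> = of_nat n" by (simp add: uu tr_mu)
  finally show "tr P = of_nat n" .
qed

text \<open>Take a longest orthonormal system of eigenvectors with nonzero eigenvalues; its length
  is bounded by the size of \<open>h\<close>, as its range projection lies below
  \<open>idp N\<close>. The remainder \<open>g\<close> is Hermitian with range orthogonal to the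
  system, so an eigenvector of \<open>g\<close> would be one of \<open>h\<close> and would lengthen
  the system; hence \<open>g = 0\<close>.\<close>

lemma spectral_theorem:
  assumes h: "adj h = h"
  shows "\<exists>n u (d::nat \<Rightarrow> real). orthonormal n u \<and> (\<forall>i<n. d i \<noteq> 0) \<and>
    h = (\<Sum>i<n. complex_of_real (d i) *\<^sub>C (u i * adj (u i)))"
proof -
  define Q where "Q n u d \<longleftrightarrow> orthonormal n u \<and> (\<forall>i<n. d i \<noteq> 0) \<and>
    (\<forall>i<n. h * u i = complex_of_real (d i) *\<^sub>C u i)" for n u and d :: "nat \<Rightarrow> real"
  obtain N where N: "bounded_by N h" using bounded_by_exists by blast
  have bound: "n \<le> N" if Q: "Q n u d" for n u d
  proof -
    have Iu: "idp N * u i = u i" if "i < n" for i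
    proof -
      have "complex_of_real (d i) *\<^sub>C (idp N * u i) = (idp N * h) * u i"
        using Q that unfolding Q_def by (simp add: mult.assoc)
      also have "\<dots> = complex_of_real (d i) *\<^sub>C u i"
        using N Q that unfolding bounded_by_iff_idp Q_def by simp
      finally show ?thesis using Q that unfolding Q_def by simp
    qed
    let ?P = "\<Sum>i<n. u i * adj (u i)"
    have o: "orthonormal n u" using Q by (simp add: Q_def)
    have "idp N * ?P = ?P" by (simp add: sum_distrib_left Iu mult.assoc[symmetric])
    then have "proj (idp N - ?P)"
      using orthonormal_proj[OF o] by (intro proj_diff) (auto simp: proj_def)
    then have "0 \<le> tr (idp N - ?P)" by (rule tr_proj_nonneg)
    then show "n \<le> N" by (simp add: tr_diff tr_idp orthonormal_proj(2)[OF o] less_eq_complex_def)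
  qed
  have Q0: "\<exists>u d. Q 0 u d" by (simp add: Q_def orthonormal_def)
  define n where "n = (GREATEST n. \<exists>u d. Q n u d)"
  have "\<exists>u d. Q n u d" unfolding n_def by (rule GreatestI_nat[where k = 0 and b = N]) (use bound Q0 in blast)+
  then obtain u d where Q: "Q n u d" by blast
  have nS: "\<not> Q (Suc n) u' d'" for u' d'
    using Greatest_le_nat[of "\<lambda>n. \<exists>u d. Q n u d" "Suc n" N] bound unfolding n_def[symmetric] by fastforce
  have u: "u i * mu 0 0 = u i" if "i < n" for i using Q that by (auto simp: Q_def orthonormal_def)
  have uu: "adj (u i) * u j = (if i = j then mu 0 0 else 0)" if "i < n" "j < n" for i j
    using Q that by (auto simp: Q_def orthonormal_def)
  have hu: "h * u i = complex_of_real (d i) *\<^sub>C u i" if "i < n" for i using Q that by (simp add: Q_def)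
  have uh: "adj (u i) * h = complex_of_real (d i) *\<^sub>C adj (u i)" if "i < n" for i
    using arg_cong[OF hu[OF that], of adj] by (simp add: h)
  define g where "g = h - (\<Sum>i<n. complex_of_real (d i) *\<^sub>C (u i * adj (u i)))"
  have ug: "adj (u i) * g = 0" if "i < n" for i
  proof -
    have "adj (u i) * (\<Sum>j<n. complex_of_real (d j) *\<^sub>C (u j * adj (u j)))
      = (\<Sum>j<n. complex_of_real (d j) *\<^sub>C ((adj (u i) * u j) * adj (u j)))"
      by (simp add: sum_distrib_left mult.assoc)
    also have "\<dots> = (\<Sum>j<n. if j = i then complex_of_real (d i) *\<^sub>C adj (u i) else 0)"
    proof (rule sum.cong)
      fix j assume "j \<in> {..<n}"
      have "mu 0 0 * adj (u i) = adj (u i)" using arg_cong[OF u[OF that], of adj] by simp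
      then show "complex_of_real (d j) *\<^sub>C ((adj (u i) * u j) * adj (u j)) =
        (if j = i then complex_of_real (d i) *\<^sub>C adj (u i) else 0)"
        using uu[OF that] \<open>j \<in> _\<close> by auto
    qed simp
    also have "\<dots> = adj (u i) * h" using that by (simp add: uh)
    finally show ?thesis by (simp add: g_def right_diff_distrib)
  qed
  have "g = 0"
  proof (rule ccontr)
    assume "g \<noteq> 0"
    moreover have "adj g = g" by (simp add: g_def h)
    ultimately obtain z w where w: "z \<noteq> 0" "w * mu 0 0 = w" "adj w * w = mu 0 0" "g * w = complex_of_real z *\<^sub>C w"
      using hermitian_eigenvector by blast
    have uw: "adj (u i) * w = 0" if "i < n" for i
    proof -
      have "complex_of_real z *\<^sub>C (adj (u i) * w) = adj (u i) * g * w" using w by (simp add: mult.assoc)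
      then show ?thesis using ug[OF that] w by simp
    qed
    have wu: "adj w * u i = 0" if "i < n" for i
      using arg_cong[OF uw[OF that], of adj] by simp
    have "h * w = g * w + (\<Sum>i<n. complex_of_real (d i) *\<^sub>C (u i * (adj (u i) * w)))"
      by (simp add: g_def left_diff_distrib sum_distrib_right mult.assoc)
    then have hw: "h * w = complex_of_real z *\<^sub>C w" using w uw by simp
    have "Q (Suc n) (u(n := w)) (d(n := z))"
      using w hw uw wu u uu hu Q unfolding Q_def orthonormal_def
      by (auto simp: less_Suc_eq)
    then show False using nS by blast
  qed
  then show ?thesis using Q unfolding g_def Q_def by auto
qed

text \<open>Only nonzero eigenvalues are listed, so the \<open>E x\<close> add up to the support
  projection of \<open>h\<close> and not to an identity.\<close>

definition spectral :: "fsmat \<Rightarrow> real set \<Rightarrow> (real \<Rightarrow> fsmat) \<Rightarrow> bool" where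
  "spectral h L E \<longleftrightarrow> finite L \<and> 0 \<notin> L \<and> (\<forall>x\<in>L. proj (E x) \<and> E x \<noteq> 0) \<and>
     (\<forall>x\<in>L. \<forall>y\<in>L. x \<noteq> y \<longrightarrow> E x * E y = 0) \<and> h = (\<Sum>x\<in>L. complex_of_real x *\<^sub>C E x)"

lemma spectral_mult:
  assumes "spectral h L E" "x \<in> L" "y \<in> L"
  shows "E x * E y = (if x = y then E x else 0)"
  using assms unfolding spectral_def proj_def by auto

lemma spectral_exists:
  assumes h: "adj h = h"
  shows "\<exists>L E. spectral h L E"
proof -
  obtain n u and d :: "nat \<Rightarrow> real" where o: "orthonormal n u" and d: "\<And>i. i < n \<Longrightarrow> d i \<noteq> 0"
    and hh: "h = (\<Sum>i<n. complex_of_real (d i) *\<^sub>C (u i * adj (u i)))"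
    using spectral_theorem[OF h] by blast
  define P where "P i = u i * adj (u i)" for i
  have PP: "P i * P j = (if i = j then P i else 0)" if "i < n" "j < n" for i j
  proof -
    have "P i * P j = u i * (adj (u i) * u j) * adj (u j)" by (simp add: P_def mult.assoc)
    also have "\<dots> = (if i = j then u i * mu 0 0 * adj (u j) else 0)"
      using o that unfolding orthonormal_def by auto
    also have "\<dots> = (if i = j then P i else 0)"
      using o that unfolding orthonormal_def P_def by auto
    finally show ?thesis .
  qed
  have P0: "P i \<noteq> 0" if "i < n" for i
  proof
    assume "P i = 0"
    then have "P i * u i = 0" by simp
    then have "u i * (adj (u i) * u i) = 0" by (simp add: P_def mult.assoc)
    then have "u i = 0" using o that unfolding orthonormal_def by simp
    then have "mu 0 0 = 0" using o that unfolding orthonormal_def by force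
    then show False using tr_mu[of 0 0] by simp
  qed
  have aP: "adj (P i) = P i" for i by (simp add: P_def)
  define L where "L = d ` {..<n}"
  define E where "E x = (\<Sum>i | i < n \<and> d i = x. P i)" for x
  have EE: "E x * E y = (if x = y then E x else 0)" for x y
  proof -
    have "E x * E y = (\<Sum>i | i < n \<and> d i = x. \<Sum>j | j < n \<and> d j = y. P i * P j)"
      by (simp add: E_def sum_product)
    also have "\<dots> = (\<Sum>i | i < n \<and> d i = x. if x = y then P i else 0)"
    proof (rule sum.cong)
      fix i assume i: "i \<in> {i. i < n \<and> d i = x}"
      have "(\<Sum>j | j < n \<and> d j = y. P i * P j) = (\<Sum>j | j < n \<and> d j = y. if i = j then P i else 0)"
        by (rule sum.cong) (use i PP in auto)
      also have "\<dots> = (if x = y then P i else 0)" using i by (auto simp: sum.delta)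
      finally show "(\<Sum>j | j < n \<and> d j = y. P i * P j) = (if x = y then P i else 0)" .
    qed simp
    also have "\<dots> = (if x = y then E x else 0)" by (simp add: E_def)
    finally show ?thesis .
  qed
  have "h = (\<Sum>x\<in>L. \<Sum>i | i \<in> {..<n} \<and> d i = x. complex_of_real (d i) *\<^sub>C P i)"
    unfolding hh L_def P_def[symmetric] by (rule sum.image_gen) simp
  also have "\<dots> = (\<Sum>x\<in>L. complex_of_real x *\<^sub>C E x)"
    unfolding E_def fsvs.scale_sum_right by (intro sum.cong) auto
  finally have hE: "h = (\<Sum>x\<in>L. complex_of_real x *\<^sub>C E x)" .
  have "E x \<noteq> 0" if "x \<in> L" for x
  proof -
    obtain i where i: "i < n" "d i = x" using \<open>x \<in> L\<close> unfolding L_def by auto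
    have "P i * E x = (\<Sum>j | j < n \<and> d j = x. if i = j then P i else 0)"
      unfolding E_def sum_distrib_left by (rule sum.cong) (use i PP in auto)
    also have "\<dots> = P i" using i by (auto simp: sum.delta)
    finally show ?thesis using P0[OF i(1)] by auto
  qed
  then have "spectral h L E"
    unfolding spectral_def proj_def using hE EE d by (auto simp: L_def E_def aP)
  then show ?thesis by blast
qed

lemma spectral_mult_left:
  assumes "spectral h L E" "x \<in> L"
  shows "h * E x = complex_of_real x *\<^sub>C E x" "E x * h = complex_of_real x *\<^sub>C E x"
proof -
  have f: "finite L" and h: "h = (\<Sum>x\<in>L. complex_of_real x *\<^sub>C E x)" using assms by (auto simp: spectral_def)
  have "h * E x = (\<Sum>y\<in>L. if y = x then complex_of_real x *\<^sub>C E x else 0)"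
    unfolding h sum_distrib_right by (rule sum.cong) (use assms in \<open>auto simp: spectral_mult\<close>)
  then show "h * E x = complex_of_real x *\<^sub>C E x" using f assms by simp
  have "E x * h = (\<Sum>y\<in>L. if y = x then complex_of_real x *\<^sub>C E x else 0)"
    unfolding h sum_distrib_left by (rule sum.cong) (use assms in \<open>auto simp: spectral_mult\<close>)
  then show "E x * h = complex_of_real x *\<^sub>C E x" using f assms by simp
qed

text \<open>Compressing \<open>y * h = h * y\<close> by two spectral projections multiplies one
  block by two different eigenvalues, so off-diagonal blocks vanish. As \<open>y\<close> is
  arbitrary and the kernel of \<open>h\<close> has no projection in the list, both kinds of blocks
  are treated, and \<open>y * E x\<close> and \<open>E x * y\<close> are recovered through
  \<open>h\<close>.\<close>

lemma spectral_commute: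
  assumes s: "spectral h L E" and x: "x \<in> L" and y: "y * h = h * y"
  shows "y * E x = E x * y"
proof -
  have f: "finite L" and h: "h = (\<Sum>x\<in>L. complex_of_real x *\<^sub>C E x)" and x0: "x \<noteq> 0"
    using s x by (auto simp: spectral_def)
  have *: "E z * y * E x = 0" if z: "z \<in> L" "z \<noteq> x" for z
  proof -
    have "E z * (y * h) * E x = complex_of_real x *\<^sub>C (E z * y * E x)"
      by (simp add: mult.assoc spectral_mult_left[OF s x])
    moreover have "E z * (h * y) * E x = complex_of_real z *\<^sub>C (E z * y * E x)"
      by (simp add: mult.assoc[symmetric] spectral_mult_left[OF s z(1)])
    ultimately have "complex_of_real x *\<^sub>C (E z * y * E x) = complex_of_real z *\<^sub>C (E z * y * E x)" using y by metis
    then show ?thesis using z by (metis fsvs.scale_cancel_right of_real_eq_iff)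
  qed
  have **: "E x * y * E z = 0" if z: "z \<in> L" "z \<noteq> x" for z
  proof -
    have "E x * (y * h) * E z = complex_of_real z *\<^sub>C (E x * y * E z)"
      by (simp add: mult.assoc spectral_mult_left[OF s z(1)])
    moreover have "E x * (h * y) * E z = complex_of_real x *\<^sub>C (E x * y * E z)"
      by (simp add: mult.assoc[symmetric] spectral_mult_left[OF s x])
    ultimately have "complex_of_real z *\<^sub>C (E x * y * E z) = complex_of_real x *\<^sub>C (E x * y * E z)" using y by metis
    then show ?thesis using z by (metis fsvs.scale_cancel_right of_real_eq_iff)
  qed
  have "complex_of_real x *\<^sub>C (y * E x) = y * h * E x" by (simp add: mult.assoc spectral_mult_left[OF s x])
  also have "\<dots> = h * y * E x" using y by simp
  also have "\<dots> = (\<Sum>z\<in>L. if z = x then complex_of_real x *\<^sub>C (E x * y * E x) else 0)"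
    unfolding h sum_distrib_right by (rule sum.cong) (auto simp: *)
  also have "\<dots> = complex_of_real x *\<^sub>C (E x * y * E x)" using f x by simp
  finally have 1: "y * E x = E x * y * E x" using x0 by simp
  have "complex_of_real x *\<^sub>C (E x * y) = E x * (h * y)" by (simp add: mult.assoc[symmetric] spectral_mult_left[OF s x])
  also have "\<dots> = E x * y * h" using y by (simp add: mult.assoc)
  also have "\<dots> = (\<Sum>z\<in>L. if z = x then complex_of_real x *\<^sub>C (E x * y * E x) else 0)"
    by (subst h, unfold sum_distrib_left, rule sum.cong) (auto simp: **)
  also have "\<dots> = complex_of_real x *\<^sub>C (E x * y * E x)" using f x by simp
  finally have "E x * y = E x * y * E x" using x0 by simp
  with 1 show ?thesis by simp
qed

lemma spectral_pos:
  assumes s: "spectral h L E" and h: "pos h" and x: "x \<in> L"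
  shows "0 < x"
proof -
  have E: "proj (E x)" "E x \<noteq> 0" "x \<noteq> 0" using s x by (auto simp: spectral_def)
  have "0 \<le> tr (adj (E x) * h * E x)" using h unfolding pos_def by blast
  also have "adj (E x) * h * E x = complex_of_real x *\<^sub>C E x"
    using E by (simp add: proj_def mult.assoc spectral_mult_left[OF s x])
  finally have "0 \<le> complex_of_real x * tr (E x)" by (simp add: tr_sc)
  moreover have "0 < tr (E x)" using E tr_proj_eq_0 tr_proj_nonneg by (metis less_le)
  ultimately have "0 \<le> x" by (auto simp: less_eq_complex_def less_complex_def zero_le_mult_iff)
  then show ?thesis using E by simp
qed

lemma spectral_sum_mult:
  assumes s: "spectral h L E"
  shows "(\<Sum>x\<in>L. f x *\<^sub>C E x) * (\<Sum>x\<in>L. g x *\<^sub>C E x) = (\<Sum>x\<in>L. (f x * g x) *\<^sub>C E x)"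
proof -
  have f: "finite L" using s by (simp add: spectral_def)
  have "(\<Sum>x\<in>L. f x *\<^sub>C E x) * (\<Sum>x\<in>L. g x *\<^sub>C E x) = (\<Sum>x\<in>L. \<Sum>y\<in>L. (f x * g y) *\<^sub>C (E x * E y))"
    by (simp add: sum_product mult.commute)
  also have "\<dots> = (\<Sum>x\<in>L. \<Sum>y\<in>L. if y = x then (f x * g x) *\<^sub>C E x else 0)"
    by (intro sum.cong refl) (auto simp: spectral_mult[OF s])
  also have "\<dots> = (\<Sum>x\<in>L. (f x * g x) *\<^sub>C E x)" using f by simp
  finally show ?thesis .
qed

text \<open>\<open>c\<close> is the square root of \<open>a\<close>, \<open>s\<close> the Moore--Penrose inverse of \<open>c\<close>, and \<open>e\<close> the support projection.\<close>

definition root_pinv :: "fsmat \<Rightarrow> fsmat \<Rightarrow> fsmat \<Rightarrow> fsmat \<Rightarrow> bool" where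
  "root_pinv a c s e \<longleftrightarrow> pos c \<and> pos s \<and> proj e \<and> c * c = a \<and> c * s = e \<and> s * c = e \<and>
     e * c = c \<and> c * e = c \<and> e * s = s \<and> s * e = s"

lemma root_pinv_exists:
  assumes a: "pos a"
  shows "\<exists>c s e. root_pinv a c s e"
proof -
  obtain L E where s: "spectral a L E" using spectral_exists a pos_adj by blast
  have p: "\<And>x. x \<in> L \<Longrightarrow> 0 < x" and E: "\<And>x. x \<in> L \<Longrightarrow> proj (E x)"
    using spectral_pos[OF s a] s by (auto simp: spectral_def)
  have ah: "a = (\<Sum>x\<in>L. complex_of_real x *\<^sub>C E x)" using s by (simp add: spectral_def)
  define c where "c = (\<Sum>x\<in>L. complex_of_real (sqrt x) *\<^sub>C E x)"
  define t where "t = (\<Sum>x\<in>L. complex_of_real (1 / sqrt x) *\<^sub>C E x)"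
  define e where "e = (\<Sum>x\<in>L. 1 *\<^sub>C E x)"
  have cc: "complex_of_real (sqrt x) * complex_of_real (sqrt x) = complex_of_real x"
    "complex_of_real (sqrt x) * complex_of_real (1 / sqrt x) = 1"
    "complex_of_real (1 / sqrt x) * complex_of_real (sqrt x) = 1" if "x \<in> L" for x
    unfolding of_real_mult[symmetric] using p[OF that] by auto
  have "adj e = e" using E by (simp add: e_def proj_def)
  moreover have "e * e = e" unfolding e_def spectral_sum_mult[OF s] by simp
  ultimately have "proj e" by (simp add: proj_def)
  moreover have "pos c" unfolding c_def by (intro pos_sum pos_sc pos_proj E) (auto dest: p)
  moreover have "pos t" unfolding t_def by (intro pos_sum pos_sc pos_proj E) (auto dest: p)
  moreover have "c * c = a" unfolding c_def spectral_sum_mult[OF s] ah by (intro sum.cong) (auto simp: cc)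
  moreover have "c * t = e" unfolding c_def t_def e_def spectral_sum_mult[OF s] by (intro sum.cong refl) (simp only: cc)
  moreover have "t * c = e" unfolding c_def t_def e_def spectral_sum_mult[OF s] by (intro sum.cong refl) (simp only: cc)
  moreover have "e * c = c" "c * e = c" "e * t = t" "t * e = t"
    unfolding c_def t_def e_def spectral_sum_mult[OF s] by auto
  ultimately show ?thesis unfolding root_pinv_def by blast
qed

lemma root_pinv_bounded:
  assumes r: "root_pinv a c s e" and a: "bounded_by n a"
  shows "bounded_by n c" "bounded_by n s" "bounded_by n e"
proof -
  have r': "adj c = c" "adj s = s" "adj e = e" "c * c = a" "c * s = e" "s * c = e" "e * c = c" "c * e = c" "e * s = s" "s * e = s"
    "e * e = e" using r by (auto simp: root_pinv_def pos_def proj_def)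
  have "e = a * s * s" using r' by (metis mult.assoc)
  then have "idp n * e = e" using a unfolding bounded_by_iff_idp by (metis mult.assoc)
  moreover from this have "e * idp n = e" using r' by (metis adj_idp adj_mult)
  ultimately show "bounded_by n c" "bounded_by n s" "bounded_by n e"
    unfolding bounded_by_iff_idp using r' by (metis mult.assoc)+
qed

section \<open>Traces of products, supports and ranks\<close>

lemma pos_root:
  assumes "pos a"
  shows "\<exists>c. adj c = c \<and> c * c = a"
  using root_pinv_exists[OF assms] unfolding root_pinv_def pos_def by blast

lemma tr_mult_pos:
  assumes "pos A" "pos B"
  shows "0 \<le> tr (A * B)"
proof -
  obtain c where c: "adj c = c" "c * c = A" using pos_root assms by blast
  have "tr (A * B) = tr (adj c * B * c)" using c by (metis mult.assoc tr_mult_commute)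
  then show ?thesis using pos_conj[OF assms(2)] pos_tr by metis
qed

lemma pos_tr_eq_0:
  assumes "pos A" "tr A = 0"
  shows "A = 0"
proof -
  obtain c where c: "adj c = c" "c * c = A" using pos_root assms by blast
  then show ?thesis using assms tr_adj_mult_self_eq_0 by (metis mult_zero_left)
qed

lemma pos_conj_eq_0:
  assumes "pos A" "adj C * A * C = 0"
  shows "A * C = 0"
proof -
  obtain c where c: "adj c = c" "c * c = A" using pos_root assms by blast
  have "adj (c * C) * (c * C) = 0" using c assms by (metis adj_mult mult.assoc)
  then have "c * C = 0" using adj_mult_self_eq_0 by blast
  then show ?thesis using c by (metis mult.assoc mult_zero_right)
qed

text \<open>On the kernel of \<open>a\<close>, cut to finite size as \<open>F = idp N - e\<close>,
  the form of \<open>A\<close> is squeezed between 0 and that of \<open>a\<close>, which vanishes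
  there; hence \<open>A * F = 0\<close>, and \<open>A\<close> lives on the support of
  \<open>a\<close>.\<close>

lemma root_pinv_support:
  assumes r: "root_pinv a c s e" and A: "pos A" "pos (a - A)"
  shows "e * A = A" "A * e = A"
proof -
  have r': "adj e = e" "c * c = a" "e * c = c" "c * e = c" "e * e = e"
    using r by (auto simp: root_pinv_def pos_def proj_def)
  obtain N where N: "bounded_by N A" "bounded_by N e" using bounded_by_exists2 by blast
  obtain F where F: "F = idp N - e" by blast
  have af: "a * F = 0" using N r' unfolding bounded_by_iff_idp F
    by (metis mult.assoc right_diff_distrib diff_self)
  have 1: "pos (adj F * A * F)" using pos_conj A by blast
  have "0 \<le> tr (adj F * (a - A) * F)" using A unfolding pos_def by blast
  then have "tr (adj F * A * F) \<le> 0" using af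
    by (simp add: right_diff_distrib left_diff_distrib mult.assoc tr_diff tr_uminus)
  then have "tr (adj F * A * F) = 0" using pos_tr[OF 1] by simp
  then have "adj F * A * F = 0" using pos_tr_eq_0[OF 1] by blast
  then have "A * F = 0" using pos_conj_eq_0 A by blast
  then show "A * e = A" using N unfolding bounded_by_iff_idp F by (simp add: right_diff_distrib)
  then show "e * A = A" using r' A pos_adj by (metis adj_mult)
qed

lemma proj_decomposition:
  assumes p: "proj p"
  shows "\<exists>n u. orthonormal n u \<and> p = (\<Sum>i<n. u i * adj (u i))"
proof -
  obtain n u and d :: "nat \<Rightarrow> real" where o: "orthonormal n u" and d: "\<And>i. i < n \<Longrightarrow> d i \<noteq> 0"
    and hh: "p = (\<Sum>i<n. complex_of_real (d i) *\<^sub>C (u i * adj (u i)))"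
    using spectral_theorem[of p] p proj_adj by blast
  have u: "u i * mu 0 0 = u i" if "i < n" for i using o that by (auto simp: orthonormal_def)
  have uu: "adj (u i) * u j = (if i = j then mu 0 0 else 0)" if "i < n" "j < n" for i j
    using o that by (auto simp: orthonormal_def)
  have "d i = 1" if "i < n" for i
  proof -
    have "p * u i = (\<Sum>j<n. complex_of_real (d j) *\<^sub>C (u j * (adj (u j) * u i)))"
      by (subst hh) (simp add: sum_distrib_right mult.assoc)
    also have "\<dots> = (\<Sum>j<n. if j = i then complex_of_real (d i) *\<^sub>C u i else 0)"
      by (rule sum.cong) (use that uu u in auto)
    also have "\<dots> = complex_of_real (d i) *\<^sub>C u i" using that by simp
    finally have pu: "p * u i = complex_of_real (d i) *\<^sub>C u i" .
    have "p * (p * u i) = p * u i" using p by (simp add: proj_def mult.assoc[symmetric])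
    then have "complex_of_real (d i) *\<^sub>C complex_of_real (d i) *\<^sub>C u i = complex_of_real (d i) *\<^sub>C u i"
      by (simp add: pu del: fsvs.scale_scale)
    moreover have "u i \<noteq> 0" using uu[OF that that] tr_mu[of 0 0] by auto
    ultimately show "d i = 1" using d[OF that] by simp
  qed
  then have "p = (\<Sum>i<n. u i * adj (u i))" by (subst hh) simp
  then show ?thesis using o by blast
qed

text \<open>Ranks are read off as traces. That they are natural numbers is what later permits least
  projections, longest families and induction on the rank.\<close>

lemma tr_proj_nat:
  assumes "proj p"
  shows "\<exists>n. tr p = of_nat n"
  using proj_decomposition[OF assms] orthonormal_proj(2) by metis

subsection \<open>Monotonicity under positive maps\<close>

text \<open>If the ratio \<open>r = a 1 / a 0\<close> exceeded 1, the doubling inequality would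
  square the growth at every step, \<open>a (2 ^ k) \<ge> a 0 * r ^ (2 ^ k)\<close>, which no
  bounded sequence can follow.\<close>

lemma log_convex_bounded:
  fixes a :: "nat \<Rightarrow> real"
  assumes nonneg: "\<And>n. 0 \<le> a n" and bound: "\<And>n. a n \<le> C" and lc: "\<And>n. (a n)\<^sup>2 \<le> a 0 * a (2 * n)"
  shows "a 1 \<le> a 0"
proof (rule ccontr)
  assume "\<not> a 1 \<le> a 0"
  then have less: "a 0 < a 1" by simp
  have a0: "a 0 > 0"
  proof (rule ccontr)
    assume "\<not> 0 < a 0"
    then have "a 0 = 0" using nonneg[of 0] by simp
    then show False using lc[of 1] less by simp
  qed
  define r where "r = a 1 / a 0"
  have r: "r > 1" using less a0 by (simp add: r_def)
  have *: "a 0 * r ^ (2 ^ k) \<le> a (2 ^ k)" for k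
  proof (induction k)
    case 0
    show ?case using a0 by (simp add: r_def)
  next
    case (Suc k)
    have "(a 0 * r ^ (2 ^ k))\<^sup>2 \<le> (a (2 ^ k))\<^sup>2" using Suc a0 r by (intro power_mono) auto
    also have "\<dots> \<le> a 0 * a (2 ^ Suc k)" using lc[of "2 ^ k"] by simp
    finally have "a 0 * (a 0 * r ^ (2 ^ Suc k)) \<le> a 0 * a (2 ^ Suc k)"
      by (simp add: power_mult_distrib power2_eq_square power_mult[symmetric] mult.commute mult.left_commute power_add[symmetric] mult_2)
    then show ?case using a0 by simp
  qed
  obtain k where k: "C / a 0 < r ^ k" using real_arch_pow[OF r] by blast
  have "k \<le> 2 ^ k" by (simp add: less_imp_le)
  then have "r ^ k \<le> r ^ (2 ^ k)" using r by (intro power_increasing) auto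
  then have "C < a 0 * r ^ (2 ^ k)" using k a0 by (simp add: field_simps) (smt (verit, best) mult_left_mono)
  then show False using *[of k] bound[of "2 ^ k"] by simp
qed

text \<open>With \<open>r\<close> the root of \<open>c\<close>, the form is the squared
  Hilbert-Schmidt norm of \<open>r * Z * r\<close>.\<close>

lemma hermitian_form:
  assumes Z: "adj Z = Z" and c: "pos c"
  shows "0 \<le> tr (Z * c * Z * c)" "tr (Z * c * Z * c) = 0 \<Longrightarrow> c * Z * c = 0"
proof -
  obtain r where r: "adj r = r" "r * r = c" using pos_root c by blast
  have "tr (Z * c * Z * c) = tr ((Z * c * Z * r) * r)" using r by (simp add: mult.assoc)
  also have "\<dots> = tr (r * (Z * c * Z * r))" by (rule tr_mult_commute)
  also have "r * (Z * c * Z * r) = adj (r * Z * r) * (r * Z * r)"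
    unfolding r(2)[symmetric] using r(1) Z by (simp add: mult.assoc)
  finally have eq: "tr (Z * c * Z * c) = tr (adj (r * Z * r) * (r * Z * r))" .
  show "0 \<le> tr (Z * c * Z * c)" unfolding eq by (rule tr_adj_mult_self_nonneg)
  assume "tr (Z * c * Z * c) = 0"
  then have "r * Z * r = 0" unfolding eq using tr_adj_mult_self_eq_0 by blast
  then have "r * (r * Z * r) * r = 0" by simp
  then show "c * Z * c = 0" unfolding r(2)[symmetric] by (simp only: mult.assoc)
qed

text \<open>The discriminant of a nonnegative quadratic. In the degenerate case \<open>C = 0\<close>
  a nonzero \<open>B\<close> is excluded because the value at \<open>(A + 1) / (2 * B)\<close> would
  be -1.\<close>

lemma quadratic_nonneg_imp:
  fixes A B C :: real
  assumes q: "\<And>x. 0 \<le> A - 2 * x * B + x\<^sup>2 * C" and C: "0 \<le> C"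
  shows "B\<^sup>2 \<le> C * A"
proof (cases "C = 0")
  case True
  have "B = 0"
  proof (rule ccontr)
    assume "B \<noteq> 0"
    then show False using q[of "(A + 1) / (2 * B)"] True by (simp add: field_simps)
  qed
  then show ?thesis using True by simp
next
  case False
  then have "0 < C" using C by simp
  have "0 \<le> C * (A - 2 * (B / C) * B + (B / C)\<^sup>2 * C)" using q[of "B / C"] C by (intro mult_nonneg_nonneg) auto
  also have "\<dots> = C * A - B\<^sup>2" using \<open>0 < C\<close> by (simp add: field_simps power2_eq_square)
  finally show ?thesis by simp
qed

text \<open>The iterates of \<open>T' \<circ> T\<close>, which is self-adjoint for the form \<open>tr (X * c * Y * c)\<close>, give a
  bounded log-convex sequence, and such a sequence is nonincreasing.\<close>

lemma weighted_form_mono: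
  assumes c: "pos c"
    and T: "\<And>X. pos X \<Longrightarrow> pos (I - X) \<Longrightarrow> pos (T X) \<and> pos (J - T X)"
    and T': "\<And>Y. pos Y \<Longrightarrow> pos (J - Y) \<Longrightarrow> pos (T' Y) \<and> pos (I - T' Y)"
    and adjoint: "\<And>X Y. pos X \<Longrightarrow> pos (I - X) \<Longrightarrow> pos Y \<Longrightarrow> pos (J - Y) \<Longrightarrow>
      tr (T X * f * Y * f) = tr (X * c * T' Y * c)"
    and X: "pos X" "pos (I - X)"
  shows "tr (T X * f * T X * f) \<le> tr (X * c * X * c)"
proof -
  define x where "x n = ((T' \<circ> T) ^^ n) X" for n
  have x0: "x 0 = X" and xS: "x (Suc n) = T' (T (x n))" for n by (simp_all add: x_def)
  have xp: "pos (x n) \<and> pos (I - x n)" for n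
    by (induction n) (use X T T' in \<open>auto simp: x0 xS\<close>)
  have cyc: "tr (Y * c * Z * c) = tr (Z * c * Y * c)" for Y Z c :: fsmat
    using tr_mult_commute[of "Y * c" "Z * c"] by (simp add: mult.assoc)
  define g where "g i j = tr (x i * c * x j * c)" for i j
  have gT: "tr (T (x i) * f * T (x j) * f) = g i (Suc j)" for i j
    unfolding g_def xS using xp T by (intro adjoint) auto
  \<comment> \<open>The assumed adjointness and the symmetry of both forms make
    \<open>T' \<circ> T\<close> symmetric, so that \<open>g i j\<close> depends on
    \<open>i + j\<close> only.\<close>
  have gs: "g (Suc i) j = g i (Suc j)" for i j
  proof -
    have "g (Suc i) j = g j (Suc i)" unfolding g_def by (rule cyc)
    also have "\<dots> = tr (T (x j) * f * T (x i) * f)" by (rule gT[symmetric])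
    also have "\<dots> = tr (T (x i) * f * T (x j) * f)" by (rule cyc)
    also have "\<dots> = g i (Suc j)" by (rule gT)
    finally show ?thesis .
  qed
  have g0: "g i j = g 0 (i + j)" for i j
    by (induction i arbitrary: j) (simp_all add: gs)
  have gnn: "0 \<le> g i j" for i j
  proof -
    have "0 \<le> tr (x i * (adj c * x j * c))" using xp pos_conj by (intro tr_mult_pos) auto
    then show ?thesis using pos_adj[OF c] by (simp add: g_def mult.assoc)
  qed
  \<comment> \<open>All iterates stay between 0 and \<open>I\<close>, which bounds the sequence
    uniformly; positivity of the two maps enters only through this order interval.\<close>
  have gb: "g 0 n \<le> tr (X * c * I * c)" for n
  proof -
    have "0 \<le> tr (X * (adj c * (I - x n) * c))" using xp X pos_conj by (intro tr_mult_pos) auto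
    then show ?thesis using pos_adj[OF c]
      by (simp add: g_def x0 mult.assoc right_diff_distrib left_diff_distrib tr_diff)
  qed
  define a where "a n = Re (g 0 n)" for n
  have ga: "g i j = complex_of_real (a (i + j))" for i j
    using gnn[of 0 "i + j"] by (subst g0) (auto simp: a_def less_eq_complex_def complex_eq_iff)
  \<comment> \<open>Cauchy-Schwarz for \<open>x n\<close> against \<open>x 0\<close>. Since
    \<open>g n n\<close> equals \<open>a (2 * n)\<close>, it becomes the doubling
    inequality.\<close>
  have "(a n)\<^sup>2 \<le> a 0 * a (2 * n)" for n
  proof (rule quadratic_nonneg_imp)
    show "0 \<le> a 0" using gnn[of 0 0] by (simp add: a_def less_eq_complex_def)
    fix l :: real
    let ?Z = "x n - complex_of_real l *\<^sub>C x 0"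
    have "adj ?Z = ?Z" using xp pos_adj by simp
    then have "0 \<le> tr (?Z * c * ?Z * c)" using hermitian_form(1) c by blast
    also have "tr (?Z * c * ?Z * c) = g n n - complex_of_real l * g n 0 -
        complex_of_real l * (g 0 n - complex_of_real l * g 0 0)"
      by (simp add: g_def left_diff_distrib right_diff_distrib tr_diff tr_sc mult.assoc)
    also have "\<dots> = complex_of_real (a (2 * n) - 2 * l * a n + l\<^sup>2 * a 0)"
      unfolding ga mult_2[of n] by (simp add: power2_eq_square right_diff_distrib)
    finally show "0 \<le> a (2 * n) - 2 * l * a n + l\<^sup>2 * a 0" by (simp add: less_eq_complex_def)
  qed
  moreover have "0 \<le> a n" for n using gnn[of 0 n] by (simp add: a_def less_eq_complex_def)
  moreover have "a n \<le> Re (tr (X * c * I * c))" for n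
    using gb[of n] by (simp add: a_def less_eq_complex_def)
  ultimately have "a 1 \<le> a 0" by (intro log_convex_bounded)
  then have "g 0 (Suc 0) \<le> g 0 0" by (simp add: ga less_eq_complex_def)
  then show ?thesis unfolding gT[of 0 0, symmetric] by (simp add: x0 g_def)
qed

text \<open>\<open>J k\<close> stands for the isometry
  \<open>v \<mapsto> v \<otimes> |k\<rangle>\<close>, with \<open>k\<close> running through an
  orthonormal basis of the second factor; \<open>I\<close> and \<open>IE\<close> stand for the
  identities of the first factor and of the joint space. These relations carry the whole tensor
  structure: \<open>amp\<close> is \<open>X \<mapsto> X \<otimes> 1\<close>, and \<open>ptr\<close>
  is the partial trace.\<close>

locale bipartite =
  fixes I IE :: fsmat and d :: nat and J :: "nat \<Rightarrow> fsmat"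
  assumes I: "proj I" and IE: "proj IE"
    and JJ: "\<And>k l. k < d \<Longrightarrow> l < d \<Longrightarrow> adj (J k) * J l = (if k = l then I else 0)"
    and JI: "\<And>k. k < d \<Longrightarrow> J k * I = J k"
    and sum_JJ: "(\<Sum>k<d. J k * adj (J k)) = IE"
begin

definition amp :: "fsmat \<Rightarrow> fsmat" where "amp X = (\<Sum>k<d. J k * X * adj (J k))"
definition ptr :: "fsmat \<Rightarrow> fsmat" where "ptr Y = (\<Sum>k<d. adj (J k) * Y * J k)"

lemma IJ: "k < d \<Longrightarrow> I * adj (J k) = adj (J k)"
  using JI[of k] I by (metis adj_mult proj_adj)

lemma amp_I: "amp I = IE" unfolding amp_def sum_JJ[symmetric] by (simp add: JI)

lemma amp_diff: "amp (X - Y) = amp X - amp Y"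
  by (simp add: amp_def left_diff_distrib right_diff_distrib sum_subtractf)

lemma ptr_diff: "ptr (X - Y) = ptr X - ptr Y"
  by (simp add: ptr_def left_diff_distrib right_diff_distrib sum_subtractf)

lemma pos_amp: "pos X \<Longrightarrow> pos (amp X)"
  unfolding amp_def by (intro pos_sum pos_conj')

lemma pos_ptr: "pos X \<Longrightarrow> pos (ptr X)"
  unfolding ptr_def by (intro pos_sum pos_conj)

lemma tr_amp_mult: "tr (amp X * Y) = tr (X * ptr Y)"
  unfolding amp_def ptr_def sum_distrib_left sum_distrib_right tr_sum
proof (rule sum.cong)
  fix k
  show "tr (J k * X * adj (J k) * Y) = tr (X * (adj (J k) * Y * J k))"
    using tr_mult_commute[of "J k" "X * adj (J k) * Y"] by (simp add: mult.assoc)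
qed simp

lemma I_ptr: "I * ptr Y = ptr Y"
  unfolding ptr_def sum_distrib_left by (rule sum.cong) (simp_all add: IJ mult.assoc[symmetric])

text \<open>In the form weighted by \<open>b\<close>, both \<open>Y = b\<^sup>-\<^sup>1\<^sup>/\<^sup>2 B b\<^sup>-\<^sup>1\<^sup>/\<^sup>2\<close> and \<open>amp X\<close> are no longer than \<open>X\<close> in the form weighted
  by \<open>a\<close>, and their inner product equals the squared length of \<open>X\<close>. Hence they coincide.\<close>

theorem recovery:
  assumes Lam_adjoint: "\<And>X Y. I * X * I = X \<Longrightarrow> tr (Lam X * Y) = tr (X * Lam' Y)"
    and Lam_diff: "\<And>X Y. Lam (X - Y) = Lam X - Lam Y"
    and Lam_pos: "\<And>X. I * X * I = X \<Longrightarrow> pos X \<Longrightarrow> pos (Lam X)"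
    and Lam'_pos: "\<And>Y. pos Y \<Longrightarrow> pos (Lam' Y)"
    and Lam'_le: "\<And>Y. pos (IE - Y) \<Longrightarrow> pos (I - Lam' Y)"
    and a: "root_pinv a c s e" "I * a = a" and b: "root_pinv b f t g" "IE * b = b"
    and ab: "Lam a = b" "ptr b = a"
    and A: "pos A" "pos (a - A)" and AB: "Lam A = B" "ptr B = A"
  shows "B = f * amp (s * A * s) * f"
proof -
  have I': "adj I = I" "I * I = I" and IE': "adj IE = IE" "IE * IE = IE"
    using I IE by (auto simp: proj_def)
  have a': "adj c = c" "adj s = s" "adj e = e" "c * c = a" "c * s = e" "s * c = e"
    "e * c = c" "c * e = c" "e * s = s" "s * e = s" "e * e = e" "proj e" "pos c"
    using a by (auto simp: root_pinv_def pos_def proj_def)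
  have b': "adj f = f" "adj t = t" "adj g = g" "f * f = b" "f * t = g" "t * f = g"
    "g * f = f" "f * g = f" "g * t = t" "t * g = t" "g * g = g" "proj g" "pos f"
    using b by (auto simp: root_pinv_def pos_def proj_def)
  have Ie: "I * e = e" "e * I = e"
  proof -
    have "e = a * s * s" using a' by (metis mult.assoc)
    then show "I * e = e" using a by (metis mult.assoc)
    then show "e * I = e" using a' I' by (metis adj_mult)
  qed
  have Ic: "I * c = c" "c * I = c" using Ie a' by (metis mult.assoc)+
  have IEg: "IE * g = g" "g * IE = g"
  proof -
    have "g = b * t * t" using b' by (metis mult.assoc)
    then show "IE * g = g" using b by (metis mult.assoc)
    then show "g * IE = g" using b' IE' by (metis adj_mult)
  qed
  have IEf: "IE * f = f" "f * IE = f" using IEg b' by (metis mult.assoc)+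
  have pIe: "pos (I - e)" using proj_diff[OF _ I Ie(1)] a' pos_proj by blast
  have pIEg: "pos (IE - g)" using proj_diff[OF _ IE IEg(1)] b' pos_proj by blast
  have sas: "s * a * s = e" using a' by (metis mult.assoc)
  have tbt: "t * b * t = g" using b' by (metis mult.assoc)
  have Isupp: "I * (c * Z * c) * I = c * Z * c" for Z
    using Ic by (metis mult.assoc)
  define X where "X = s * A * s"
  have eA: "e * A = A" "A * e = A" using root_pinv_support[OF a(1) A] by auto
  have cXc: "c * X * c = A"
  proof -
    have "c * X * c = (c * s) * A * (s * c)" by (simp add: X_def mult.assoc)
    then show ?thesis using a' eA by simp
  qed
  have pX: "pos X" unfolding X_def using pos_conj[OF A(1), of s] a' by simp
  have pIX: "pos (I - X)"
  proof -
    have "I - X = (I - e) + adj s * (a - A) * s"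
      by (simp add: X_def a' left_diff_distrib right_diff_distrib sas)
    then show ?thesis using pIe pos_conj[OF A(2)] pos_add by metis
  qed
  define Y where "Y = t * B * t"
  have pB: "pos B" using Lam_pos[of A] AB(1) A(1) eA Ie by (metis mult.assoc)
  have pbB: "pos (b - B)"
  proof -
    have "I * (a - A) * I = a - A"
      using a(2) Ie eA I' A a' by (metis adj_mult pos_adj pos_def left_diff_distrib mult.assoc right_diff_distrib)
    then show ?thesis using Lam_pos[of "a - A"] A(2) ab(1) AB(1) by (simp add: Lam_diff)
  qed
  have gB: "g * B = B" "B * g = B" using root_pinv_support[OF b(1) pB pbB] by auto
  have ineq1: "tr (Y * f * Y * f) \<le> tr (X * c * X * c)"
  proof -
    \<comment> \<open>\<open>Lam\<close> is rescaled to
      \<open>Z \<mapsto> t * Lam (c * Z * c) * t\<close>, which sends \<open>I\<close> to the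
      support projection \<open>g\<close> because \<open>Lam a = b\<close>, so the order interval is
      respected. Its adjoint for the two weighted forms is \<open>Lam'\<close> after compression by
      \<open>g\<close>. At \<open>X\<close> the rescaled map takes the value
      \<open>Y\<close>.\<close>
    have "tr (t * Lam (c * X * c) * t * f * (t * Lam (c * X * c) * t) * f) \<le> tr (X * c * X * c)"
    proof (rule weighted_form_mono[where T = "\<lambda>Z. t * Lam (c * Z * c) * t" and T' = "\<lambda>Z. Lam' (g * Z * g)"
          and I = I and J = IE, OF a'(13) _ _ _ pX pIX])
      fix Z assume Z: "pos Z" "pos (I - Z)"
      have 1: "pos (Lam (c * Z * c))" using Lam_pos[OF Isupp] pos_conj[OF Z(1), of c] a' by simp
      have 2: "pos (Lam (c * (I - Z) * c))" using Lam_pos[OF Isupp] pos_conj[OF Z(2), of c] a' by simp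
      have "c * (I - Z) * c = a - c * Z * c" using Ic a' by (simp add: left_diff_distrib right_diff_distrib)
      then have 2: "pos (b - Lam (c * Z * c))" using 2 ab by (simp add: Lam_diff)
      have "IE - t * Lam (c * Z * c) * t = (IE - g) + adj t * (b - Lam (c * Z * c)) * t"
        using b' tbt by (simp add: left_diff_distrib right_diff_distrib)
      then have "pos (IE - t * Lam (c * Z * c) * t)"
        using pos_add[OF pIEg pos_conj[OF 2, of t]] by metis
      then show "pos (t * Lam (c * Z * c) * t) \<and> pos (IE - t * Lam (c * Z * c) * t)"
        using pos_conj[OF 1, of t] b' by simp
    next
      fix Z assume Z: "pos Z" "pos (IE - Z)"
      have "IE - g * Z * g = (IE - g) + adj g * (IE - Z) * g"
        using b' IEg by (simp add: left_diff_distrib right_diff_distrib)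
      then have "pos (IE - g * Z * g)" using pos_add[OF pIEg pos_conj[OF Z(2), of g]] by metis
      moreover have "pos (g * Z * g)" using pos_conj[OF Z(1), of g] b' by simp
      ultimately show "pos (Lam' (g * Z * g)) \<and> pos (I - Lam' (g * Z * g))"
        using Lam'_pos Lam'_le by blast
    next
      fix Z V
      have "tr (t * Lam (c * Z * c) * t * f * V * f) = tr (f * (t * Lam (c * Z * c) * t * f * V))"
        by (rule tr_mult_commute)
      also have "f * (t * Lam (c * Z * c) * t * f * V) = (f * t) * Lam (c * Z * c) * (t * f) * V"
        by (simp only: mult.assoc)
      also have "\<dots> = g * (Lam (c * Z * c) * g * V)" using b' by (simp add: mult.assoc)
      also have "tr \<dots> = tr (Lam (c * Z * c) * g * V * g)" by (rule tr_mult_commute)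
      also have "\<dots> = tr (Lam (c * Z * c) * (g * V * g))" by (simp add: mult.assoc)
      also have "\<dots> = tr (c * Z * c * Lam' (g * V * g))" by (rule Lam_adjoint[OF Isupp])
      also have "\<dots> = tr (c * (Z * c * Lam' (g * V * g)))" by (simp add: mult.assoc)
      also have "\<dots> = tr (Z * c * Lam' (g * V * g) * c)" by (rule tr_mult_commute)
      finally show "tr (t * Lam (c * Z * c) * t * f * V * f) = tr (Z * c * Lam' (g * V * g) * c)" .
    qed
    then show ?thesis unfolding cXc AB(1) Y_def .
  qed
  \<comment> \<open>Here \<open>amp\<close> itself is the order-preserving map. Its adjoint for the
    weighted forms is the Petz map in the Heisenberg picture,
    \<open>Z \<mapsto> s * ptr (f * Z * f) * s\<close>, and \<open>ptr b = a\<close> keeps the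
    images of operators below \<open>IE\<close> below \<open>I\<close>.\<close>
  have ineq2: "tr (amp X * f * amp X * f) \<le> tr (X * c * X * c)"
  proof (rule weighted_form_mono[where T = amp and T' = "\<lambda>Z. s * ptr (f * Z * f) * s"
        and I = I and J = IE, OF a'(13) _ _ _ pX pIX])
    fix Z assume "pos Z" "pos (I - Z)"
    then show "pos (amp Z) \<and> pos (IE - amp Z)"
      using pos_amp amp_diff amp_I by metis
  next
    fix Z assume Z: "pos Z" "pos (IE - Z)"
    have 1: "pos (ptr (f * Z * f))" using pos_ptr pos_conj[OF Z(1), of f] b' by simp
    have "pos (ptr (f * (IE - Z) * f))" using pos_ptr pos_conj[OF Z(2), of f] b' by simp
    then have 2: "pos (a - ptr (f * Z * f))" using b' IEf ab
      by (simp add: left_diff_distrib right_diff_distrib ptr_diff)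
    have "I - s * ptr (f * Z * f) * s = (I - e) + adj s * (a - ptr (f * Z * f)) * s"
      using a' sas by (simp add: left_diff_distrib right_diff_distrib)
    then have "pos (I - s * ptr (f * Z * f) * s)"
      using pos_add[OF pIe pos_conj[OF 2, of s]] by metis
    then show "pos (s * ptr (f * Z * f) * s) \<and> pos (I - s * ptr (f * Z * f) * s)"
      using pos_conj[OF 1, of s] a' by simp
  next
    fix Z V assume Z: "pos Z" "pos (I - Z)" "pos V" "pos (IE - V)"
    have 1: "pos (ptr (f * V * f))" using pos_ptr pos_conj[OF Z(3), of f] b' by simp
    have "pos (ptr (f * (IE - V) * f))" using pos_ptr pos_conj[OF Z(4), of f] b' by simp
    then have 2: "pos (a - ptr (f * V * f))" using b' IEf ab
      by (simp add: left_diff_distrib right_diff_distrib ptr_diff)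
    note supp = root_pinv_support[OF a(1) 1 2]
    have "tr (Z * c * (s * ptr (f * V * f) * s) * c) = tr (Z * (c * s) * ptr (f * V * f) * (s * c))"
      by (simp only: mult.assoc)
    also have "\<dots> = tr (Z * ptr (f * V * f))" using a' supp by (simp add: mult.assoc)
    also have "\<dots> = tr (amp Z * f * V * f)" by (simp add: tr_amp_mult[symmetric] mult.assoc)
    finally show "tr (amp Z * f * V * f) = tr (Z * c * (s * ptr (f * V * f) * s) * c)" by simp
  qed
  have fYf: "f * Y * f = B"
  proof -
    have "f * Y * f = (f * t) * B * (t * f)" by (simp add: Y_def mult.assoc)
    then show ?thesis using b' gB by simp
  qed
  have cross: "tr (Y * f * amp X * f) = tr (X * c * X * c)"
  proof -
    have "tr (Y * f * amp X * f) = tr (f * (Y * f * amp X))" by (rule tr_mult_commute)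
    also have "\<dots> = tr (B * amp X)" unfolding fYf[symmetric] by (simp add: mult.assoc)
    also have "\<dots> = tr (amp X * B)" by (rule tr_mult_commute)
    also have "\<dots> = tr (X * A)" by (simp add: tr_amp_mult AB)
    also have "\<dots> = tr (X * c * X * c)" unfolding cXc[symmetric] by (simp add: mult.assoc)
    finally show ?thesis .
  qed
  have cross': "tr (amp X * f * Y * f) = tr (X * c * X * c)"
    using cross tr_mult_commute[of "amp X * f" "Y * f"] by (simp add: mult.assoc)
  define D where "D = Y - amp X"
  have D: "adj D = D" using pos_adj[OF pB] pos_adj[OF pos_amp[OF pX]] b' by (simp add: D_def Y_def mult.assoc)
  have "tr (D * f * D * f) = tr (Y * f * Y * f) - tr (X * c * X * c) - tr (X * c * X * c) + tr (amp X * f * amp X * f)"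
    by (simp add: D_def left_diff_distrib right_diff_distrib tr_diff cross cross')
  also have "\<dots> \<le> 0" using ineq1 ineq2 by (auto simp: less_eq_complex_def)
  finally have "tr (D * f * D * f) = 0" using hermitian_form(1)[OF D b'(13)] by simp
  then have "f * D * f = 0" using hermitian_form(2)[OF D b'(13)] by blast
  then show ?thesis using fYf by (simp add: D_def left_diff_distrib right_diff_distrib X_def)
qed

end

subsection \<open>Fixed points and commutants\<close>

text \<open>Lindblad's argument: the sum of the squared commutators has trace zero against the
  invariant \<open>a\<close>.\<close>

lemma commutator_eq_0:
  assumes e: "(\<Sum>k\<in>S. adj (V k) * V k) = e" and Ve: "\<And>k. k \<in> S \<Longrightarrow> V k * e = V k"
    and inv: "\<And>Y. tr (a * (\<Sum>k\<in>S. adj (V k) * Y * V k)) = tr (a * Y)"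
    and a: "root_pinv a c s e"
    and Z: "e * Z = Z" "Z * e = Z"
    and fixed: "(\<Sum>k\<in>S. adj (V k) * Z * V k) = Z"
    and S: "finite S" and k: "k \<in> S"
  shows "V k * adj Z = adj Z * V k"
proof -
  have a': "adj c = c" "adj s = s" "adj e = e" "c * c = a" "c * s = e" "s * c = e"
    "e * c = c" "c * e = c" "e * s = s" "s * e = s" "e * e = e" "pos c" "pos a"
    using a pos_mult_adj[of c] by (auto simp: root_pinv_def pos_def proj_def)
  define D where "D k = V k * adj Z - adj Z * V k" for k
  have fixed': "(\<Sum>k\<in>S. adj (V k) * adj Z * V k) = adj Z"
    using arg_cong[OF fixed, of adj] by (simp add: mult.assoc)
  have DD: "adj (D k) * D k = Z * (adj (V k) * V k) * adj Z - Z * (adj (V k) * adj Z * V k)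
      - adj (V k) * Z * V k * adj Z + adj (V k) * (Z * adj Z) * V k" for k
    by (simp add: D_def left_diff_distrib right_diff_distrib mult.assoc)
  have "(\<Sum>k\<in>S. adj (D k) * D k) = Z * e * adj Z - Z * adj Z - Z * adj Z + (\<Sum>k\<in>S. adj (V k) * (Z * adj Z) * V k)"
    unfolding DD sum.distrib sum_subtractf
    unfolding sum_distrib_left[symmetric] sum_distrib_right[symmetric] e fixed fixed' ..
  then have "tr (a * (\<Sum>k\<in>S. adj (D k) * D k)) = 0"
    using inv[of "Z * adj Z"] Z by (simp add: distrib_left right_diff_distrib tr_add tr_diff)
  then have "(\<Sum>k\<in>S. tr (a * (adj (D k) * D k))) = 0"
    by (simp add: sum_distrib_left tr_sum)
  moreover have "0 \<le> tr (a * (adj (D k) * D k))" for k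
    using a' pos_adj_mult by (intro tr_mult_pos)
  ultimately have "tr (a * (adj (D k) * D k)) = 0"
    using S k by (simp add: sum_nonneg_eq_0_iff)
  also have "a * (adj (D k) * D k) = c * (c * adj (D k) * D k)" using a' by (simp add: mult.assoc[symmetric])
  also have "tr \<dots> = tr (c * adj (D k) * D k * c)" by (rule tr_mult_commute)
  also have "c * adj (D k) * D k * c = adj (D k * c) * (D k * c)" using a' by (simp add: mult.assoc)
  finally have "D k * c = 0" using tr_adj_mult_self_eq_0 by blast
  \<comment> \<open>The weight \<open>a\<close> is faithful on its support only: multiplying by
    \<open>s\<close> turns \<open>c\<close> into \<open>e\<close>, and
    \<open>D k * e = D k\<close>.\<close>
  then have "D k * (c * s) = 0" by (simp add: mult.assoc[symmetric])
  moreover have "adj Z * e = adj Z" using Z a' by (metis adj_mult)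
  ultimately have "D k = 0" using a' Ve[OF k] by (simp add: D_def left_diff_distrib mult.assoc)
  then show ?thesis by (simp add: D_def)
qed

text \<open>A Vandermonde argument with matrix coefficients: the relation for \<open>n + 1\<close>
  minus \<open>k\<close> times the one for \<open>n\<close> removes the node \<open>k\<close> and
  multiplies every other term by \<open>m - k\<close>, which is nonzero.\<close>

lemma power_sums_eq_0:
  fixes x :: "complex \<Rightarrow> fsmat"
  assumes "finite M" "\<And>n. (\<Sum>m\<in>M. m ^ n *\<^sub>C x m) = 0" "m \<in> M"
  shows "x m = 0"
  using assms
proof (induction M arbitrary: x m rule: finite_induct)
  case (insert k M)
  have "(\<Sum>m\<in>M. m ^ n *\<^sub>C ((m - k) *\<^sub>C x m)) = 0" for n
  proof -
    have "0 = (\<Sum>m\<in>insert k M. m ^ Suc n *\<^sub>C x m) - k *\<^sub>C (\<Sum>m\<in>insert k M. m ^ n *\<^sub>C x m)"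
      by (simp only: insert.prems fsvs.scale_zero_right diff_0_right)
    also have "\<dots> = (\<Sum>m\<in>insert k M. m ^ n *\<^sub>C ((m - k) *\<^sub>C x m))"
      unfolding fsvs.scale_sum_right sum_subtractf[symmetric]
      by (rule sum.cong) (simp_all add: fsvs.scale_left_diff_distrib fsvs.scale_right_diff_distrib mult.commute)
    also have "\<dots> = (\<Sum>m\<in>M. m ^ n *\<^sub>C ((m - k) *\<^sub>C x m))" using insert.hyps by simp
    finally show ?thesis by simp
  qed
  then have "(m - k) *\<^sub>C x m = 0" if "m \<in> M" for m by (rule insert.IH) (rule that)
  then have M: "x m = 0" if "m \<in> M" for m using that insert.hyps by fastforce
  have "(\<Sum>m\<in>insert k M. m ^ 0 *\<^sub>C x m) = 0" by (rule insert.prems)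
  then have "x k = 0" using insert.hyps M by simp
  then show ?case using M insert.prems(2) by blast
qed simp

text \<open>\<open>c\<close> is positive and invertible in the corner of \<open>I\<close>, and
  \<open>modular\<close> is stability of the commutant under conjugation by it. This stability is
  exactly what a spanning set of eigenvectors of the conjugation inside the commutant requires.
  Closure of \<open>\<W>\<close> under adjoints makes the commutant a star-algebra.\<close>

locale modular_commutant =
  fixes I c s :: fsmat and \<W> :: "fsmat set"
  assumes I: "proj I"
    and c: "pos c" "I * c = c" and s: "adj s = s" "I * s = s" and cs: "c * s = I"
    and W: "\<And>w. w \<in> \<W> \<Longrightarrow> I * w = w \<and> w * I = w" and W_adj: "\<And>w. w \<in> \<W> \<Longrightarrow> adj w \<in> \<W>"
    and modular: "\<And>x. I * x * I = x \<Longrightarrow> (\<And>w. w \<in> \<W> \<Longrightarrow> x * w = w * x) \<Longrightarrow>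
      (\<And>w. w \<in> \<W> \<Longrightarrow> (c * x * s) * w = w * (c * x * s))"
begin

definition \<A> :: "fsmat set" where "\<A> = {x. I * x * I = x \<and> (\<forall>w\<in>\<W>. x * w = w * x)}"

lemma I': "adj I = I" "I * I = I" "c * I = c" "s * I = s" "s * c = I" "adj c = c"
proof -
  show 1: "adj I = I" "I * I = I" using I by (auto simp: proj_def)
  show 2: "adj c = c" using c pos_adj by blast
  show "c * I = c" "s * I = s" "s * c = I" using 1 2 c s cs by (metis adj_mult)+
qed

lemma A_I: "x \<in> \<A> \<Longrightarrow> I * x = x" "x \<in> \<A> \<Longrightarrow> x * I = x"
  unfolding \<A>_def using I' by (metis (mono_tags, lifting) mem_Collect_eq mult.assoc)+

lemma A_comm: "x \<in> \<A> \<Longrightarrow> w \<in> \<W> \<Longrightarrow> x * w = w * x"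
  unfolding \<A>_def by blast

lemma AI: "I * x = x \<Longrightarrow> x * I = x \<Longrightarrow> (\<And>w. w \<in> \<W> \<Longrightarrow> x * w = w * x) \<Longrightarrow> x \<in> \<A>"
  unfolding \<A>_def by auto

lemma A_mult: "x \<in> \<A> \<Longrightarrow> y \<in> \<A> \<Longrightarrow> x * y \<in> \<A>"
  by (rule AI) (metis A_I A_comm mult.assoc)+

lemma A_add: "x \<in> \<A> \<Longrightarrow> y \<in> \<A> \<Longrightarrow> x + y \<in> \<A>"
  by (rule AI) (simp_all add: distrib_left distrib_right A_I A_comm)

lemma A_diff: "x \<in> \<A> \<Longrightarrow> y \<in> \<A> \<Longrightarrow> x - y \<in> \<A>"
  by (rule AI) (simp_all add: left_diff_distrib right_diff_distrib A_I A_comm)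

lemma A_sc: "x \<in> \<A> \<Longrightarrow> r *\<^sub>C x \<in> \<A>"
  by (rule AI) (simp_all add: A_I A_comm)

lemma A_sum: "(\<And>i. i \<in> S \<Longrightarrow> f i \<in> \<A>) \<Longrightarrow> sum f S \<in> \<A>"
proof (induction S rule: infinite_finite_induct)
  case (insert x F)
  then show ?case by (simp add: A_add)
qed (auto intro: AI)

lemma A_adj: assumes "x \<in> \<A>" shows "adj x \<in> \<A>"
proof (rule AI)
  show "I * adj x = adj x" "adj x * I = adj x" using A_I[OF assms] I' by (metis adj_mult)+
  fix w assume "w \<in> \<W>"
  then have "x * adj w = adj w * x" using A_comm[OF assms] W_adj by blast
  then show "adj x * w = w * adj x" by (metis adj_adj adj_mult)
qed

lemma A_modular: assumes "x \<in> \<A>" shows "c * x * s \<in> \<A>"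
proof (rule AI)
  show "I * (c * x * s) = c * x * s" "c * x * s * I = c * x * s"
    using c I' by (metis mult.assoc)+
  fix w assume "w \<in> \<W>"
  then show "c * x * s * w = w * (c * x * s)" using assms unfolding \<A>_def by (intro modular) auto
qed

text \<open>The components of \<open>x\<close> for the eigenvalues of \<open>x \<mapsto> c * x * s\<close> stay in the commutant, because
  they are polynomials in this map applied to \<open>x\<close>.\<close>

lemma eigencomponents:
  assumes x: "x \<in> \<A>"
  shows "\<exists>M y. finite M \<and> x = sum y M \<and> (\<forall>m\<in>M. 0 < m \<and> y m \<in> \<A> \<and> c * y m = complex_of_real m *\<^sub>C (y m * c)
    \<and> (\<forall>p q. p * c = c * p \<longrightarrow> q * c = c * q \<longrightarrow> p * x * q = x \<longrightarrow> p * y m * q = y m))"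
proof -
  obtain L E where sp: "spectral c L E" using spectral_exists I'(6) by blast
  have L: "finite L" "\<And>l. l \<in> L \<Longrightarrow> 0 < l" using sp spectral_pos[OF sp c(1)] by (auto simp: spectral_def)
  have c': "c = (\<Sum>l\<in>L. complex_of_real l *\<^sub>C E l)" using sp by (simp add: spectral_def)
  define P where "P = sum E L"
  have "c * P = c"
    unfolding P_def sum_distrib_left using sp by (simp add: spectral_mult_left[OF sp]) (simp add: spectral_def)
  \<comment> \<open>As \<open>c\<close> is invertible in the corner, its spectral projections
    exhaust \<open>I\<close>.\<close>
  then have "I * P = I" using I'(5) by (metis mult.assoc)
  moreover have "I * P = P" unfolding P_def sum_distrib_left
  proof (rule sum.cong)
    fix l assume l: "l \<in> L"
    have "complex_of_real l *\<^sub>C (I * E l) = I * c * E l" by (simp add: mult.assoc spectral_mult_left[OF sp l])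
    also have "\<dots> = complex_of_real l *\<^sub>C E l" using c by (simp add: spectral_mult_left[OF sp l])
    finally show "I * E l = E l" using L(2)[OF l] by simp
  qed simp
  ultimately have P: "P = I" by simp
  have sE: "E l * s = complex_of_real (1 / l) *\<^sub>C E l" if "l \<in> L" for l
  proof -
    have "E l * c * s = complex_of_real l *\<^sub>C (E l * s)" by (simp add: spectral_mult_left[OF sp that])
    moreover have "E l * I = E l"
    proof -
      have "complex_of_real l *\<^sub>C (E l * I) = E l * c * I" by (simp add: spectral_mult_left[OF sp that])
      also have "\<dots> = E l * c" using I' by (simp only: mult.assoc)
      also have "\<dots> = complex_of_real l *\<^sub>C E l" by (simp add: spectral_mult_left[OF sp that])
      finally show ?thesis using L(2)[OF that] by simp
    qed
    ultimately have "complex_of_real l *\<^sub>C (E l * s) = E l" using cs by (simp add: mult.assoc)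
    then have "complex_of_real (1 / l) *\<^sub>C (complex_of_real l *\<^sub>C (E l * s)) = complex_of_real (1 / l) *\<^sub>C E l" by simp
    then show ?thesis using L(2)[OF that] by simp
  qed
  have cE: "c * E l = complex_of_real l *\<^sub>C E l" "E l * c = complex_of_real l *\<^sub>C E l" if "l \<in> L" for l
    using spectral_mult_left[OF sp that] .
  \<comment> \<open>On the block between \<open>E l\<close> and \<open>E k\<close>, conjugation by
    \<open>c\<close> multiplies by \<open>l / k\<close>. The eigenvalues are these ratios, and
    \<open>y m\<close> collects the blocks of ratio \<open>m\<close>.\<close>
  define M where "M = (\<lambda>(l, k). l / k) ` (L \<times> L)"
  define y where "y m = (\<Sum>(l, k) | (l, k) \<in> L \<times> L \<and> l / k = m. E l * x * E k)" for m
  have fM: "finite M" using L by (simp add: M_def)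
  have gen: "(\<Sum>(l,k)\<in>L \<times> L. g l k *\<^sub>C (E l * x * E k)) = (\<Sum>m\<in>M. \<Sum>(l, k) | (l, k) \<in> L \<times> L \<and> l / k = m. g l k *\<^sub>C (E l * x * E k))"
    for g :: "real \<Rightarrow> real \<Rightarrow> complex"
  proof -
    have "(\<Sum>z\<in>L \<times> L. (\<lambda>(l,k). g l k *\<^sub>C (E l * x * E k)) z) =
      (\<Sum>m\<in>M. \<Sum>z | z \<in> L \<times> L \<and> (\<lambda>(l,k). l / k) z = m. (\<lambda>(l,k). g l k *\<^sub>C (E l * x * E k)) z)"
      unfolding M_def by (rule sum.image_gen) (use L in auto)
    also have "\<dots> = (\<Sum>m\<in>M. \<Sum>(l, k) | (l, k) \<in> L \<times> L \<and> l / k = m. g l k *\<^sub>C (E l * x * E k))"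
      by (intro sum.cong) auto
    finally show ?thesis .
  qed
  have "x = P * x * P" using A_I[OF x] P by simp
  also have "\<dots> = (\<Sum>(l,k)\<in>L \<times> L. 1 *\<^sub>C (E l * x * E k))"
    unfolding P_def sum_distrib_right[of E L x] sum_product sum.cartesian_product by simp
  also have "\<dots> = (\<Sum>m\<in>M. y m)" unfolding gen y_def by (intro sum.cong) auto
  finally have xy: "x = sum y M" .
  have M0: "0 < m" if "m \<in> M" for m using that L by (auto simp: M_def)
  have cy: "c * y m = complex_of_real m *\<^sub>C (y m * c)" for m
    unfolding y_def sum_distrib_left sum_distrib_right fsvs.scale_sum_right
  proof (intro sum.cong refl, clarsimp)
    fix l k assume lk: "l \<in> L" "k \<in> L"
    then have "k \<noteq> 0" using L(2)[of k] by auto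
    then show "c * (E l * x * E k) = (complex_of_real l / complex_of_real k) *\<^sub>C (E l * x * E k * c)"
      using lk by (simp add: mult.assoc cE) (simp add: mult.assoc[symmetric] cE)
  qed
  have cys: "c * y m * s = complex_of_real m *\<^sub>C y m" if "m \<in> M" for m
  proof -
    have "y m * I = y m" unfolding y_def sum_distrib_right
    proof (intro sum.cong refl, clarsimp)
      fix l k assume "l \<in> L" "k \<in> L"
      have "E k * c * s = E k" using sE[OF \<open>k \<in> L\<close>] cE[OF \<open>k \<in> L\<close>] L(2)[OF \<open>k \<in> L\<close>] by simp
      then show "E l * x * E k * I = E l * x * E k" using cs by (simp add: mult.assoc)
    qed
    then show ?thesis unfolding cy by (simp add: mult.assoc cs)
  qed
  have iter: "(\<Sum>m\<in>M. complex_of_real m ^ n *\<^sub>C y m) \<in> \<A>" for n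
  proof (induction n)
    case 0
    then show ?case using x xy by simp
  next
    case (Suc n)
    have "c * (\<Sum>m\<in>M. complex_of_real m ^ n *\<^sub>C y m) * s = (\<Sum>m\<in>M. complex_of_real m ^ Suc n *\<^sub>C y m)"
      unfolding sum_distrib_left sum_distrib_right
      by (intro sum.cong refl) (simp add: cys mult.commute)
    then show ?case using A_modular[OF Suc] by simp
  qed
  \<comment> \<open>A linear condition satisfied on the commutant is satisfied by all iterates of
    the conjugation at \<open>x\<close>, that is by the sums of \<open>m ^ n *\<^sub>C y m\<close>
    for every \<open>n\<close>; the Vandermonde argument passes it on to each component.\<close>
  have ker: "F (y m) = 0" if "m \<in> M" and F0: "F 0 = 0" and FA: "\<And>x. x \<in> \<A> \<Longrightarrow> F x = 0"
    and add: "\<And>x y. F (x + y) = F x + F y" and scl: "\<And>r x. F (r *\<^sub>C x) = r *\<^sub>C F x" for F m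
  proof -
    have Fs: "F (sum h M) = (\<Sum>m\<in>M. F (h m))" for h
      using fM by (induction M rule: finite_induct) (auto simp: F0 add)
    \<comment> \<open>The nodes are real here but complex in \<open>power_sums_eq_0\<close>;
      \<open>Re\<close> undoes the embedding.\<close>
    define z where "z r = F (y (Re r))" for r
    have "z (complex_of_real m) = 0"
    proof (rule power_sums_eq_0)
      show "finite (complex_of_real ` M)" using fM by simp
      show "complex_of_real m \<in> complex_of_real ` M" using that by simp
      fix n
      have "(\<Sum>m\<in>complex_of_real ` M. m ^ n *\<^sub>C z m) = (\<Sum>m\<in>M. complex_of_real m ^ n *\<^sub>C F (y m))"
        by (subst sum.reindex) (auto simp: inj_on_def z_def)
      also have "\<dots> = F (\<Sum>m\<in>M. complex_of_real m ^ n *\<^sub>C y m)" by (simp add: Fs scl)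
      also have "\<dots> = 0" using iter FA by blast
      finally show "(\<Sum>m\<in>complex_of_real ` M. m ^ n *\<^sub>C z m) = 0" .
    qed
    then show ?thesis by (simp add: z_def)
  qed
  have yA: "y m \<in> \<A>" if m: "m \<in> M" for m
  proof (rule AI)
    show "I * y m = y m" using ker[OF m, of "\<lambda>x. I * x - x"] A_I
      by (simp add: distrib_left fsvs.scale_right_diff_distrib)
    show "y m * I = y m" using ker[OF m, of "\<lambda>x. x * I - x"] A_I
      by (simp add: distrib_right fsvs.scale_right_diff_distrib)
    fix w assume w: "w \<in> \<W>"
    show "y m * w = w * y m" using ker[OF m, of "\<lambda>x. x * w - w * x"] A_comm[OF _ w]
      by (simp add: distrib_right distrib_left fsvs.scale_right_diff_distrib)
  qed
  have "p * y m * q = y m" if m: "m \<in> M" and p: "p * c = c * p" and q: "q * c = c * q" and pxq: "p * x * q = x" for m p q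
    unfolding y_def sum_distrib_left sum_distrib_right
  proof (intro sum.cong refl, clarsimp)
    fix l k assume lk: "l \<in> L" "k \<in> L"
    have "p * (E l * x * E k) * q = (p * E l) * x * (E k * q)" by (simp add: mult.assoc)
    also have "\<dots> = (E l * p) * x * (q * E k)" using spectral_commute[OF sp _ p] spectral_commute[OF sp _ q] lk by simp
    also have "\<dots> = E l * (p * x * q) * E k" by (simp only: mult.assoc)
    also have "\<dots> = E l * x * E k" using pxq by simp
    finally show "p * (E l * x * E k) * q = E l * x * E k" .
  qed
  then show ?thesis using fM xy yA M0 cy by blast
qed

end

definition pos_form :: "nat \<Rightarrow> (nat \<Rightarrow> nat \<Rightarrow> complex) \<Rightarrow> bool" where
  "pos_form n L \<longleftrightarrow> (\<forall>\<xi>. 0 \<le> (\<Sum>i<n. \<Sum>j<n. cnj (\<xi> i) * L i j * \<xi> j))"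

definition range_proj :: "nat \<Rightarrow> (nat \<Rightarrow> fsmat) \<Rightarrow> fsmat" where
  "range_proj n v = (\<Sum>i<n. v i * adj (v i))"

text \<open>The \<open>v i\<close> are partial isometries with common initial projection
  \<open>p\<close> and pairwise orthogonal ranges, so the sum is the projection onto
  \<open>n\<close> orthogonal copies of the range of \<open>p\<close>.\<close>

lemma range_proj:
  assumes p: "proj p" and v: "\<And>i. i < n \<Longrightarrow> v i * p = v i"
    and vv: "\<And>i j. i < n \<Longrightarrow> j < n \<Longrightarrow> adj (v i) * v j = (if i = j then p else 0)"
  shows "proj (range_proj n v)" "tr (range_proj n v) = of_nat n * tr p"
    "\<And>i. i < n \<Longrightarrow> range_proj n v * v i = v i"
proof -
  let ?z = "range_proj n v"
  show zv: "?z * v i = v i" if "i < n" for i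
  proof -
    have "?z * v i = (\<Sum>j<n. v j * (adj (v j) * v i))"
      unfolding range_proj_def by (simp add: sum_distrib_right mult.assoc)
    also have "\<dots> = (\<Sum>j<n. if j = i then v i else 0)"
      by (rule sum.cong) (use that vv v in auto)
    also have "\<dots> = v i" using that by simp
    finally show ?thesis .
  qed
  have "?z * ?z = (\<Sum>i<n. ?z * v i * adj (v i))"
    by (subst (2) range_proj_def) (simp add: sum_distrib_left mult.assoc)
  also have "\<dots> = (\<Sum>i<n. v i * adj (v i))" by (simp add: zv)
  finally have "?z * ?z = ?z" by (simp only: range_proj_def)
  then show "proj ?z" by (simp add: proj_def) (simp add: range_proj_def)
  have "tr ?z = (\<Sum>i<n. tr (adj (v i) * v i))"
    unfolding range_proj_def tr_sum by (rule sum.cong) (auto simp: tr_mult_commute[of "v _"])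
  then show "tr ?z = of_nat n * tr p" by (simp add: vv)
qed

subsection \<open>Block decomposition of the commutant\<close>

context modular_commutant
begin

text \<open>A full matrix block of the commutant: \<open>p\<close> is a minimal projection and the
  \<open>v i\<close> carry it to \<open>n\<close> orthogonal copies, so that the
  \<open>v i * adj (v j)\<close> are matrix units and \<open>range_proj n v\<close> is the unit of
  the block. Each \<open>v i\<close> is an eigenvector of conjugation by \<open>c\<close>, with
  eigenvalue \<open>m i\<close>.\<close>

definition block :: "fsmat \<Rightarrow> nat \<Rightarrow> (nat \<Rightarrow> fsmat) \<Rightarrow> (nat \<Rightarrow> real) \<Rightarrow> bool" where
  "block p n v m \<longleftrightarrow> proj p \<and> p \<noteq> 0 \<and> p \<in> \<A> \<and> p * c = c * p \<and> (\<forall>x\<in>\<A>. \<exists>r. p * x * p = r *\<^sub>C p) \<and> 0 < n \<and>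
    (\<forall>i<n. v i \<in> \<A> \<and> v i * p = v i \<and> 0 < m i \<and> c * v i = complex_of_real (m i) *\<^sub>C (v i * c)) \<and>
    (\<forall>i<n. \<forall>j<n. adj (v i) * v j = (if i = j then p else 0)) \<and>
    (\<forall>x\<in>\<A>. range_proj n v * x = x * range_proj n v)"

definition central :: "fsmat \<Rightarrow> bool" where
  "central q \<longleftrightarrow> proj q \<and> q \<in> \<A> \<and> q * c = c * q \<and> (\<forall>x\<in>\<A>. q * x = x * q)"

definition rk :: "fsmat \<Rightarrow> nat" where "rk p = (THE n. tr p = of_nat n)"

lemma tr_rk: "proj p \<Longrightarrow> tr p = of_nat (rk p)"
  unfolding rk_def by (rule theI') (use tr_proj_nat[of p] in auto)

lemma rk_eq_0: "proj p \<Longrightarrow> rk p = 0 \<longleftrightarrow> p = 0"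
  using tr_rk[of p] tr_proj_eq_0[of p] by simp

lemma rk_diff: "proj p \<Longrightarrow> proj q \<Longrightarrow> q * p = p \<Longrightarrow> rk q = rk p + rk (q - p)"
proof -
  assume a: "proj p" "proj q" "q * p = p"
  then have "proj (q - p)" by (rule proj_diff)
  then have "of_nat (rk q) = (of_nat (rk p + rk (q - p)) :: complex)"
    using tr_rk a by (simp add: tr_diff flip: tr_rk)
  then show ?thesis by (simp only: of_nat_eq_iff)
qed

lemma eigen_adj:
  assumes "c * v = complex_of_real m *\<^sub>C (v * c)"
  shows "adj v * c = complex_of_real m *\<^sub>C (c * adj v)"
  using arg_cong[OF assms, of adj] I' by simp

text \<open>Taking adjoints inverts the eigenvalue of the conjugation, so a product of one
  eigenvector with the adjoint of another of the same eigenvalue is left fixed.\<close>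

lemma eigen_adj_mult:
  assumes v: "c * v = complex_of_real m *\<^sub>C (v * c)" and w: "c * w = complex_of_real m *\<^sub>C (w * c)" and m: "0 < m"
  shows "(adj v * w) * c = c * (adj v * w)" "(v * adj w) * c = c * (v * adj w)"
proof -
  have "complex_of_real m *\<^sub>C (c * (adj v * w)) = adj v * c * w"
    by (simp add: eigen_adj[OF v] mult.assoc[symmetric])
  also have "\<dots> = complex_of_real m *\<^sub>C (adj v * w * c)" by (simp add: mult.assoc w)
  finally show "(adj v * w) * c = c * (adj v * w)" using m by simp
  have "c * (v * adj w) = complex_of_real m *\<^sub>C (v * c * adj w)" by (simp add: mult.assoc[symmetric] v)
  also have "\<dots> = v * adj w * c" by (simp add: mult.assoc eigen_adj[OF w])
  finally show "(v * adj w) * c = c * (v * adj w)" by simp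
qed

text \<open>The projection \<open>p\<close> is minimal only among those commuting with \<open>c\<close>. An eigencomponent \<open>y\<close> of \<open>x\<close> has
  \<open>adj y * y\<close> and \<open>y * adj y\<close> commuting with \<open>c\<close>, hence scalar on \<open>p\<close>; comparing traces against \<open>c\<close> shows
  that its eigenvalue is 1.\<close>

lemma minimal_scalar:
  assumes p: "proj p" "p \<noteq> 0" "p \<in> \<A>" "p * c = c * p"
    and min: "\<And>p'. proj p' \<Longrightarrow> p' \<noteq> 0 \<Longrightarrow> p' \<in> \<A> \<Longrightarrow> p' * c = c * p' \<Longrightarrow> p * p' = p' \<Longrightarrow> rk p \<le> rk p'"
    and x: "x \<in> \<A>" "p * x * p = x"
  shows "\<exists>r. x = r *\<^sub>C p"
proof -
  \<comment> \<open>The spectral projections of \<open>h\<close> lie in the commutant, commute with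
    \<open>c\<close> and are below \<open>p\<close>; minimality of the rank makes each of them equal
    to \<open>p\<close>.\<close>
  have herm: "\<exists>r. h = r *\<^sub>C p" if h: "h \<in> \<A>" "p * h * p = h" "adj h = h" "h * c = c * h" for h
  proof -
    obtain L E where sp: "spectral h L E" using spectral_exists h by blast
    have ph: "p * h = h" using h p by (metis mult.assoc proj_idem)
    have "E l = p" if l: "l \<in> L" for l
    proof -
      have E: "proj (E l)" "E l \<noteq> 0" "l \<noteq> 0" using sp l by (auto simp: spectral_def)
      have left: "y * E l = E l" if "y * h = h" for y
      proof -
        have "complex_of_real l *\<^sub>C (y * E l) = y * h * E l" by (simp add: mult.assoc spectral_mult_left[OF sp l])
        also have "\<dots> = complex_of_real l *\<^sub>C E l" using that by (simp add: spectral_mult_left[OF sp l])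
        finally show ?thesis using E by simp
      qed
      have pE: "p * E l = E l" using left[OF ph] .
      have IE: "I * E l = E l" using left A_I h by blast
      have "E l \<in> \<A>"
      proof (rule AI)
        show "I * E l = E l" by (rule IE)
        then show "E l * I = E l" using E I' by (metis adj_mult proj_adj)
        fix w assume "w \<in> \<W>"
        then have "w * h = h * w" using A_comm[OF h(1)] by simp
        then show "E l * w = w * E l" using spectral_commute[OF sp l] by simp
      qed
      moreover have "E l * c = c * E l" using spectral_commute[OF sp l, of c] h by simp
      ultimately have "rk p \<le> rk (E l)" using min E pE by blast
      then have "rk (p - E l) = 0" using rk_diff[OF E(1) p(1) pE] by simp
      then show ?thesis using rk_eq_0 proj_diff[OF E(1) p(1) pE] by simp
    qed
    then have "h = (\<Sum>l\<in>L. complex_of_real l *\<^sub>C p)" using sp by (simp add: spectral_def)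
    then show ?thesis unfolding fsvs.scale_sum_left[symmetric] by blast
  qed
  have comm: "\<exists>r. x = r *\<^sub>C p" if x: "x \<in> \<A>" "p * x * p = x" "x * c = c * x" for x
  proof -
    have x': "adj x \<in> \<A>" "p * adj x * p = adj x" "adj x * c = c * adj x"
      using A_adj[OF x(1)] arg_cong[OF x(2), of adj] arg_cong[OF x(3), of adj]
      by (simp_all add: proj_adj[OF p(1)] I'(6) mult.assoc)
    define h1 where "h1 = x + adj x"
    define h2 where "h2 = \<i> *\<^sub>C (x - adj x)"
    have "h1 \<in> \<A>" "h2 \<in> \<A>" unfolding h1_def h2_def using A_add A_diff A_sc x x' by auto
    moreover have "p * h1 * p = h1" "p * h2 * p = h2" unfolding h1_def h2_def
      using x x' by (simp_all add: left_diff_distrib right_diff_distrib distrib_left distrib_right)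
    moreover have "adj h1 = h1" "adj h2 = h2" unfolding h1_def h2_def
      by (simp_all add: fsvs.scale_right_diff_distrib)
    moreover have "h1 * c = c * h1" "h2 * c = c * h2" unfolding h1_def h2_def
      using x x' by (simp_all add: left_diff_distrib right_diff_distrib distrib_left distrib_right)
    ultimately obtain r1 r2 where r: "h1 = r1 *\<^sub>C p" "h2 = r2 *\<^sub>C p" using herm by meson
    have "h1 - \<i> *\<^sub>C h2 = x + x" unfolding h1_def h2_def by simp
    also have "\<dots> = 2 *\<^sub>C x" using fsvs.scale_left_distrib[of 1 1 x] by simp
    finally have "(1/2) *\<^sub>C (2 *\<^sub>C x) = (1/2) *\<^sub>C (h1 - \<i> *\<^sub>C h2)" by simp
    then have "x = ((1/2) * (r1 - \<i> * r2)) *\<^sub>C p" using r by (simp add: fsvs.scale_left_diff_distrib fsvs.scale_right_diff_distrib right_diff_distrib)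
    then show ?thesis by blast
  qed
  \<comment> \<open>\<open>c\<close> is invertible in the corner, so it gives positive weight to
    every nonzero projection there; the comparison of traces below divides by this number.\<close>
  have trpc: "tr (c * p) \<noteq> 0"
  proof
    assume "tr (c * p) = 0"
    then have "tr (adj p * c * p) = 0" using p tr_mult_commute[of p "c * p"] by (simp add: proj_def mult.assoc)
    then have "adj p * c * p = 0" using pos_tr_eq_0 pos_conj c by blast
    then have "c * p = 0" using pos_conj_eq_0 c by blast
    then have "s * c * p = 0" by (simp add: mult.assoc)
    then show False using I' A_I p by simp
  qed
  have trp: "tr p \<noteq> 0" using p tr_proj_eq_0 by blast
  obtain M y where M: "finite M" "x = sum y M" and
    y: "\<And>m. m \<in> M \<Longrightarrow> 0 < m \<and> y m \<in> \<A> \<and> c * y m = complex_of_real m *\<^sub>C (y m * c) \<and> p * y m * p = y m"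
    using eigencomponents[OF x(1)] x(2) p(4) by metis
  have "\<exists>r. y m = r *\<^sub>C p" if m: "m \<in> M" for m
  proof (cases "y m = 0")
    case True
    then show ?thesis by (intro exI[of _ 0]) simp
  next
    case False
    have ym: "0 < m" "y m \<in> \<A>" "c * y m = complex_of_real m *\<^sub>C (y m * c)" "p * y m * p = y m" using y[OF m] by auto
    have py: "p * y m = y m" "y m * p = y m" using ym(4) p by (metis mult.assoc proj_idem)+
    have py': "p * adj (y m) = adj (y m)" "adj (y m) * p = adj (y m)" using py p by (metis adj_mult proj_adj)+
    have "\<exists>r. adj (y m) * y m = r *\<^sub>C p"
      by (rule comm) (use ym eigen_adj_mult[OF ym(3,3)] A_mult A_adj py py' in \<open>auto simp: mult.assoc\<close>, simp add: mult.assoc[symmetric] py')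
    moreover have "\<exists>r. y m * adj (y m) = r *\<^sub>C p"
      by (rule comm) (use ym eigen_adj_mult[OF ym(3,3)] A_mult A_adj py py' in \<open>auto simp: mult.assoc\<close>, simp add: mult.assoc[symmetric] py)
    ultimately obtain k k' where k: "adj (y m) * y m = k *\<^sub>C p" "y m * adj (y m) = k' *\<^sub>C p" by blast
    have "k * tr p = k' * tr p" using tr_mult_commute[of "adj (y m)" "y m"] by (simp add: k tr_sc)
    then have kk: "k' = k" using trp by simp
    have k0: "k \<noteq> 0" using k(1) False adj_mult_self_eq_0 by fastforce
    \<comment> \<open>One evaluation moves \<open>c\<close> past \<open>y m\<close> and picks up the
      factor \<open>m\<close>; the other cycles the trace until \<open>y m * adj (y m)\<close>
      appears and picks up none.\<close>
    have "tr (adj (y m) * (c * y m)) = complex_of_real m * (k * tr (c * p))"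
      by (simp add: ym mult.assoc[symmetric] k tr_sc p(4))
    moreover have "tr (adj (y m) * (c * y m)) = tr (c * y m * adj (y m))" by (rule tr_mult_commute)
    moreover have "\<dots> = k * tr (c * p)" by (simp add: mult.assoc k kk tr_sc)
    ultimately have "m = 1" using k0 trpc by simp
    then show ?thesis using ym comm by simp
  qed
  then obtain r where "\<And>m. m \<in> M \<Longrightarrow> y m = r m *\<^sub>C p" by metis
  then have "x = (\<Sum>m\<in>M. r m *\<^sub>C p)" using M by simp
  then show ?thesis unfolding fsvs.scale_sum_left[symmetric] by blast
qed

lemma range_proj_A:
  assumes "\<And>i. i < n \<Longrightarrow> v i \<in> \<A> \<and> 0 < m i \<and> c * v i = complex_of_real (m i) *\<^sub>C (v i * c)"
  shows "range_proj n v \<in> \<A>" "range_proj n v * c = c * range_proj n v"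
proof -
  show "range_proj n v \<in> \<A>" unfolding range_proj_def using assms A_adj A_mult by (intro A_sum) auto
  have "v i * adj (v i) * c = c * (v i * adj (v i))" if "i < n" for i
    using eigen_adj_mult(2)[of "v i" "m i" "v i"] assms[OF that] by blast
  then show "range_proj n v * c = c * range_proj n v"
    unfolding range_proj_def sum_distrib_left sum_distrib_right by (intro sum.cong) auto
qed

text \<open>Choose \<open>p\<close> of least rank below \<open>q\<close> among the nonzero
  projections of the commutant that commute with \<open>c\<close>, then a longest family of
  eigenvectors \<open>v i\<close> that are partial isometries starting at \<open>p\<close>. The part
  \<open>q1\<close> of \<open>q\<close> outside their ranges satisfies \<open>q1 * x * p = 0\<close>
  for all \<open>x\<close> in the commutant, because a nonzero eigencomponent of it, normalised,
  would lengthen the family. Hence the range projection of the family is central.\<close>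

lemma block_exists:
  assumes q: "central q" "q \<noteq> 0"
  shows "\<exists>p n v m. block p n v m \<and> q * range_proj n v = range_proj n v"
proof -
  have q': "proj q" "q \<in> \<A>" "q * c = c * q" "\<And>x. x \<in> \<A> \<Longrightarrow> q * x = x * q"
    using q by (auto simp: central_def)
  define P where "P p \<longleftrightarrow> proj p \<and> p \<noteq> 0 \<and> p \<in> \<A> \<and> p * c = c * p \<and> q * p = p" for p
  have "P q" using q(2) q'(1-3) by (simp add: P_def proj_def)
  then obtain p where p: "P p" and min: "\<And>p'. P p' \<Longrightarrow> rk p \<le> rk p'"
    using ex_has_least_nat[of P q rk] by blast
  have p': "proj p" "p \<noteq> 0" "p \<in> \<A>" "p * c = c * p" "q * p = p" "p * p = p" "adj p = p"
    using p by (auto simp: P_def proj_def)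
  have scalar: "\<exists>r. x = r *\<^sub>C p" if "x \<in> \<A>" "p * x * p = x" for x
    by (rule minimal_scalar[OF p'(1-4) _ that], rule min) (use p' in \<open>auto simp: P_def, metis mult.assoc\<close>)
  define R where "R n v m \<longleftrightarrow> (\<forall>i<n. v i \<in> \<A> \<and> v i * p = v i \<and> 0 < m i \<and> c * v i = complex_of_real (m i) *\<^sub>C (v i * c)) \<and>
    (\<forall>i<n. \<forall>j<n. adj (v i) * v j = (if i = j then p else 0))" for n v and m :: "nat \<Rightarrow> real"
  have qv: "q * x = x" if "x \<in> \<A>" "x * p = x" for x
    using q'(4)[OF that(1)] that p' q' by (metis mult.assoc)
  have rp: "proj (range_proj n v)" "tr (range_proj n v) = of_nat n * tr p" "q * range_proj n v = range_proj n v"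
    "range_proj n v \<in> \<A>" "range_proj n v * c = c * range_proj n v"
    "\<And>i. i < n \<Longrightarrow> range_proj n v * v i = v i" if R: "R n v m" for n v m
  proof -
    show "proj (range_proj n v)" "tr (range_proj n v) = of_nat n * tr p" "\<And>i. i < n \<Longrightarrow> range_proj n v * v i = v i"
      using range_proj[OF p'(1), of n v] R unfolding R_def by blast+
    show "range_proj n v \<in> \<A>" "range_proj n v * c = c * range_proj n v"
      using range_proj_A[of n v m] R unfolding R_def by blast+
    show "q * range_proj n v = range_proj n v" unfolding range_proj_def sum_distrib_left
      by (rule sum.cong) (use R qv in \<open>auto simp: R_def mult.assoc[symmetric]\<close>)
  qed
  have bound: "n \<le> rk q" if R: "R n v m" for n v m
  proof -
    have "rk q = rk (range_proj n v) + rk (q - range_proj n v)" by (rule rk_diff) (use rp(1,3)[OF R] q'(1) in auto)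
    moreover have "of_nat (rk (range_proj n v)) = (of_nat (n * rk p) :: complex)"
      using rp[OF R] tr_rk p' by (metis of_nat_mult)
    then have "rk (range_proj n v) = n * rk p" by (simp only: of_nat_eq_iff)
    moreover have "rk p \<noteq> 0" using rk_eq_0 p' by blast
    ultimately show ?thesis by (metis le_add1 mult.right_neutral mult_le_mono2 le_trans One_nat_def Suc_leI neq0_conv)
  qed
  have R1: "\<exists>v m. R 1 v m" by (rule exI[of _ "\<lambda>_. p"], rule exI[of _ "\<lambda>_. 1"]) (use p' in \<open>simp add: R_def\<close>)
  define n where "n = (GREATEST n. \<exists>v m. R n v m)"
  have "\<exists>v m. R n v m" unfolding n_def by (rule GreatestI_nat[where k = 1 and b = "rk q"]) (use bound R1 in blast)+
  then obtain v m where R: "R n v m" by blast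
  have nS: "\<not> R (Suc n) v' m'" for v' m'
    using Greatest_le_nat[of "\<lambda>n. \<exists>v m. R n v m" "Suc n" "rk q"] bound unfolding n_def[symmetric] by fastforce
  have "1 \<le> n" unfolding n_def by (rule Greatest_le_nat[where b = "rk q"]) (use bound R1 in blast)+
  define z where "z = range_proj n v"
  note z = rp[OF R, folded z_def]
  have vi: "v i \<in> \<A>" "v i * p = v i" "0 < m i" "c * v i = complex_of_real (m i) *\<^sub>C (v i * c)" if "i < n" for i
    using R that by (auto simp: R_def)
  have vv: "adj (v i) * v j = (if i = j then p else 0)" if "i < n" "j < n" for i j
    using R that by (auto simp: R_def)
  define q1 where "q1 = q - z"
  have q1: "q1 \<in> \<A>" "q1 * c = c * q1" "proj q1" unfolding q1_def using A_diff q'(1-3) z(1-5) proj_diff[OF z(1) q'(1) z(3)]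
    by (auto simp: left_diff_distrib right_diff_distrib)
  have q1v: "q1 * v i = 0" if "i < n" for i using z(6)[OF that] qv vi[OF that] by (simp add: q1_def left_diff_distrib)
  have vq1: "adj (v i) * q1 = 0" if "i < n" for i using arg_cong[OF q1v[OF that], of adj] q1 by (simp add: proj_def)
  have zero: "q1 * x * p = 0" if x: "x \<in> \<A>" for x
  proof (rule ccontr)
    assume nz: "q1 * x * p \<noteq> 0"
    have XA: "q1 * x * p \<in> \<A>" using A_mult x q1 p' by blast
    have Xq: "q1 * (q1 * x * p) * p = q1 * x * p" using q1 p' by (metis mult.assoc proj_idem)
    obtain M y where M: "finite M" "q1 * x * p = sum y M" and
      y: "\<And>m. m \<in> M \<Longrightarrow> 0 < m \<and> y m \<in> \<A> \<and> c * y m = complex_of_real m *\<^sub>C (y m * c) \<and> q1 * y m * p = y m"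
      using eigencomponents[OF XA] Xq p'(4) q1(2) by metis
    obtain l where l: "l \<in> M" "y l \<noteq> 0" using nz M by (metis sum.neutral)
    have yl: "0 < l" "y l \<in> \<A>" "c * y l = complex_of_real l *\<^sub>C (y l * c)" "q1 * y l * p = y l" using y[OF l(1)] by auto
    have yp: "y l * p = y l" "q1 * y l = y l" using yl(4) p' q1 by (metis mult.assoc proj_idem)+
    have py: "p * adj (y l) = adj (y l)" using yp p' by (metis adj_mult)
    have "p * (adj (y l) * y l) * p = adj (y l) * y l" by (simp add: mult.assoc yp) (simp add: mult.assoc[symmetric] py)
    then obtain k where k: "adj (y l) * y l = k *\<^sub>C p" using scalar[of "adj (y l) * y l"] A_mult A_adj yl by blast
    have kt: "0 < k * tr p" using tr_adj_mult_self_nonneg[of "y l"] tr_adj_mult_self_eq_0[of "y l"] l(2)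
      unfolding k tr_sc by (metis less_le)
    moreover have "0 < tr p" using tr_proj_nonneg[OF p'(1)] tr_proj_eq_0[OF p'(1)] p' by (metis less_le)
    ultimately have "0 < k" by (auto simp: less_complex_def zero_less_mult_iff)
    then have k': "k = complex_of_real (Re k)" "0 < Re k" by (auto simp: less_complex_def complex_eq_iff)
    \<comment> \<open>\<open>adj (y l) * y l\<close> is \<open>k\<close> times \<open>p\<close> with
      \<open>k > 0\<close>, so this scaling yields a partial isometry with initial projection
      \<open>p\<close>.\<close>
    define r where "r = complex_of_real (1 / sqrt (Re k))"
    have "1 / sqrt (Re k) * (1 / sqrt (Re k)) * Re k = 1" using k' by simp
    then have rr: "cnj r * r * k = 1"
      unfolding r_def by (subst k'(1), simp only: complex_cnj_complex_of_real of_real_mult[symmetric] of_real_1)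
    define w where "w = r *\<^sub>C y l"
    have "adj w * w = p" using rr by (simp add: w_def k mult.assoc mult.left_commute)
    moreover have "adj (v i) * w = 0" if "i < n" for i
      using vq1[OF that] yp(2) by (simp add: w_def) (metis mult.assoc mult_zero_left fsvs.scale_zero_right)
    moreover from this have "adj w * v i = 0" if "i < n" for i
      using that adj_inject[of "adj w * v i" 0] by simp
    moreover have "w \<in> \<A>" "w * p = w" "c * w = complex_of_real l *\<^sub>C (w * c)"
      unfolding w_def using yl A_sc yp by (auto simp: mult.commute)
    ultimately have "R (Suc n) (v(n := w)) (m(n := l))"
      using vi vv yl(1) unfolding R_def by (auto simp: less_Suc_eq)
    then show False using nS by blast
  qed
  have zero': "q1 * x * z = 0" if x: "x \<in> \<A>" for x
  proof -
    have "q1 * x * z = (\<Sum>i<n. q1 * (x * v i) * p * adj (v i))"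
      unfolding z_def range_proj_def sum_distrib_left using vi by (intro sum.cong) (auto simp: mult.assoc[symmetric], simp add: mult.assoc)
    also have "\<dots> = 0" using zero A_mult x vi by (intro sum.neutral) auto
    finally show ?thesis .
  qed
  \<comment> \<open>The range of \<open>z\<close> is invariant under the algebra. As the algebra
    contains adjoints, invariance becomes commutation.\<close>
  have xz: "x * z = z * x * z" if x: "x \<in> \<A>" for x
  proof -
    have "q * x * z = x * z" using q'(4)[OF x] z by (simp add: mult.assoc)
    then show ?thesis using zero'[OF x] by (simp add: q1_def left_diff_distrib)
  qed
  have "z * x = x * z" if x: "x \<in> \<A>" for x
    using arg_cong[OF xz[OF A_adj[OF x]], of adj] xz[OF x] z(1) by (simp add: proj_def mult.assoc)
  moreover have "\<exists>r. p * x * p = r *\<^sub>C p" if "x \<in> \<A>" for x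
    using that p' A_mult by (intro scalar) (auto simp: mult.assoc, simp add: mult.assoc[symmetric])
  ultimately have "block p n v m"
    unfolding block_def using p' vi vv \<open>1 \<le> n\<close> by (auto simp: z_def)
  then show ?thesis using z(3) unfolding z_def by blast
qed

lemma blockD:
  assumes "block p n v m"
  shows "proj p" "p \<noteq> 0" "p \<in> \<A>" "p * c = c * p" "0 < n"
    "\<And>i. i < n \<Longrightarrow> v i \<in> \<A> \<and> v i * p = v i \<and> 0 < m i \<and> c * v i = complex_of_real (m i) *\<^sub>C (v i * c)"
    "\<And>i j. i < n \<Longrightarrow> j < n \<Longrightarrow> adj (v i) * v j = (if i = j then p else 0)"
    "\<And>x. x \<in> \<A> \<Longrightarrow> \<exists>r. p * x * p = r *\<^sub>C p"
    "central (range_proj n v)" "range_proj n v \<noteq> 0"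
    "\<And>i. i < n \<Longrightarrow> range_proj n v * v i = v i"
proof -
  show 1: "proj p" "p \<noteq> 0" "p \<in> \<A>" "p * c = c * p" "0 < n"
    "\<And>i. i < n \<Longrightarrow> v i \<in> \<A> \<and> v i * p = v i \<and> 0 < m i \<and> c * v i = complex_of_real (m i) *\<^sub>C (v i * c)"
    "\<And>i j. i < n \<Longrightarrow> j < n \<Longrightarrow> adj (v i) * v j = (if i = j then p else 0)"
    "\<And>x. x \<in> \<A> \<Longrightarrow> \<exists>r. p * x * p = r *\<^sub>C p"
    using assms unfolding block_def by blast+
  have 2: "proj (range_proj n v)" "tr (range_proj n v) = of_nat n * tr p"
    and 3: "\<And>i. i < n \<Longrightarrow> range_proj n v * v i = v i" using range_proj[OF 1(1), of n v] 1 by blast+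
  show "\<And>i. i < n \<Longrightarrow> range_proj n v * v i = v i" by (rule 3)
  show "range_proj n v \<noteq> 0"
    using 2 1 tr_proj_eq_0[OF 1(1)] by (metis mult_eq_0_iff neq0_conv of_nat_eq_0_iff tr_0)
  show "central (range_proj n v)"
    unfolding central_def using 2 range_proj_A[of n v m] 1(6) assms unfolding block_def by blast
qed

definition decomposes ::
  "fsmat \<Rightarrow> nat \<Rightarrow> (nat \<Rightarrow> fsmat) \<Rightarrow> (nat \<Rightarrow> nat) \<Rightarrow> (nat \<Rightarrow> nat \<Rightarrow> fsmat) \<Rightarrow> (nat \<Rightarrow> nat \<Rightarrow> real) \<Rightarrow> bool" where
  "decomposes q K p n v m \<longleftrightarrow> (\<forall>k<K. block (p k) (n k) (v k) (m k)) \<and> (\<Sum>k<K. range_proj (n k) (v k)) = q \<and>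
    (\<forall>k<K. q * range_proj (n k) (v k) = range_proj (n k) (v k)) \<and>
    (\<forall>j<K. \<forall>k<K. j \<noteq> k \<longrightarrow> range_proj (n j) (v j) * range_proj (n k) (v k) = 0)"

text \<open>The unit \<open>z\<close> of one block below \<open>q\<close> is central, so
  \<open>q - z\<close> is again central and has smaller rank.\<close>

lemma blocks_exist:
  assumes "central q"
  shows "\<exists>K p n v m. decomposes q K p n v m"
  using assms
proof (induction "rk q" arbitrary: q rule: less_induct)
  case less
  show ?case
  proof (cases "q = 0")
    case True
    then have "decomposes q 0 p n v m" for p n v m by (simp add: decomposes_def)
    then show ?thesis by blast
  next
    case False
    obtain p n v m where b: "block p n v m" and qz: "q * range_proj n v = range_proj n v"
      using block_exists[OF less.prems False] by blast
    define z where "z = range_proj n v"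
    have z: "central z" "z \<noteq> 0" "q * z = z" using blockD[OF b] qz by (auto simp: z_def)
    have "q * z = z * q" using less.prems z(1) unfolding central_def by blast
    then have zq: "z * q = z" using z(3) by simp
    have "proj z" "proj q" using z(1) less.prems unfolding central_def by blast+
    then have pz: "proj z" "proj q" "z * z = z" by (simp_all add: proj_def)
    have lt: "rk (q - z) < rk q" using rk_diff[OF pz(1,2) z(3)] rk_eq_0[OF pz(1)] z(2) by simp
    have cq: "central (q - z)"
      unfolding central_def
    proof (intro conjI ballI)
      show "proj (q - z)" by (rule proj_diff[OF pz(1,2) z(3)])
      show "q - z \<in> \<A>" using A_diff less.prems z(1) unfolding central_def by blast
      have "q * c = c * q" "z * c = c * z" using less.prems z(1) unfolding central_def by blast+
      then show "(q - z) * c = c * (q - z)" by (simp add: left_diff_distrib right_diff_distrib)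
      fix x assume "x \<in> \<A>"
      then have "q * x = x * q" "z * x = x * z" using less.prems z(1) unfolding central_def by blast+
      then show "(q - z) * x = x * (q - z)" by (simp add: left_diff_distrib right_diff_distrib)
    qed
    from less.hyps[OF lt cq] obtain K P N V M where "decomposes (q - z) K P N V M"
      by blast
    then have IH: "\<forall>k<K. block (P k) (N k) (V k) (M k)" "(\<Sum>k<K. range_proj (N k) (V k)) = q - z"
       "\<forall>k<K. (q - z) * range_proj (N k) (V k) = range_proj (N k) (V k)"
       "\<forall>j<K. \<forall>k<K. j \<noteq> k \<longrightarrow> range_proj (N j) (V j) * range_proj (N k) (V k) = 0"
      unfolding decomposes_def by blast+
    have zz: "z * range_proj (N k) (V k) = 0" if "k < K" for k
    proof -
      have "z * ((q - z) * range_proj (N k) (V k)) = 0" using zq pz by (simp add: mult.assoc[symmetric] right_diff_distrib)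
      then show ?thesis using IH(3) that by simp
    qed
    have zz': "range_proj (N k) (V k) * z = 0" if "k < K" for k
    proof -
      have "range_proj (N k) (V k) \<in> \<A>" using IH(1) that blockD(9) unfolding central_def by blast
      then show ?thesis using zz[OF that] z(1) unfolding central_def by metis
    qed
    have qz': "q * range_proj (N k) (V k) = range_proj (N k) (V k)" if "k < K" for k
      using IH(3) that zz[OF that] by (metis diff_zero left_diff_distrib)
    have "decomposes q (Suc K) (P(K := p)) (N(K := n)) (V(K := v)) (M(K := m))"
      unfolding decomposes_def using IH b z zz zz' qz' by (auto simp: less_Suc_eq z_def[symmetric])
    then show ?thesis by blast
  qed
qed

text \<open>The \<open>w k i b\<close> form an orthonormal basis adapted to a direct sum of tensor
  products: \<open>i\<close> indexes the left factor of summand \<open>k\<close>, and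
  \<open>b\<close> the right one. The last clause is the factorisation: an element \<open>x\<close>
  of the commutant, weighted by \<open>c\<close> and placed between elements of \<open>\<W>\<close>,
  is block diagonal in \<open>k\<close>, with a left matrix \<open>L\<close> that depends on
  \<open>x\<close> alone and a right matrix free of \<open>x\<close>.\<close>

definition adapted_basis ::
  "nat \<Rightarrow> (nat \<Rightarrow> nat) \<Rightarrow> (nat \<Rightarrow> nat) \<Rightarrow> (nat \<Rightarrow> nat \<Rightarrow> nat \<Rightarrow> fsmat) \<Rightarrow> (nat \<Rightarrow> nat \<Rightarrow> fsmat) \<Rightarrow> (nat \<Rightarrow> fsmat) \<Rightarrow> bool" where
  "adapted_basis K aL aR w f p \<longleftrightarrow> (\<forall>k<K. 0 < aL k \<and> 0 < aR k) \<and>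
    (\<forall>k<K. \<forall>i<aL k. \<forall>b<aR k. w k i b * mu 0 0 = w k i b) \<and>
    (\<forall>k<K. \<forall>i<aL k. \<forall>b<aR k. \<forall>k'<K. \<forall>i'<aL k'. \<forall>b'<aR k'. adj (w k i b) * w k' i' b' =
       (if k = k' \<and> i = i' \<and> b = b' then mu 0 0 else 0)) \<and>
    (\<Sum>k<K. \<Sum>i<aL k. \<Sum>b<aR k. w k i b * adj (w k i b)) = I \<and>
    (\<forall>k<K. proj (p k)) \<and> (\<forall>k<K. \<forall>b<aR k. f k b * mu 0 0 = f k b) \<and>
    (\<forall>x\<in>\<A>. \<exists>L. (pos x \<longrightarrow> (\<forall>k<K. pos_form (aL k) (L k))) \<and>
      (\<forall>z\<in>\<W>. \<forall>z'\<in>\<W>. \<forall>k<K. \<forall>i<aL k. \<forall>b<aR k. \<forall>k'<K. \<forall>i'<aL k'. \<forall>b'<aR k'.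
        adj (w k i b) * (z * c * x * c * z') * w k' i' b' =
         (if k = k' then L k i i' *\<^sub>C (adj (f k b) * (z * c * p k * c * z') * f k b') else 0)))"

text \<open>The basis is \<open>w k i b = v k i * f k b\<close>, with the \<open>f k b\<close> an
  orthonormal basis of the range of \<open>p k\<close>. Moving \<open>v k i\<close> inwards costs
  nothing at elements of \<open>\<W>\<close>, which commute with the algebra, and a factor
  \<open>m k i\<close> at \<open>c\<close>. What remains in the middle,
  \<open>adj (v k i) * x * v k j\<close>, is a multiple of \<open>p k\<close> by minimality.\<close>

theorem adapted_basis_exists: "\<exists>K aL aR w f p. adapted_basis K aL aR w f p"
proof -
  have "I \<in> \<A>" by (rule AI) (simp_all add: I'(2) W)
  then have "central I" unfolding central_def using I I'(3) c(2) A_I by simp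
  from blocks_exist[OF this] obtain K p n v m where "decomposes I K p n v m"
    by blast
  then have b: "\<And>k. k < K \<Longrightarrow> block (p k) (n k) (v k) (m k)"
    and sumI: "(\<Sum>k<K. range_proj (n k) (v k)) = I"
    and orth: "\<And>j k. j < K \<Longrightarrow> k < K \<Longrightarrow> j \<noteq> k \<Longrightarrow> range_proj (n j) (v j) * range_proj (n k) (v k) = 0"
    unfolding decomposes_def by blast+
  have "\<exists>aR f. orthonormal aR f \<and> p k = (\<Sum>i<aR. f i * adj (f i))" if "k < K" for k
    using proj_decomposition blockD(1)[OF b[OF that]] by blast
  then obtain aR f where of: "\<And>k. k < K \<Longrightarrow> orthonormal (aR k) (f k)"
    and pf: "\<And>k. k < K \<Longrightarrow> p k = (\<Sum>i<aR k. f k i * adj (f k i))" by metis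
  note bD = blockD[OF b]
  have f: "f k b * mu 0 0 = f k b" "p k * f k b = f k b" if "k < K" "b < aR k" for k b
    using of[OF that(1)] orthonormal_proj(3)[OF of[OF that(1)] that(2)] pf[OF that(1)] that by (auto simp: orthonormal_def)
  have ff: "adj (f k b) * f k b' = (if b = b' then mu 0 0 else 0)" if "k < K" "b < aR k" "b' < aR k" for k b b'
    using of[OF that(1)] that by (simp add: orthonormal_def)
  have aR: "0 < aR k" if "k < K" for k using pf[OF that] bD(2)[OF that] by (cases "aR k") auto
  define w where "w k i b = v k i * f k b" for k i b
  define Z where "Z k = range_proj (n k) (v k)" for k
  have Z: "proj (Z k)" "Z k \<in> \<A>" "Z k * c = c * Z k" "\<And>x. x \<in> \<A> \<Longrightarrow> Z k * x = x * Z k" if "k < K" for k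
    using bD(9)[OF that] by (auto simp: central_def Z_def)
  have Zv: "Z k * v k i = v k i" if "k < K" "i < n k" for k i using bD(11) that by (simp add: Z_def)
  have vZ: "adj (v k i) * Z k = adj (v k i)" if "k < K" "i < n k" for k i
    using arg_cong[OF Zv[OF that], of adj] Z(1)[OF that(1)] by (simp add: proj_def)
  have ZZ: "Z j * Z k = 0" if "j < K" "k < K" "j \<noteq> k" for j k using orth that by (simp add: Z_def)
  \<comment> \<open>Different blocks have orthogonal central units, and these can be moved past
    \<open>x\<close>.\<close>
  have cross: "adj (v k i) * x * v k' i' = 0" if "k < K" "k' < K" "k \<noteq> k'" "i < n k" "i' < n k'" "Z k * x = x * Z k" for k k' i i' x
  proof -
    have "adj (v k i) * x * v k' i' = (adj (v k i) * Z k) * x * (Z k' * v k' i')" using Zv vZ that by simp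
    also have "\<dots> = adj (v k i) * (Z k * x) * Z k' * v k' i'" by (simp only: mult.assoc)
    also have "\<dots> = adj (v k i) * x * (Z k * Z k') * v k' i'" unfolding that(6) by (simp only: mult.assoc)
    finally show ?thesis using ZZ that by simp
  qed
  have cross1: "adj (v k i) * v k' i' = 0" if "k < K" "k' < K" "k \<noteq> k'" "i < n k" "i' < n k'" for k k' i i'
  proof -
    have "adj (v k i) * v k' i' = (adj (v k i) * Z k) * (Z k' * v k' i')" using Zv vZ that by simp
    also have "\<dots> = adj (v k i) * (Z k * Z k') * v k' i'" by (simp only: mult.assoc)
    finally show ?thesis using ZZ that by simp
  qed
  have orthw: "adj (w k i b) * w k' i' b' = (if k = k' \<and> i = i' \<and> b = b' then mu 0 0 else 0)"
    if "k < K" "i < n k" "b < aR k" "k' < K" "i' < n k'" "b' < aR k'" for k i b k' i' b'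
  proof -
    have e: "adj (w k i b) * w k' i' b' = adj (f k b) * (adj (v k i) * v k' i') * f k' b'" by (simp add: w_def mult.assoc)
    show ?thesis
    proof (cases "k = k'")
      case True
      then show ?thesis unfolding e using that bD(7)[of k i i'] f ff by (auto simp: mult.assoc)
    next
      case False
      then show ?thesis unfolding e using cross1 that by simp
    qed
  qed
  have sumw: "(\<Sum>k<K. \<Sum>i<n k. \<Sum>b<aR k. w k i b * adj (w k i b)) = I"
  proof -
    have "(\<Sum>b<aR k. w k i b * adj (w k i b)) = v k i * adj (v k i)" if "k < K" "i < n k" for k i
    proof -
      have "(\<Sum>b<aR k. w k i b * adj (w k i b)) = v k i * p k * adj (v k i)"
        unfolding pf[OF that(1)] by (simp add: w_def sum_distrib_left sum_distrib_right mult.assoc)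
      then show ?thesis using bD(6) that by simp
    qed
    then show ?thesis unfolding sumI[symmetric] range_proj_def by simp
  qed
  have main: "\<exists>L. (pos x \<longrightarrow> (\<forall>k<K. pos_form (n k) (L k))) \<and>
      (\<forall>z\<in>\<W>. \<forall>z'\<in>\<W>. \<forall>k<K. \<forall>i<n k. \<forall>b<aR k. \<forall>k'<K. \<forall>i'<n k'. \<forall>b'<aR k'.
        adj (w k i b) * (z * c * x * c * z') * w k' i' b' =
         (if k = k' then L k i i' *\<^sub>C (adj (f k b) * (z * c * p k * c * z') * f k b') else 0))"
    if x: "x \<in> \<A>" for x
  proof -
    have "\<exists>r. adj (v k i) * x * v k j = r *\<^sub>C p k" if "k < K" "i < n k" "j < n k" for k i j
    proof -
      have vA: "v k i \<in> \<A>" "v k j \<in> \<A>" "v k i * p k = v k i" "v k j * p k = v k j" using bD(6) that by auto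
      have "p k * adj (v k i) = adj (v k i)" using arg_cong[OF vA(3), of adj] bD(1)[OF that(1)] by (simp add: proj_def)
      then have "p k * (adj (v k i) * x * v k j) * p k = adj (v k i) * x * v k j"
        using vA by (metis mult.assoc)
      then show ?thesis using bD(8)[OF that(1), of "adj (v k i) * x * v k j"] A_mult A_adj vA x by auto
    qed
    then obtain y where y: "\<And>k i j. k < K \<Longrightarrow> i < n k \<Longrightarrow> j < n k \<Longrightarrow> adj (v k i) * x * v k j = y k i j *\<^sub>C p k"
      by metis
    \<comment> \<open>The eigenvalues picked up on both sides are absorbed into the left matrix.
      This is a congruence by a real diagonal matrix, so positivity is kept.\<close>
    define L where "L k i j = complex_of_real (m k i) * y k i j * complex_of_real (m k j)" for k i j
    have "pos_form (n k) (L k)" if k: "k < K" and px: "pos x" for k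
      unfolding pos_form_def
    proof
      fix \<xi> :: "nat \<Rightarrow> complex"
      define \<eta> where "\<eta> i = complex_of_real (m k i) * \<xi> i" for i
      define u where "u = (\<Sum>i<n k. \<eta> i *\<^sub>C v k i)"
      have "adj u * x * u = (\<Sum>i<n k. \<Sum>j<n k. (cnj (\<eta> i) * \<eta> j) *\<^sub>C (adj (v k i) * x * v k j))"
      proof -
        have 1: "adj u * x = (\<Sum>i<n k. cnj (\<eta> i) *\<^sub>C (adj (v k i) * x))"
          by (simp add: u_def sum_distrib_right)
        show ?thesis unfolding 1 unfolding u_def sum_product by (simp add: mult.commute)
      qed
      also have "\<dots> = (\<Sum>i<n k. \<Sum>j<n k. (cnj (\<xi> i) * L k i j * \<xi> j) *\<^sub>C p k)"
        by (intro sum.cong refl) (use y k in \<open>auto simp: L_def \<eta>_def mult_ac\<close>)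
      also have "\<dots> = (\<Sum>i<n k. \<Sum>j<n k. cnj (\<xi> i) * L k i j * \<xi> j) *\<^sub>C p k"
        by (simp add: fsvs.scale_sum_left)
      finally have "tr (adj u * x * u) = (\<Sum>i<n k. \<Sum>j<n k. cnj (\<xi> i) * L k i j * \<xi> j) * tr (p k)"
        by (simp add: tr_sc)
      moreover have "0 \<le> tr (adj u * x * u)" using px unfolding pos_def by blast
      moreover have "0 < tr (p k)" using tr_proj_nonneg tr_proj_eq_0 bD(1,2)[OF k] by (metis less_le)
      ultimately show "0 \<le> (\<Sum>i<n k. \<Sum>j<n k. cnj (\<xi> i) * L k i j * \<xi> j)"
        by (auto simp: less_complex_def less_eq_complex_def zero_le_mult_iff)
    qed
    moreover have "adj (w k i b) * (z * c * x * c * z') * w k' i' b' =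
         (if k = k' then L k i i' *\<^sub>C (adj (f k b) * (z * c * p k * c * z') * f k b') else 0)"
      if z: "z \<in> \<W>" "z' \<in> \<W>" and k: "k < K" "i < n k" "b < aR k" "k' < K" "i' < n k'" "b' < aR k'" for z z' k i b k' i' b'
    proof -
      have left: "adj (v k i) * (z * c) = complex_of_real (m k i) *\<^sub>C (z * c * adj (v k i))"
      proof -
        have v: "v k i \<in> \<A>" "c * v k i = complex_of_real (m k i) *\<^sub>C (v k i * c)" using bD(6) k by auto
        have "adj (v k i) * (z * c) = z * (adj (v k i) * c)"
          using A_comm[OF A_adj[OF v(1)] z(1)] by (metis mult.assoc)
        then show ?thesis by (simp add: eigen_adj[OF v(2)] mult.assoc)
      qed
      have right: "c * z' * v k' i' = complex_of_real (m k' i') *\<^sub>C (v k' i' * (c * z'))"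
      proof -
        have v: "v k' i' \<in> \<A>" "c * v k' i' = complex_of_real (m k' i') *\<^sub>C (v k' i' * c)" using bD(6) k by auto
        have "c * z' * v k' i' = (c * v k' i') * z'"
          using A_comm[OF v(1) z(2)] by (metis mult.assoc)
        then show ?thesis by (simp add: v(2) mult.assoc)
      qed
      have "adj (w k i b) * (z * c * x * c * z') * w k' i' b' =
        adj (f k b) * (adj (v k i) * (z * c)) * x * (c * z' * v k' i') * f k' b'"
        by (simp add: w_def mult.assoc)
      also have "\<dots> = (complex_of_real (m k i) * complex_of_real (m k' i')) *\<^sub>C
         (adj (f k b) * (z * c) * (adj (v k i) * x * v k' i') * (c * z') * f k' b')"
        unfolding left right by (simp add: mult.assoc mult.commute)
      also have "\<dots> = (if k = k' then L k i i' *\<^sub>C (adj (f k b) * (z * c * p k * c * z') * f k b') else 0)"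
      proof (cases "k = k'")
        case True
        then show ?thesis using y[of k i i'] k by (simp add: L_def mult.assoc mult.left_commute mult.commute)
      next
        case False
        then show ?thesis using cross[of k k' i i' x] k Z(4)[OF _ x] by simp
      qed
      finally show ?thesis .
    qed
    ultimately show ?thesis by blast
  qed
  have wmu: "w k i b * mu 0 0 = w k i b" if "k < K" "b < aR k" for k i b
    using f that by (simp add: w_def mult.assoc)
  have "adapted_basis K n aR w f p"
    unfolding adapted_basis_def using main sumw orthw wmu f(1) bD(1,5) aR by auto
  then show ?thesis by blast
qed

end

section \<open>Blocks of the joint states in the adapted basis\<close>

lemma column_form:
  assumes "u * mu 0 0 = u" "w * mu 0 0 = w"
  shows "adj u * Y * w = tr (adj u * Y * w) *\<^sub>C mu 0 0"
proof -
  have "mu 0 0 * adj u = adj u" using arg_cong[OF assms(1), of adj] by simp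
  then have "mu 0 0 * (adj u * Y * w) * mu 0 0 = adj u * Y * w" using assms(2) by (metis mult.assoc)
  then have *: "adj u * Y * w = entry (adj u * Y * w) 0 0 *\<^sub>C mu 0 0" by (simp only: mu_sandwich)
  have "tr (adj u * Y * w) = entry (adj u * Y * w) 0 0" by (subst *) (simp add: tr_sc tr_mu)
  with * show ?thesis by simp
qed

definition pos_form2 :: "nat \<Rightarrow> nat \<Rightarrow> (nat \<Rightarrow> nat \<Rightarrow> nat \<Rightarrow> nat \<Rightarrow> complex) \<Rightarrow> bool" where
  "pos_form2 n d R \<longleftrightarrow> (\<forall>\<xi>. 0 \<le> (\<Sum>b<n. \<Sum>x<d. \<Sum>b'<n. \<Sum>y<d. cnj (\<xi> b x) * R b x b' y * \<xi> b' y))"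

text \<open>\<open>adj (J x) * B l * J y\<close> is the block of \<open>B l\<close> between the
  basis vectors \<open>x\<close> and \<open>y\<close> of the second factor. In the adapted basis it
  is the direct sum over \<open>k\<close> of \<open>L l k \<otimes> R k\<close>, the right matrix
  being taken at \<open>x\<close> and \<open>y\<close>. Only the left factor depends on
  \<open>l\<close>: entry by entry, this is the Markov property.\<close>

definition markov_basis ::
  "fsmat \<Rightarrow> nat \<Rightarrow> (nat \<Rightarrow> fsmat) \<Rightarrow> nat set \<Rightarrow> (nat \<Rightarrow> fsmat) \<Rightarrow> nat \<Rightarrow> (nat \<Rightarrow> nat) \<Rightarrow> (nat \<Rightarrow> nat) \<Rightarrow>
   (nat \<Rightarrow> nat \<Rightarrow> nat \<Rightarrow> fsmat) \<Rightarrow> (nat \<Rightarrow> nat \<Rightarrow> nat \<Rightarrow> nat \<Rightarrow> complex) \<Rightarrow>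
   (nat \<Rightarrow> nat \<Rightarrow> nat \<Rightarrow> nat \<Rightarrow> nat \<Rightarrow> complex) \<Rightarrow> bool" where
  "markov_basis I d J T B K aL aR w L R \<longleftrightarrow> (\<forall>k<K. 0 < aL k \<and> 0 < aR k) \<and>
    (\<forall>k<K. \<forall>i<aL k. \<forall>b<aR k. w k i b * mu 0 0 = w k i b) \<and>
    (\<forall>k<K. \<forall>i<aL k. \<forall>b<aR k. \<forall>k'<K. \<forall>i'<aL k'. \<forall>b'<aR k'. adj (w k i b) * w k' i' b' =
       (if k = k' \<and> i = i' \<and> b = b' then mu 0 0 else 0)) \<and>
    (\<Sum>k<K. \<Sum>i<aL k. \<Sum>b<aR k. w k i b * adj (w k i b)) = I \<and>
    (\<forall>l\<in>T. \<forall>k<K. pos_form (aL k) (L l k)) \<and> (\<forall>k<K. pos_form2 (aR k) d (R k)) \<and>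
    (\<forall>l\<in>T. \<forall>x<d. \<forall>y<d. \<forall>k<K. \<forall>i<aL k. \<forall>b<aR k. \<forall>k'<K. \<forall>i'<aL k'. \<forall>b'<aR k'.
      adj (w k i b) * (adj (J x) * B l * J y) * w k' i' b' =
        (if k = k' then (L l k i i' * R k b x b' y) *\<^sub>C mu 0 0 else 0))"

context bipartite
begin

text \<open>The map whose fixed points matter is
  \<open>Y \<mapsto> s * ptr (f * amp Y * f) * s\<close>, the composite of \<open>amp\<close> with
  its weighted adjoint from the recovery argument. It is unital and has a faithful invariant state
  only relative to the support \<open>e\<close> of \<open>a\<close>, so the commutant is formed in
  the whole corner of \<open>I\<close> with \<open>e\<close> adjoined to the Kraus
  operators.\<close>

theorem markov_basis_exists:
  assumes a: "root_pinv a c s e" "I * a = a" and b: "pos f" "f * f = b" "IE * f = f"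
    and ab: "ptr b = a"
    and A: "\<And>l. l \<in> T \<Longrightarrow> pos (A l)" "\<And>l. l \<in> T \<Longrightarrow> ptr (B l) = A l"
    and B: "\<And>l. l \<in> T \<Longrightarrow> B l = f * amp (s * A l * s) * f"
  shows "\<exists>K aL aR w L R. markov_basis I d J T B K aL aR w L R"
proof -
  have I': "adj I = I" "I * I = I" using I by (auto simp: proj_def)
  have a': "adj c = c" "adj s = s" "adj e = e" "c * c = a" "c * s = e" "s * c = e"
    "e * c = c" "c * e = c" "e * s = s" "s * e = s" "e * e = e" "proj e" "pos c" "pos s"
    using a by (auto simp: root_pinv_def pos_def proj_def)
  have f': "adj f = f" using b pos_adj by blast
  have fIE: "f * IE = f" using b f' IE by (metis adj_mult proj_adj)
  have Ie: "I * e = e" "e * I = e"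
  proof -
    have "e = a * s * s" using a' by (metis mult.assoc)
    then show "I * e = e" using a by (metis mult.assoc)
    then show "e * I = e" using a' I' by (metis adj_mult)
  qed
  have Ic: "I * c = c" "c * I = c" "I * s = s" "s * I = s" using Ie a' by (metis mult.assoc)+
  have sas: "s * a * s = e" using a' by (metis mult.assoc)
  \<comment> \<open>The blocks of the root \<open>f\<close> between basis vectors of the second
    factor. As \<open>f\<close> is Hermitian, swapping the indices is taking the adjoint.\<close>
  define h where "h x y = adj (J x) * f * J y" for x y
  have adjh: "adj (h x y) = h y x" for x y by (simp add: h_def f' mult.assoc)
  define S where "S = {..<d} \<times> {..<d}"
  have S: "finite S" by (simp add: S_def)
  have hh: "(\<Sum>x<d. h y x * Y * h x z) = adj (J y) * (f * amp Y * f) * J z" for Y y z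
    by (simp add: h_def amp_def sum_distrib_left sum_distrib_right mult.assoc)
  have hYh: "(\<Sum>(x,y)\<in>S. h y x * Y * h x y) = ptr (f * amp Y * f)" for Y
  proof -
    have "(\<Sum>(x,y)\<in>S. h y x * Y * h x y) = (\<Sum>y<d. \<Sum>x<d. h y x * Y * h x y)"
      unfolding S_def sum.cartesian_product[symmetric] by (rule sum.swap)
    then show ?thesis unfolding hh ptr_def .
  qed
  have hI: "h x y * I = h x y" "I * h x y = h x y" if "x < d" "y < d" for x y
    using that JI by (simp add: h_def mult.assoc, simp add: h_def mult.assoc[symmetric] IJ)
  have hsum: "(\<Sum>(x,y)\<in>S. h y x * h x y) = a"
  proof -
    have "(\<Sum>(x,y)\<in>S. h y x * h x y) = (\<Sum>(x,y)\<in>S. h y x * I * h x y)"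
      by (rule sum.cong) (auto simp: S_def hI)
    then show ?thesis by (simp add: hYh amp_I fIE b ab)
  qed
  \<comment> \<open>\<open>h x y * h y x\<close> is one term of the positive sum that makes up
    \<open>a\<close>, hence below \<open>a\<close> and supported on \<open>e\<close>; then so is
    \<open>h x y\<close>.\<close>
  have eh: "e * h x y = h x y" if "x < d" "y < d" for x y
  proof -
    have m: "(y, x) \<in> S" using that by (simp add: S_def)
    have "a = h x y * h y x + (\<Sum>(x,y)\<in>S - {(y,x)}. h y x * h x y)"
      unfolding hsum[symmetric] using sum.remove[OF S m, of "\<lambda>(x,y). h y x * h x y"] by simp
    then have "a - h x y * h y x = (\<Sum>(x,y)\<in>S - {(y,x)}. h y x * h x y)" by simp
    moreover have "pos (h y x * h x y)" for x y using pos_adj_mult[of "h x y"] by (simp only: adjh)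
    then have "pos (\<Sum>(x,y)\<in>S - {(y,x)}. h y x * h x y)" by (intro pos_sum) (simp only: case_prod_unfold)
    ultimately have "pos (a - h x y * h y x)" by metis
    moreover have "pos (h x y * h y x)" using pos_mult_adj[of "h x y"] by (simp add: adjh)
    ultimately have 1: "e * (h x y * h y x) = h x y * h y x" using root_pinv_support[OF a(1)] by blast
    have "(h x y - e * h x y) * adj (h x y - e * h x y) =
      (h x y * h y x - e * (h x y * h y x)) - (h x y * h y x - e * (h x y * h y x)) * e"
      by (simp add: adjh a' left_diff_distrib right_diff_distrib mult.assoc)
    also have "\<dots> = 0" by (simp add: 1)
    finally have "h x y - e * h x y = 0" unfolding mult_adj_self_eq_0 .
    then show ?thesis by simp
  qed
  have he: "h x y * e = h x y" if "x < d" "y < d" for x y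
    using arg_cong[OF eh[OF that(2,1)], of adj] by (simp add: adjh a')
  define V where "V z = h (fst z) (snd z) * s" for z
  have adjV: "adj (V z) = s * h (snd z) (fst z)" for z by (simp add: V_def adjh a')
  have hz: "h (fst z) (snd z) * e = h (fst z) (snd z)" "e * h (fst z) (snd z) = h (fst z) (snd z)"
    "h (snd z) (fst z) * e = h (snd z) (fst z)" "e * h (snd z) (fst z) = h (snd z) (fst z)"
    if "z \<in> S" for z using that eh he by (auto simp: S_def)
  have Ve: "V z * e = V z" "e * V z = V z" "adj (V z) * e = adj (V z)" "e * adj (V z) = adj (V z)" if "z \<in> S" for z
    using hz[OF that] a' unfolding V_def by (simp_all add: adjh mult.assoc) (simp_all add: mult.assoc[symmetric])
  have VYV: "(\<Sum>z\<in>S. adj (V z) * Y * V z) = s * ptr (f * amp Y * f) * s" for Y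
  proof -
    have "(\<Sum>z\<in>S. adj (V z) * Y * V z) = (\<Sum>(x,y)\<in>S. s * (h y x * Y * h x y) * s)"
      by (rule sum.cong) (auto simp: adjV, simp add: V_def mult.assoc)
    also have "\<dots> = s * (\<Sum>(x,y)\<in>S. h y x * Y * h x y) * s"
      unfolding sum_distrib_left sum_distrib_right by (rule sum.cong) auto
    finally show ?thesis unfolding hYh .
  qed
  have VV: "(\<Sum>z\<in>S. adj (V z) * V z) = e"
  proof -
    have "(\<Sum>z\<in>S. adj (V z) * V z) = (\<Sum>z\<in>S. adj (V z) * e * V z)" by (rule sum.cong) (auto simp: Ve)
    also have "\<dots> = (\<Sum>z\<in>S. adj (V z) * I * V z)"
    proof (rule sum.cong)
      fix z assume z: "z \<in> S"
      have "I * V z = V z" using Ve(2)[OF z] Ie by (metis mult.assoc)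
      then show "adj (V z) * e * V z = adj (V z) * I * V z" using Ve[OF z] by (simp add: mult.assoc)
    qed simp
    also have "\<dots> = e" unfolding VYV amp_I by (simp add: fIE b ab sas)
    finally show ?thesis .
  qed
  have inv: "tr (a * (\<Sum>z\<in>S. adj (V z) * Y * V z)) = tr (a * Y)" for Y
  proof -
    have "e * (\<Sum>(x,y)\<in>S. h y x * Y * h x y) = (\<Sum>(x,y)\<in>S. h y x * Y * h x y)"
      unfolding sum_distrib_left by (rule sum.cong) (auto simp: S_def eh mult.assoc[symmetric])
    then have e: "e * ptr (f * amp Y * f) = ptr (f * amp Y * f)" unfolding hYh .
    have "tr (a * (s * ptr (f * amp Y * f) * s)) = tr (s * a * s * ptr (f * amp Y * f))"
      using tr_mult_commute[of "a * s * ptr (f * amp Y * f)" s] by (simp add: mult.assoc)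
    also have "\<dots> = tr (ptr (f * amp Y * f))" by (simp add: sas e)
    also have "\<dots> = tr (I * ptr (f * amp Y * f))" by (simp add: I_ptr)
    also have "\<dots> = tr (amp I * (f * amp Y * f))" by (simp add: tr_amp_mult)
    also have "\<dots> = tr (f * (amp Y * f))" using b(3) by (simp add: amp_I mult.assoc[symmetric])
    also have "\<dots> = tr (amp Y * b)" using tr_mult_commute[of f "amp Y * f"] b(2) by (simp add: mult.assoc)
    also have "\<dots> = tr (Y * a)" by (simp add: tr_amp_mult ab)
    finally show ?thesis unfolding VYV by (simp add: tr_mult_commute)
  qed
  note lindblad = commutator_eq_0[OF VV Ve(1) inv a(1) _ _ _ S]
  \<comment> \<open>\<open>c\<close> is completed by the identity off its support, which makes it
    invertible in the corner of \<open>I\<close>: the direct sum has to exhaust the system space and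
    not only the support of \<open>a\<close>.\<close>
  define c' where "c' = c + (I - e)"
  define s' where "s' = s + (I - e)"
  \<comment> \<open>With \<open>e\<close> included, the commutant respects the support, and there
    \<open>c'\<close> and \<open>s'\<close> can be exchanged for \<open>c\<close> and
    \<open>s\<close>.\<close>
  define \<W> where "\<W> = insert e (V ` S \<union> (\<lambda>z. adj (V z)) ` S)"
  have c'e: "c' * e = c" "e * c' = c" "s' * e = s" "e * s' = s" "I * c' = c'" "I * s' = s'" "c' * s' = I"
    "c' * s = e" "s * c' = e" "adj s' = s'"
    unfolding c'_def s'_def using Ie Ic I' a'
    by (simp_all add: left_diff_distrib right_diff_distrib distrib_left distrib_right)
  have "proj (I - e)" by (rule proj_diff[OF a'(12) I Ie(1)])
  then have pc': "pos c'" unfolding c'_def using a' by (intro pos_add) (auto intro: pos_proj)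
  have WI: "I * w = w \<and> w * I = w" if "w \<in> \<W>" for w
  proof -
    have "e * w = w" "w * e = w" using that Ve a' unfolding \<W>_def by auto
    then show ?thesis using Ie by (metis mult.assoc)
  qed
  interpret M: modular_commutant I c' s' \<W>
  proof
    show "proj I" "pos c'" "I * c' = c'" "adj s' = s'" "I * s' = s'" "c' * s' = I" using I pc' c'e by auto
    show "\<And>w. w \<in> \<W> \<Longrightarrow> I * w = w \<and> w * I = w" by (rule WI)
    show "\<And>w. w \<in> \<W> \<Longrightarrow> adj w \<in> \<W>" unfolding \<W>_def using a' by auto
    fix x w assume x: "I * x * I = x" and comm: "\<And>w. w \<in> \<W> \<Longrightarrow> x * w = w * x" and w: "w \<in> \<W>"
    define Z where "Z = c' * x * s'"
    have xe: "x * e = e * x" using comm unfolding \<W>_def by blast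
    have xV: "x * adj (V z) = adj (V z) * x" if "z \<in> S" for z using comm that unfolding \<W>_def by blast
    have Ze: "Z * e = e * Z"
    proof -
      have "Z * e = c' * x * (s' * e)" by (simp add: Z_def mult.assoc)
      also have "\<dots> = c' * (x * e) * s'" by (simp add: c'e mult.assoc)
      also have "\<dots> = (c' * e) * x * s'" by (simp add: xe mult.assoc)
      also have "\<dots> = e * Z" by (simp add: c'e Z_def mult.assoc[symmetric])
      finally show ?thesis .
    qed
    \<comment> \<open>\<open>V z\<close> has the form \<open>h * s\<close>, and the adjoint of
      \<open>V\<close> at the swapped index is \<open>s * h\<close> with the same \<open>h\<close>.
      Commutation of \<open>x\<close> with the latter turns, after conjugation by \<open>c'\<close>,
      into commutation with the former: this is the source of the stability.\<close>
    have ZV: "Z * V z = V z * Z" if z: "z \<in> S" for z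
    proof -
      define z' where "z' = (snd z, fst z)"
      have z': "z' \<in> S" using z by (auto simp: z'_def S_def)
      have sh: "s * h (fst z) (snd z) = adj (V z')" by (simp add: adjV z'_def)
      have "Z * V z = c' * x * (s' * e) * h (fst z) (snd z) * s"
        using hz[OF z] by (simp add: Z_def V_def mult.assoc)
      also have "\<dots> = c' * (x * adj (V z')) * s" by (simp add: c'e sh[symmetric] mult.assoc)
      also have "\<dots> = (c' * s) * h (fst z) (snd z) * x * s" unfolding xV[OF z'] by (simp add: sh[symmetric] mult.assoc)
      also have "\<dots> = h (fst z) (snd z) * x * s" by (simp add: c'e hz[OF z])
      also have "\<dots> = h (fst z) (snd z) * (x * e) * s'" by (simp add: c'e mult.assoc)
      also have "\<dots> = h (fst z) (snd z) * (s * c') * x * s'" by (simp add: c'e xe mult.assoc)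
      also have "\<dots> = V z * Z" by (simp add: V_def Z_def mult.assoc)
      finally show ?thesis .
    qed
    \<comment> \<open>Commutation with the adjoints comes from fixed points: since
      \<open>e * Z\<close> commutes with all \<open>V z\<close> and the
      \<open>adj (V z) * V z\<close> add up to \<open>e\<close>, the map fixes \<open>e * Z\<close>,
      and the commutator argument applies.\<close>
    have ZV': "Z * adj (V z) = adj (V z) * Z" if z: "z \<in> S" for z
    proof -
      have eZ: "e * (e * Z) = e * Z" "e * Z * e = e * Z"
        using a' Ze by (metis mult.assoc)+
      have fixed: "(\<Sum>z\<in>S. adj (V z) * (e * Z) * V z) = e * Z"
      proof -
        have "(\<Sum>z\<in>S. adj (V z) * (e * Z) * V z) = (\<Sum>z\<in>S. adj (V z) * V z * (e * Z))"
        proof (rule sum.cong)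
          fix z assume z: "z \<in> S"
          have "(e * Z) * V z = V z * (e * Z)" using ZV[OF z] Ve[OF z] Ze by (metis mult.assoc)
          then show "adj (V z) * (e * Z) * V z = adj (V z) * V z * (e * Z)" by (simp add: mult.assoc)
        qed simp
        then show ?thesis unfolding sum_distrib_right[symmetric] VV by (simp add: eZ)
      qed
      have "V z * adj (e * Z) = adj (e * Z) * V z" by (rule lindblad[OF _ eZ fixed z])
      then have "(e * Z) * adj (V z) = adj (V z) * (e * Z)" by (metis adj_adj adj_mult)
      then show ?thesis using Ve[OF z] Ze by (metis mult.assoc)
    qed
    have "Z * w = w * Z" using w Ze ZV ZV' unfolding \<W>_def by blast
    then show "c' * x * s' * w = w * (c' * x * s')" by (simp add: Z_def)
  qed
  have XA: "s * A l * s \<in> M.\<A>" "pos (s * A l * s)" if l: "l \<in> T" for l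
  proof -
    show pX: "pos (s * A l * s)" using pos_conj[OF A(1)[OF l], of s] a' by simp
    let ?X = "s * A l * s"
    have eX: "e * ?X = ?X" "?X * e = ?X" using a' by (metis mult.assoc)+
    have "(\<Sum>z\<in>S. adj (V z) * ?X * V z) = ?X"
      unfolding VYV B[OF l, symmetric] A(2)[OF l] ..
    then have VX: "V z * ?X = ?X * V z" if "z \<in> S" for z
      using lindblad[OF _ eX _ that] pos_adj[OF pX] by metis
    show "?X \<in> M.\<A>"
    proof (rule M.AI)
      show "I * ?X = ?X" "?X * I = ?X" using Ic by (metis mult.assoc)+
      fix w assume "w \<in> \<W>"
      moreover have "?X * adj (V z) = adj (V z) * ?X" if "z \<in> S" for z
        using arg_cong[OF VX[OF that], of adj] pos_adj[OF pX] by simp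
      ultimately show "?X * w = w * ?X" using VX eX unfolding \<W>_def by auto
    qed
  qed
  from M.adapted_basis_exists obtain K aL aR w g p where basis: "M.adapted_basis K aL aR w g p"
    by blast
  define Q where "Q l L \<longleftrightarrow> (\<forall>k<K. pos_form (aL k) (L k)) \<and>
      (\<forall>z\<in>\<W>. \<forall>z'\<in>\<W>. \<forall>k<K. \<forall>i<aL k. \<forall>b<aR k. \<forall>k'<K. \<forall>i'<aL k'. \<forall>b'<aR k'.
        adj (w k i b) * (z * c' * (s * A l * s) * c' * z') * w k' i' b' =
         (if k = k' then L k i i' *\<^sub>C (adj (g k b) * (z * c' * p k * c' * z') * g k b') else 0))" for l L
  have family: "\<forall>x\<in>M.\<A>. \<exists>L. (pos x \<longrightarrow> (\<forall>k<K. pos_form (aL k) (L k))) \<and>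
      (\<forall>z\<in>\<W>. \<forall>z'\<in>\<W>. \<forall>k<K. \<forall>i<aL k. \<forall>b<aR k. \<forall>k'<K. \<forall>i'<aL k'. \<forall>b'<aR k'.
        adj (w k i b) * (z * c' * x * c' * z') * w k' i' b' =
         (if k = k' then L k i i' *\<^sub>C (adj (g k b) * (z * c' * p k * c' * z') * g k b') else 0))"
    using basis unfolding M.adapted_basis_def by (elim conjE)
  have "\<exists>L. Q l L" if "l \<in> T" for l
    using bspec[OF family XA(1)[OF that]] unfolding Q_def by (simp only: XA(2)[OF that] simp_thms)
  then have "\<forall>l\<in>T. \<exists>L. Q l L" by blast
  then obtain L where QL: "\<forall>l\<in>T. Q l (L l)" using bchoice[of T Q] by blast
  have L1: "pos_form (aL k) (L l k)" if "l \<in> T" "k < K" for l k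
    using QL that unfolding Q_def by blast
  have L2: "adj (w k i b) * (z * c' * (s * A l * s) * c' * z') * w k' i' b' =
         (if k = k' then L l k i i' *\<^sub>C (adj (g k b) * (z * c' * p k * c' * z') * g k b') else 0)"
    if "l \<in> T" "z \<in> \<W>" "z' \<in> \<W>" "k < K" "i < aL k" "b < aR k" "k' < K" "i' < aL k'" "b' < aR k'"
    for l z z' k i b k' i' b'
    using QL that unfolding Q_def by blast
  have g: "g k b * mu 0 0 = g k b" if "k < K" "b < aR k" for k b
    using basis that unfolding M.adapted_basis_def by blast
  have p: "proj (p k)" if "k < K" for k using basis that unfolding M.adapted_basis_def by blast
  \<comment> \<open>The index \<open>t\<close> is the one summed over in \<open>amp\<close>. No
    \<open>A l\<close> occurs here, so the right matrix is common to all \<open>l\<close>.\<close>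
  define R where "R k b x b' y = tr (\<Sum>t<d. adj (g k b) * (V (x,t) * c' * p k * c' * adj (V (y,t))) * g k b')" for k b x b' y
  have Rmu: "(\<Sum>t<d. adj (g k b) * (V (x,t) * c' * p k * c' * adj (V (y,t))) * g k b') = R k b x b' y *\<^sub>C mu 0 0"
    if "k < K" "b < aR k" "b' < aR k" for k b x b' y
  proof -
    have "adj (g k b) * Y * g k b' = tr (adj (g k b) * Y * g k b') *\<^sub>C mu 0 0" for Y
      using column_form g that by blast
    then have "(\<Sum>t<d. adj (g k b) * (V (x,t) * c' * p k * c' * adj (V (y,t))) * g k b') =
      (\<Sum>t<d. tr (adj (g k b) * (V (x,t) * c' * p k * c' * adj (V (y,t))) * g k b') *\<^sub>C mu 0 0)"
      by (intro sum.cong refl)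
    then show ?thesis unfolding R_def tr_sum fsvs.scale_sum_left .
  qed
  have R_pos: "pos_form2 (aR k) d (R k)" if k: "k < K" for k
    unfolding pos_form2_def
  proof
    fix \<xi> :: "nat \<Rightarrow> nat \<Rightarrow> complex"
    \<comment> \<open>A Gram argument: the form is the sum over \<open>t\<close> of the squared
      Hilbert-Schmidt norms of \<open>u t\<close>.\<close>
    define u where "u t = (\<Sum>b<aR k. \<Sum>x<d. \<xi> b x *\<^sub>C (p k * c' * adj (V (x,t)) * g k b))" for t
    have adju: "adj (u t) = (\<Sum>b<aR k. \<Sum>x<d. cnj (\<xi> b x) *\<^sub>C (adj (g k b) * V (x,t) * c' * p k))" for t
      using pos_adj[OF pc'] p[OF k] by (simp add: u_def proj_def mult.assoc)
    have "adj (u t) * u t = (\<Sum>b<aR k. \<Sum>x<d. \<Sum>b'<aR k. \<Sum>y<d. (cnj (\<xi> b x) * \<xi> b' y) *\<^sub>C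
       (adj (g k b) * (V (x,t) * c' * p k * c' * adj (V (y,t))) * g k b'))" for t
    proof -
      have "adj (u t) * u t = (\<Sum>b<aR k. \<Sum>x<d. \<Sum>b'<aR k. \<Sum>y<d.
        (cnj (\<xi> b x) *\<^sub>C (adj (g k b) * V (x,t) * c' * p k)) * (\<xi> b' y *\<^sub>C (p k * c' * adj (V (y,t)) * g k b')))"
        unfolding adju unfolding u_def sum_distrib_right unfolding sum_distrib_left ..
      also have "\<dots> = (\<Sum>b<aR k. \<Sum>x<d. \<Sum>b'<aR k. \<Sum>y<d. (cnj (\<xi> b x) * \<xi> b' y) *\<^sub>C
       (adj (g k b) * (V (x,t) * c' * (p k * p k) * c' * adj (V (y,t))) * g k b'))"
        by (intro sum.cong refl) (simp add: mult.assoc mult.commute)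
      finally show ?thesis using p[OF k] by (simp add: proj_def)
    qed
    then have "(\<Sum>t<d. tr (adj (u t) * u t)) = (\<Sum>t<d. \<Sum>b<aR k. \<Sum>x<d. \<Sum>b'<aR k. \<Sum>y<d. (cnj (\<xi> b x) * \<xi> b' y) *
       tr (adj (g k b) * (V (x,t) * c' * p k * c' * adj (V (y,t))) * g k b'))"
      by (simp add: tr_sum tr_sc)
    also have "\<dots> = (\<Sum>b<aR k. \<Sum>x<d. \<Sum>b'<aR k. \<Sum>y<d. \<Sum>t<d. (cnj (\<xi> b x) * \<xi> b' y) *
       tr (adj (g k b) * (V (x,t) * c' * p k * c' * adj (V (y,t))) * g k b'))"
      by ((rule trans[OF sum.swap], rule sum.cong[OF refl])+, rule refl)
    also have "\<dots> = (\<Sum>b<aR k. \<Sum>x<d. \<Sum>b'<aR k. \<Sum>y<d. cnj (\<xi> b x) * R k b x b' y * \<xi> b' y)"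
      unfolding R_def tr_sum by (intro sum.cong refl) (simp add: sum_distrib_left sum_distrib_right mult.assoc mult.commute)
    finally show "0 \<le> (\<Sum>b<aR k. \<Sum>x<d. \<Sum>b'<aR k. \<Sum>y<d. cnj (\<xi> b x) * R k b x b' y * \<xi> b' y)"
      using sum_nonneg[of "{..<d}" "\<lambda>t. tr (adj (u t) * u t)"] tr_adj_mult_self_nonneg by simp
  qed
  have main: "adj (w k i b) * (adj (J x) * B l * J y) * w k' i' b' =
        (if k = k' then (L l k i i' * R k b x b' y) *\<^sub>C mu 0 0 else 0)"
    if l: "l \<in> T" and xy: "x < d" "y < d" and k: "k < K" "i < aL k" "b < aR k" "k' < K" "i' < aL k'" "b' < aR k'"
    for l x y k i b k' i' b'
  proof -
    have "adj (J x) * B l * J y = (\<Sum>t<d. h x t * (s * A l * s) * h t y)"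
      unfolding hh B[OF l, symmetric] ..
    also have "\<dots> = (\<Sum>t<d. V (x,t) * c' * (s * A l * s) * c' * adj (V (y,t)))"
    proof (rule sum.cong)
      fix t assume t: "t \<in> {..<d}"
      \<comment> \<open>The pseudo-inverse in \<open>V\<close> cancels against \<open>c'\<close>;
        this is why the factorisation is stated with the weight on both sides of
        \<open>x\<close>.\<close>
      have "V (x,t) * c' = h x t" using c'e he xy t by (simp add: V_def mult.assoc)
      moreover have "c' * adj (V (y,t)) = h t y" using c'e eh xy t by (simp add: adjV mult.assoc[symmetric])
      ultimately show "h x t * (s * A l * s) * h t y = V (x,t) * c' * (s * A l * s) * c' * adj (V (y,t))"
        by (simp add: mult.assoc)
    qed simp
    finally have "adj (w k i b) * (adj (J x) * B l * J y) * w k' i' b' =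
      (\<Sum>t<d. adj (w k i b) * (V (x,t) * c' * (s * A l * s) * c' * adj (V (y,t))) * w k' i' b')"
      by (simp add: sum_distrib_left sum_distrib_right)
    also have "\<dots> = (\<Sum>t<d. if k = k' then L l k i i' *\<^sub>C (adj (g k b) * (V (x,t) * c' * p k * c' * adj (V (y,t))) * g k b') else 0)"
      by (rule sum.cong[OF refl], rule L2[OF l _ _ k]) (use xy in \<open>auto simp: \<W>_def S_def\<close>)
    also have "\<dots> = (if k = k' then (L l k i i' * R k b x b' y) *\<^sub>C mu 0 0 else 0)"
      using Rmu[of k b b' x y] k by (auto simp: fsvs.scale_sum_right[symmetric])
    finally show ?thesis .
  qed
  note conjs = basis[unfolded M.adapted_basis_def]
  note basis' = conjs[THEN conjunct1] conjs[THEN conjunct2, THEN conjunct1]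
    conjs[THEN conjunct2, THEN conjunct2, THEN conjunct1]
    conjs[THEN conjunct2, THEN conjunct2, THEN conjunct2, THEN conjunct1]
  have "markov_basis I d J T B K aL aR w L R"
    unfolding markov_basis_def
  proof (intro conjI basis')
    show "\<forall>l\<in>T. \<forall>k<K. pos_form (aL k) (L l k)" using L1 by blast
    show "\<forall>k<K. pos_form2 (aR k) d (R k)" using R_pos by blast
    show "\<forall>l\<in>T. \<forall>x<d. \<forall>y<d. \<forall>k<K. \<forall>i<aL k. \<forall>b<aR k. \<forall>k'<K. \<forall>i'<aL k'. \<forall>b'<aR k'.
      adj (w k i b) * (adj (J x) * B l * J y) * w k' i' b' =
        (if k = k' then (L l k i i' * R k b x b' y) *\<^sub>C mu 0 0 else 0)"
      by (intro ballI allI impI) (rule main)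
  qed
  then show ?thesis by blast
qed

end

subsection \<open>Transfer to matrices with carriers\<close>

lemma sum_lessThan_mult:
  fixes g :: "nat \<Rightarrow> 'a::comm_monoid_add"
  shows "(\<Sum>x<a * b. g x) = (\<Sum>i<a. \<Sum>j<b. g (i * b + j))"
proof -
  have "sum g {i * b..<i * b + b} = (\<Sum>j<b. g (i * b + j))" for i
    using sum.atLeastLessThan_shift_0[of g "i * b" "i * b + b"] by (simp add: lessThan_atLeast0 comp_def)
  then show ?thesis using sum.nat_group[of g b a] by simp
qed

lemma pair_index_less:
  assumes "i < a" "j < (b::nat)"
  shows "i * b + j < a * b"
proof -
  have "i * b + j < Suc i * b" using assms by simp
  also have "\<dots> \<le> a * b" using assms by (intro mult_le_mono1) simp
  finally show ?thesis .
qed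

text \<open>In the order on complex numbers, \<open>0 \<le> z\<close> includes that \<open>z\<close>
  is real. Testing the coordinates \<open>i\<close> and \<open>j\<close> with \<open>(1, 0)\<close>,
  \<open>(0, 1)\<close>, \<open>(1, 1)\<close> and \<open>(1, \<i>)\<close> makes vanishing
  imaginary parts force the symmetry.\<close>

lemma pos_form_hermitian:
  assumes p: "pos_form n L" and ij: "i < n" "j < n"
  shows "L j i = cnj (L i j)"
proof -
  have q: "0 \<le> (\<Sum>k<n. \<Sum>l<n. cnj (\<xi> k) * L k l * \<xi> l)" for \<xi>
    using p unfolding pos_form_def by blast
  \<comment> \<open>The test vector is a sum of two indicator terms, so the formula also covers
    \<open>i = j\<close>.\<close>
  have delta: "(\<Sum>k<n. \<Sum>l<n. cnj ((if k = i then u else 0) + (if k = j then v else 0)) * L k l * ((if l = i then u else 0) + (if l = j then v else 0))) =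
     cnj u * L i i * u + cnj u * L i j * v + cnj v * L j i * u + cnj v * L j j * v" for u v
  proof -
    have "(\<Sum>l<n. cnj ((if k = i then u else 0) + (if k = j then v else 0)) * L k l * ((if l = i then u else 0) + (if l = j then v else 0)))
      = cnj ((if k = i then u else 0) + (if k = j then v else 0)) * (L k i * u + L k j * v)" for k
      unfolding mult.assoc sum_distrib_left[symmetric] using ij
      by (simp add: distrib_left sum.distrib if_distrib[of "\<lambda>x. _ * x"] cong: if_cong)
    then have "(\<Sum>k<n. \<Sum>l<n. cnj ((if k = i then u else 0) + (if k = j then v else 0)) * L k l * ((if l = i then u else 0) + (if l = j then v else 0))) =
      (\<Sum>k<n. (if k = i then cnj u else 0) * (L k i * u + L k j * v) + (if k = j then cnj v else 0) * (L k i * u + L k j * v))"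
      by (intro sum.cong refl) (auto simp: distrib_right)
    also have "\<dots> = cnj u * (L i i * u + L i j * v) + cnj v * (L j i * u + L j j * v)"
      using ij by (simp add: sum.distrib if_distrib[of "\<lambda>x. x * _"] cong: if_cong)
    finally show ?thesis by (simp add: distrib_left mult.assoc)
  qed
  have q2: "0 \<le> cnj u * L i i * u + cnj u * L i j * v + cnj v * L j i * u + cnj v * L j j * v" for u v
    using q[of "\<lambda>k. (if k = i then u else 0) + (if k = j then v else 0)"] unfolding delta .
  have 1: "0 \<le> L i i" "0 \<le> L j j" using q2[of 1 0] q2[of 0 1] by auto
  have 2: "0 \<le> L i i + L i j + L j i + L j j" using q2[of 1 1] by simp
  show ?thesis using 1 2 q2[of 1 \<i>] by (auto simp: less_eq_complex_def complex_eq_iff)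
qed

lemma tr_adj_mult_mult:
  assumes "bounded_by N X" "bounded_by N B"
  shows "tr (adj B * X * B) = (\<Sum>k<N. \<Sum>i<N. \<Sum>j<N. cnj (entry B i k) * entry X i j * entry B j k)"
proof -
  have "tr (adj B * X * B) = (\<Sum>k<N. \<Sum>j<N. (\<Sum>i<N. cnj (entry B i k) * entry X i j) * entry B j k)"
    using assms by (simp add: tr_eq[of N] bounded_by_mult entry_times[of N] entry_adj)
  also have "\<dots> = (\<Sum>k<N. \<Sum>i<N. \<Sum>j<N. cnj (entry B i k) * entry X i j * entry B j k)"
    unfolding sum_distrib_right by (rule sum.cong[OF refl], rule sum.swap)
  finally show ?thesis .
qed

lemma pos_form_entry:
  assumes X: "bounded_by n X" and p: "\<And>B. 0 \<le> tr (adj B * X * B)"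
  shows "pos_form n (entry X)"
  unfolding pos_form_def
proof
  fix \<xi> :: "nat \<Rightarrow> complex"
  define v where "v = fsmat_of n 1 (\<lambda>i _. \<xi> i)"
  define N where "N = Suc n"
  have "bounded_by N X" "bounded_by N v" using X by (auto simp: v_def N_def intro: bounded_by_mono bounded_by_fsmat_of)
  then have "tr (adj v * X * v) = (\<Sum>k<N. \<Sum>i<N. \<Sum>j<N. cnj (entry v i k) * entry X i j * entry v j k)"
    by (rule tr_adj_mult_mult)
  also have "\<dots> = (\<Sum>k\<in>{0}. \<Sum>i<n. \<Sum>j<n. cnj (entry v i k) * entry X i j * entry v j k)"
    by (rule sum.mono_neutral_cong_right) (auto simp: v_def entry_fsmat_of N_def)
  also have "\<dots> = (\<Sum>i<n. \<Sum>j<n. cnj (\<xi> i) * entry X i j * \<xi> j)"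
    by (simp add: v_def entry_fsmat_of)
  finally show "0 \<le> (\<Sum>i<n. \<Sum>j<n. cnj (\<xi> i) * entry X i j * \<xi> j)" using p by metis
qed

text \<open>The trace tests the columns of \<open>B\<close> one by one, and entries beyond
  \<open>n\<close> drop out; self-adjointness is a consequence of the form being real.\<close>

lemma pos_iff_pos_form:
  assumes X: "bounded_by n X"
  shows "pos X \<longleftrightarrow> pos_form n (entry X)"
proof
  assume "pos X"
  then show "pos_form n (entry X)" using pos_form_entry[OF X] unfolding pos_def by blast
next
  assume p: "pos_form n (entry X)"
  show "pos X" unfolding pos_def
  proof (intro conjI allI)
    show "adj X = X"
    proof (rule fsmat_eqI)
      fix i j
      show "entry (adj X) i j = entry X i j"
        using pos_form_hermitian[OF p, of j i] bounded_byD[OF X, of j i] bounded_byD[OF X, of i j]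
        by (cases "i < n \<and> j < n") (auto simp: entry_adj not_less)
    qed
    fix B
    obtain M where M: "bounded_by M B" using bounded_by_exists by blast
    define N where "N = max M n"
    have N: "bounded_by N X" "bounded_by N B" using M X by (auto simp: N_def intro: bounded_by_mono)
    have "tr (adj B * X * B) = (\<Sum>k<N. \<Sum>i<N. \<Sum>j<N. cnj (entry B i k) * entry X i j * entry B j k)"
      by (rule tr_adj_mult_mult[OF N])
    also have "\<dots> = (\<Sum>k<N. \<Sum>i<n. \<Sum>j<n. cnj (entry B i k) * entry X i j * entry B j k)"
    proof (rule sum.cong[OF refl])
      fix k
      have "(\<Sum>j<N. cnj (entry B i k) * entry X i j * entry B j k) = (\<Sum>j<n. cnj (entry B i k) * entry X i j * entry B j k)" for i
        by (rule sum.mono_neutral_right) (use bounded_byD[OF X] in \<open>auto simp: N_def\<close>)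
      then have "(\<Sum>i<N. \<Sum>j<N. cnj (entry B i k) * entry X i j * entry B j k) = (\<Sum>i<N. \<Sum>j<n. cnj (entry B i k) * entry X i j * entry B j k)"
        by simp
      also have "\<dots> = (\<Sum>i<n. \<Sum>j<n. cnj (entry B i k) * entry X i j * entry B j k)"
        by (rule sum.mono_neutral_right) (use bounded_byD[OF X] in \<open>auto simp: N_def\<close>)
      finally show "(\<Sum>i<N. \<Sum>j<N. cnj (entry B i k) * entry X i j * entry B j k) = (\<Sum>i<n. \<Sum>j<n. cnj (entry B i k) * entry X i j * entry B j k)" .
    qed
    also have "0 \<le> \<dots>"
      using p[unfolded pos_form_def, rule_format, of "\<lambda>i. entry B i _"] by (rule sum_nonneg)
    finally show "0 \<le> tr (adj B * X * B)" .
  qed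
qed

lemma posI_tr: "bounded_by n X \<Longrightarrow> (\<And>B. 0 \<le> tr (adj B * X * B)) \<Longrightarrow> pos X"
  using pos_form_entry pos_iff_pos_form by blast

section \<open>Embedding of matrices with carriers into the padded ring\<close>

definition fs :: "complex mat \<Rightarrow> fsmat" where
  "fs X = fsmat_of (dim_row X) (dim_col X) (\<lambda>i j. X $$ (i, j))"

definition of_fs :: "nat \<Rightarrow> fsmat \<Rightarrow> complex mat" where
  "of_fs n Y = mat n n (\<lambda>(i, j). entry Y i j)"

lemma entry_fs: "entry (fs X) i j = (if i < dim_row X \<and> j < dim_col X then X $$ (i, j) else 0)"
  by (simp add: fs_def entry_fsmat_of)

lemma fs_bounded: "X \<in> carrier_mat n n \<Longrightarrow> bounded_by n (fs X)"
  by (auto simp: bounded_by_def entry_fs)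

lemma of_fs_carrier [simp]: "of_fs n Y \<in> carrier_mat n n" by (simp add: of_fs_def)

lemma fs_of_fs: "bounded_by n Y \<Longrightarrow> fs (of_fs n Y) = Y"
  by (rule fsmat_eqI) (auto simp: entry_fs of_fs_def bounded_byD not_less)

lemma of_fs_fs: "X \<in> carrier_mat n n \<Longrightarrow> of_fs n (fs X) = X"
  by (rule eq_matI) (auto simp: of_fs_def entry_fs)

lemma fs_inject: "X \<in> carrier_mat n n \<Longrightarrow> Y \<in> carrier_mat n n \<Longrightarrow> fs X = fs Y \<Longrightarrow> X = Y"
  using of_fs_fs by metis

lemma fs_mult: "dim_col A = dim_row B \<Longrightarrow> fs (A * B) = fs A * fs B"
proof (rule fsmat_eqI)
  fix i j assume d: "dim_col A = dim_row B"
  define N where "N = dim_row A + dim_row B + dim_col B"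
  have "bounded_by N (fs A)" using d by (auto simp: bounded_by_def entry_fs N_def)
  then have "entry (fs A * fs B) i j = (\<Sum>k<N. entry (fs A) i k * entry (fs B) k j)"
    by (simp add: entry_times)
  also have "\<dots> = (\<Sum>k<dim_row B. entry (fs A) i k * entry (fs B) k j)"
    by (rule sum.mono_neutral_right) (auto simp: N_def entry_fs)
  also have "\<dots> = entry (fs (A * B)) i j"
    using d by (auto simp: entry_fs scalar_prod_def lessThan_atLeast0)
  finally show "entry (fs (A * B)) i j = entry (fs A * fs B) i j" by simp
qed

lemma mat_adjoint_index: "i < dim_col A \<Longrightarrow> j < dim_row A \<Longrightarrow> mat_adjoint A $$ (i, j) = cnj (A $$ (j, i))"
  unfolding mat_adjoint_def mat_of_rows_def by simp

lemma mat_adjoint_dim [simp]: "dim_row (mat_adjoint A) = dim_col A" "dim_col (mat_adjoint A) = dim_row A"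
  unfolding mat_adjoint_def by auto

lemma fs_adjoint: "fs (mat_adjoint A) = adj (fs A)"
  by (rule fsmat_eqI) (simp add: entry_fs entry_adj mat_adjoint_index)

lemma fs_smult: "fs (a \<cdot>\<^sub>m A) = a *\<^sub>C fs A"
  by (rule fsmat_eqI) (simp add: entry_fs entry_sc)

lemma fs_add: "A \<in> carrier_mat n p \<Longrightarrow> B \<in> carrier_mat n p \<Longrightarrow> fs (A + B) = fs A + fs B"
  by (rule fsmat_eqI) (auto simp: entry_fs entry_add)

lemma fs_msum: "(\<And>i. i \<in> F \<Longrightarrow> f i \<in> carrier_mat n n) \<Longrightarrow> fs (msum n f F) = (\<Sum>i\<in>F. fs (f i))"
proof (rule fsmat_eqI)
  fix i j assume f: "\<And>i. i \<in> F \<Longrightarrow> f i \<in> carrier_mat n n"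
  have "entry (fs (f x)) i j = (if i < n \<and> j < n then f x $$ (i,j) else 0)" if "x \<in> F" for x
    using f[OF that] by (auto simp: entry_fs)
  then have "entry (\<Sum>i\<in>F. fs (f i)) i j = (\<Sum>x\<in>F. if i < n \<and> j < n then f x $$ (i,j) else 0)"
    unfolding entry_sum by (intro sum.cong refl)
  then show "entry (fs (msum n f F)) i j = entry (\<Sum>i\<in>F. fs (f i)) i j"
    by (cases "i < n \<and> j < n") (auto simp: entry_fs msum_def)
qed

lemma msum_carrier [simp]: "msum n f F \<in> carrier_mat n n" by (simp add: msum_def)

lemma entry_times_row:
  assumes "\<And>k. N \<le> k \<Longrightarrow> entry A i k = 0"
  shows "entry (A * B) i j = (\<Sum>k<N. entry A i k * entry B k j)"
proof -
  obtain M where "bounded_by M A" using bounded_by_exists by blast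
  then have "bounded_by (max M N) A" by (auto intro: bounded_by_mono)
  then have "entry (A * B) i j = (\<Sum>k<max M N. entry A i k * entry B k j)" by (simp add: entry_times)
  also have "\<dots> = (\<Sum>k<N. entry A i k * entry B k j)"
    by (rule sum.mono_neutral_right) (auto simp: assms)
  finally show ?thesis .
qed

lemma entry_mult_adj: "entry (A * adj B) i j = cnj (entry (B * adj A) j i)"
  by (metis adj_adj adj_mult entry_adj)

lemma tr_fs: "X \<in> carrier_mat n n \<Longrightarrow> tr (fs X) = mtrace X"
  by (auto simp: tr_eq[OF fs_bounded] mtrace_def entry_fs intro!: sum.cong)

lemma psd_iff_pos_form:
  assumes A: "A \<in> carrier_mat n n"
  shows "psd n A \<longleftrightarrow> pos_form n (\<lambda>i j. A $$ (i, j))"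
proof -
  have q: "(A *\<^sub>v v) \<bullet>c v = (\<Sum>i<n. \<Sum>j<n. cnj (v $ i) * A $$ (i, j) * v $ j)" if "v \<in> carrier_vec n" for v
    using that A by (auto simp: scalar_prod_def lessThan_atLeast0 sum_distrib_left mult.commute mult.assoc intro!: sum.cong)
  show ?thesis
  proof
    assume p: "psd n A"
    show "pos_form n (\<lambda>i j. A $$ (i, j))" unfolding pos_form_def
    proof
      fix \<xi> :: "nat \<Rightarrow> complex"
      have v: "vec n \<xi> \<in> carrier_vec n" by simp
      have "0 \<le> (A *\<^sub>v vec n \<xi>) \<bullet>c vec n \<xi>" using p v unfolding psd_def by blast
      then show "0 \<le> (\<Sum>i<n. \<Sum>j<n. cnj (\<xi> i) * A $$ (i, j) * \<xi> j)" unfolding q[OF v] by simp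
    qed
  next
    assume "pos_form n (\<lambda>i j. A $$ (i, j))"
    then show "psd n A" unfolding psd_def using A q unfolding pos_form_def by auto
  qed
qed

lemma psd_iff_pos: "A \<in> carrier_mat n n \<Longrightarrow> psd n A \<longleftrightarrow> pos (fs A)"
proof -
  assume A: "A \<in> carrier_mat n n"
  have "pos_form n (\<lambda>i j. A $$ (i, j)) = pos_form n (entry (fs A))"
    unfolding pos_form_def using A by (simp add: entry_fs)
  then show ?thesis using A by (simp add: psd_iff_pos_form pos_iff_pos_form[OF fs_bounded])
qed

text \<open>\<open>incl dS dE k\<close> is the isometry \<open>v \<mapsto> v \<otimes> |k\<rangle>\<close>.\<close>

definition incl :: "nat \<Rightarrow> nat \<Rightarrow> nat \<Rightarrow> fsmat" where
  "incl dS dE k = fsmat_of (dS * dE) dS (\<lambda>r i. if r = i * dE + k then 1 else 0)"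

lemma entry_incl:
  assumes "k < dE"
  shows "entry (incl dS dE k) r i = (if i < dS \<and> r = i * dE + k then 1 else 0)"
  using pair_index_less[of i dS k dE] assms by (auto simp: incl_def entry_fsmat_of)

lemma incl_bounded: "0 < dE \<Longrightarrow> bounded_by (dS * dE) (incl dS dE k)"
  unfolding incl_def by (rule bounded_by_fsmat_of) auto

lemma entry_mult_incl:
  assumes "k < dE" "j < dS"
  shows "entry (Y * incl dS dE k) i j = entry Y i (j * dE + k)"
proof -
  have "entry (Y * incl dS dE k) i j = (\<Sum>r<dS * dE. entry Y i r * entry (incl dS dE k) r j)"
    using assms by (intro entry_times) (auto simp: incl_bounded)
  also have "\<dots> = (\<Sum>r<dS * dE. if r = j * dE + k then entry Y i r else 0)"
    by (rule sum.cong) (use assms in \<open>auto simp: entry_incl\<close>)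
  finally show ?thesis using pair_index_less[of j dS k dE] assms by simp
qed

lemma entry_adj_incl_mult:
  assumes "k < dE" "i < dS"
  shows "entry (adj (incl dS dE k) * Y) i j = entry Y (i * dE + k) j"
  using entry_mult_incl[OF assms, of "adj Y" j]
  by (metis adj_adj adj_mult complex_cnj_cancel_iff entry_adj)

lemma incl_idp: "k < dE \<Longrightarrow> incl dS dE k * idp dS = incl dS dE k"
  by (rule fsmat_eqI) (auto simp: entry_mult_idp entry_incl)

lemma bipartite_incl:
  assumes dE: "0 < dE"
  shows "bipartite (idp dS) (idp (dS * dE)) dE (incl dS dE)"
proof
  show "proj (idp dS)" "proj (idp (dS * dE))" by (auto simp: proj_def)
  show "incl dS dE k * idp dS = incl dS dE k" if "k < dE" for k using incl_idp that .
  show "adj (incl dS dE k) * incl dS dE l = (if k = l then idp dS else 0)" if "k < dE" "l < dE" for k l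
  proof (rule fsmat_eqI)
    fix i j
    show "entry (adj (incl dS dE k) * incl dS dE l) i j = entry (if k = l then idp dS else 0) i j"
    proof (cases "i < dS")
      case True
      have "i * dE + k = j * dE + l \<longleftrightarrow> i = j \<and> k = l"
        using that by (metis add_left_cancel div_mult_self3 div_less add.right_neutral mod_mult_self3 mod_less less_nat_zero_code)
      then show ?thesis using True that by (auto simp: entry_adj_incl_mult entry_incl entry_idp)
    next
      case False
      have "idp dS * (adj (incl dS dE k) * incl dS dE l) = adj (incl dS dE k) * incl dS dE l"
        using incl_idp[OF that(1)] by (metis adj_idp adj_mult mult.assoc)
      then have "entry (adj (incl dS dE k) * incl dS dE l) i j = 0" using False by (metis entry_idp_mult)
      then show ?thesis using False by (simp add: entry_idp)
    qed
  qed
  show "(\<Sum>k<dE. incl dS dE k * adj (incl dS dE k)) = idp (dS * dE)"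
  proof (rule fsmat_eqI)
    fix r q
    have "bounded_by (max dS (dS * dE)) (incl dS dE k)" for k unfolding incl_def by (rule bounded_by_fsmat_of) auto
    then have "entry (incl dS dE k * adj (incl dS dE k)) r q =
      (\<Sum>i<dS. entry (incl dS dE k) r i * cnj (entry (incl dS dE k) q i))" if "k < dE" for k
      using that by (subst entry_times[of "max dS (dS * dE)"], simp)
        (intro sum.mono_neutral_cong_right, auto simp: entry_incl entry_adj)
    then have "entry (\<Sum>k<dE. incl dS dE k * adj (incl dS dE k)) r q =
      (\<Sum>k<dE. \<Sum>i<dS. entry (incl dS dE k) r i * cnj (entry (incl dS dE k) q i))"
      by (simp add: entry_sum)
    also have "\<dots> = (\<Sum>k<dE. \<Sum>i<dS. if i * dE + k = r then (if r = q then 1 else 0) else 0)"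
      by (intro sum.cong refl) (auto simp: entry_incl)
    also have "\<dots> = (\<Sum>i<dS. \<Sum>k<dE. if i * dE + k = r then (if r = q then 1 else 0) else 0)"
      by (rule sum.swap)
    also have "\<dots> = (\<Sum>x<dS * dE. if x = r then (if r = q then 1 else 0) else 0)"
      unfolding sum_lessThan_mult ..
    also have "\<dots> = entry (idp (dS * dE)) r q" by (simp add: entry_idp)
    finally show "entry (\<Sum>k<dE. incl dS dE k * adj (incl dS dE k)) r q = entry (idp (dS * dE)) r q" .
  qed
qed

lemma fs_ptrace:
  assumes "X \<in> carrier_mat (dS * dE) (dS * dE)"
  shows "fs (ptrace_E dS dE X) = (\<Sum>k<dE. adj (incl dS dE k) * fs X * incl dS dE k)"
proof (rule fsmat_eqI)
  fix i j
  show "entry (fs (ptrace_E dS dE X)) i j = entry (\<Sum>k<dE. adj (incl dS dE k) * fs X * incl dS dE k) i j"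
  proof (cases "i < dS \<and> j < dS")
    case True
    have "entry (adj (incl dS dE k) * fs X * incl dS dE k) i j = X $$ (i * dE + k, j * dE + k)" if "k < dE" for k
      using True that assms pair_index_less[of i dS k dE] pair_index_less[of j dS k dE]
      by (simp add: entry_mult_incl entry_adj_incl_mult entry_fs)
    then show ?thesis using True by (simp add: entry_sum ptrace_E_def entry_fs)
  next
    case False
    have "entry (adj (incl dS dE k) * fs X * incl dS dE k) i j = 0" if "k < dE" for k
    proof -
      have "idp dS * (adj (incl dS dE k) * fs X * incl dS dE k) * idp dS = adj (incl dS dE k) * fs X * incl dS dE k"
        using incl_idp[OF that] by (metis adj_idp adj_mult mult.assoc)
      then show ?thesis using False by (metis entry_idp_mult entry_mult_idp)
    qed
    then show ?thesis using False by (auto simp: entry_sum ptrace_E_def entry_fs)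
  qed
qed

lemma ptrace_carrier [simp]: "ptrace_E dS dE X \<in> carrier_mat dS dS" by (simp add: ptrace_E_def)

subsection \<open>Kraus maps\<close>

text \<open>Padded matrices carry no dimensions, so the shape of each \<open>G r\<close> is fixed by
  the corner identities.\<close>

definition kraus :: "nat \<Rightarrow> nat \<Rightarrow> ('i \<Rightarrow> fsmat) \<Rightarrow> 'i set \<Rightarrow> (complex mat \<Rightarrow> complex mat) \<Rightarrow> bool" where
  "kraus n p G S \<Phi> \<longleftrightarrow> (\<forall>r\<in>S. idp p * G r = G r \<and> G r * idp n = G r) \<and>
     (\<forall>X\<in>carrier_mat n n. \<Phi> X \<in> carrier_mat p p \<and> fs (\<Phi> X) = (\<Sum>r\<in>S. G r * fs X * adj (G r)))"

lemma kraus_linear: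
  assumes k: "kraus n p G S \<Phi>"
  shows "linear_map n p \<Phi>"
  unfolding linear_map_def
proof (intro conjI ballI allI)
  have c: "\<Phi> X \<in> carrier_mat p p" and f: "fs (\<Phi> X) = (\<Sum>r\<in>S. G r * fs X * adj (G r))" if "X \<in> carrier_mat n n" for X
    using k that unfolding kraus_def by blast+
  show "\<Phi> X \<in> carrier_mat p p" if "X \<in> carrier_mat n n" for X :: "complex mat" using c that .
  fix X Y :: "complex mat" and a b assume X: "X \<in> carrier_mat n n" and Y: "Y \<in> carrier_mat n n"
  show "\<Phi> (a \<cdot>\<^sub>m X + b \<cdot>\<^sub>m Y) = a \<cdot>\<^sub>m \<Phi> X + b \<cdot>\<^sub>m \<Phi> Y"
  proof (rule fs_inject)
    show "\<Phi> (a \<cdot>\<^sub>m X + b \<cdot>\<^sub>m Y) \<in> carrier_mat p p" "a \<cdot>\<^sub>m \<Phi> X + b \<cdot>\<^sub>m \<Phi> Y \<in> carrier_mat p p"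
      using c X Y by auto
    have "fs (a \<cdot>\<^sub>m \<Phi> X + b \<cdot>\<^sub>m \<Phi> Y) = a *\<^sub>C fs (\<Phi> X) + b *\<^sub>C fs (\<Phi> Y)"
      using fs_add[of "a \<cdot>\<^sub>m \<Phi> X" p p "b \<cdot>\<^sub>m \<Phi> Y"] c X Y by (simp add: fs_smult)
    moreover have "fs (a \<cdot>\<^sub>m X + b \<cdot>\<^sub>m Y) = a *\<^sub>C fs X + b *\<^sub>C fs Y"
      using fs_add[of "a \<cdot>\<^sub>m X" n n "b \<cdot>\<^sub>m Y"] X Y by (simp add: fs_smult)
    ultimately show "fs (\<Phi> (a \<cdot>\<^sub>m X + b \<cdot>\<^sub>m Y)) = fs (a \<cdot>\<^sub>m \<Phi> X + b \<cdot>\<^sub>m \<Phi> Y)"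
      using X Y by (simp add: f distrib_left distrib_right sum.distrib fsvs.scale_sum_right)
  qed
qed

lemma kraus_trace_preserving:
  assumes k: "kraus n p G S \<Phi>" and G: "(\<Sum>r\<in>S. adj (G r) * G r) = idp n"
  shows "trace_preserving n \<Phi>"
  unfolding trace_preserving_def
proof
  fix X :: "complex mat" assume X: "X \<in> carrier_mat n n"
  have c: "\<Phi> X \<in> carrier_mat p p" and f: "fs (\<Phi> X) = (\<Sum>r\<in>S. G r * fs X * adj (G r))"
    using k X unfolding kraus_def by blast+
  have "mtrace (\<Phi> X) = (\<Sum>r\<in>S. tr (G r * fs X * adj (G r)))" using tr_fs[OF c] f by (simp add: tr_sum)
  also have "\<dots> = (\<Sum>r\<in>S. tr (fs X * (adj (G r) * G r)))"
  proof (rule sum.cong)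
    fix r show "tr (G r * fs X * adj (G r)) = tr (fs X * (adj (G r) * G r))"
      using tr_mult_commute[of "G r" "fs X * adj (G r)"] by (simp add: mult.assoc)
  qed simp
  also have "\<dots> = tr (fs X * idp n)" unfolding G[symmetric] by (simp add: sum_distrib_left tr_sum)
  also have "fs X * idp n = fs X" using fs_bounded[OF X] unfolding bounded_by_iff_idp by blast
  finally show "mtrace (\<Phi> X) = mtrace X" using tr_fs[OF X] by simp
qed

lemma kraus_compose:
  assumes k: "kraus n p G S \<Phi>" and k': "kraus p q H S' \<Psi>" and fin: "finite S" "finite S'"
  shows "kraus n q (\<lambda>(r, r'). H r' * G r) (S \<times> S') (\<lambda>X. \<Psi> (\<Phi> X))"
proof -
  have k1: "\<And>r. r \<in> S \<Longrightarrow> G r * idp n = G r" "\<And>r. r \<in> S' \<Longrightarrow> idp q * H r = H r"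
    using k k' by (auto simp: kraus_def)
  have "fs (\<Psi> (\<Phi> X)) = (\<Sum>(r,r')\<in>S \<times> S'. (H r' * G r) * fs X * adj (H r' * G r))" if X: "X \<in> carrier_mat n n" for X
  proof -
    have "fs (\<Psi> (\<Phi> X)) = (\<Sum>r'\<in>S'. \<Sum>r\<in>S. H r' * (G r * fs X * adj (G r)) * adj (H r'))"
      using k k' X by (simp add: kraus_def sum_distrib_left sum_distrib_right)
    also have "\<dots> = (\<Sum>(r,r')\<in>S \<times> S'. (H r' * G r) * fs X * adj (H r' * G r))"
      by (subst sum.swap) (simp add: sum.cartesian_product mult.assoc)
    finally show ?thesis .
  qed
  then show ?thesis using k k' k1 unfolding kraus_def
    by (auto simp: mult.assoc case_prod_unfold) (simp add: mult.assoc[symmetric])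
qed

text \<open>The ampliation has Kraus form again, with the operators \<open>D r\<close>, which are
  \<open>1 \<otimes> G r\<close> in the index convention of the tensor product; and Kraus form
  implies positivity.\<close>

lemma kraus_completely_positive:
  assumes k: "kraus n p G S \<Phi>"
  shows "completely_positive n p \<Phi>"
  unfolding completely_positive_def positive_map_def
proof (intro allI impI)
  fix m X assume X: "psd (m * n) X"
  then have Xc: "X \<in> carrier_mat (m * n) (m * n)" by (simp add: psd_def)
  define D where "D r = fsmat_of (m * p) (m * n) (\<lambda>u v. if u div p = v div n then entry (G r) (u mod p) (v mod n) else 0)" for r
  have Gb: "entry (G r) u v = 0" if "r \<in> S" "n \<le> v" for r u v
    using k that unfolding kraus_def by (metis entry_mult_idp not_le)
  have GY: "entry (G r * Y) u j = (\<Sum>v<n. entry (G r) u v * entry Y v j)" if "r \<in> S" for r u j Y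
    by (rule entry_times_row) (use Gb that in auto)
  have DX: "entry (D r * Y) u j = (\<Sum>v<n. entry (G r) (u mod p) v * entry Y (u div p * n + v) j)"
    if u: "u < m * p" for r u j Y
  proof -
    have um: "u div p < m" using u by (simp add: less_mult_imp_div_less)
    have "entry (D r * Y) u j = (\<Sum>x<m * n. entry (D r) u x * entry Y x j)"
      by (rule entry_times_row) (simp add: D_def entry_fsmat_of)
    also have "\<dots> = (\<Sum>i<m. \<Sum>v<n. entry (D r) u (i * n + v) * entry Y (i * n + v) j)"
      by (rule sum_lessThan_mult)
    also have "\<dots> = (\<Sum>i<m. if i = u div p then (\<Sum>v<n. entry (G r) (u mod p) v * entry Y (u div p * n + v) j) else 0)"
    proof (rule sum.cong[OF refl])
      fix i assume i: "i \<in> {..<m}"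
      have "entry (D r) u (i * n + v) = (if i = u div p then entry (G r) (u mod p) v else 0)" if "v < n" for v
        using that i u pair_index_less[of i m v n] by (auto simp: D_def entry_fsmat_of)
      then show "(\<Sum>v<n. entry (D r) u (i * n + v) * entry Y (i * n + v) j) =
        (if i = u div p then (\<Sum>v<n. entry (G r) (u mod p) v * entry Y (u div p * n + v) j) else 0)" by simp
    qed
    finally show ?thesis using um by simp
  qed
  have eq: "fs (ampliation m n p \<Phi> X) = (\<Sum>r\<in>S. D r * fs X * adj (D r))"
  proof (rule fsmat_eqI)
    fix u v
    show "entry (fs (ampliation m n p \<Phi> X)) u v = entry (\<Sum>r\<in>S. D r * fs X * adj (D r)) u v"
    proof (cases "u < m * p \<and> v < m * p")
      case True
      then have uv: "u div p < m" "v div p < m" "u mod p < p" "v mod p < p"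
        by (auto simp: less_mult_imp_div_less) (metis mod_less_divisor mult_0_right neq0_conv not_less_zero)+
      let ?Y = "mat n n (\<lambda>(i,j). X $$ (u div p * n + i, v div p * n + j))"
      have Y: "\<Phi> ?Y \<in> carrier_mat p p" "fs (\<Phi> ?Y) = (\<Sum>r\<in>S. G r * fs ?Y * adj (G r))"
        using k unfolding kraus_def by auto
      have "entry (fs (ampliation m n p \<Phi> X)) u v = entry (fs (\<Phi> ?Y)) (u mod p) (v mod p)"
        using True uv Y(1) by (simp add: entry_fs ampliation_def)
      also have "\<dots> = (\<Sum>r\<in>S. entry (G r * fs ?Y * adj (G r)) (u mod p) (v mod p))"
        unfolding Y(2) entry_sum ..
      also have "\<dots> = (\<Sum>r\<in>S. entry (D r * fs X * adj (D r)) u v)"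
      proof (rule sum.cong[OF refl])
        fix r assume r: "r \<in> S"
        have Y': "entry (fs ?Y) i j = entry (fs X) (u div p * n + i) (v div p * n + j)" if "i < n" "j < n" for i j
          using that uv pair_index_less[of "u div p" m i n] pair_index_less[of "v div p" m j n] Xc
          by (simp add: entry_fs)
        have "entry (G r * (fs ?Y * adj (G r))) (u mod p) (v mod p) =
          (\<Sum>i<n. entry (G r) (u mod p) i * cnj (entry (G r * adj (fs ?Y)) (v mod p) i))"
          unfolding entry_mult_adj[of "fs ?Y" "G r", symmetric] by (rule GY[OF r])
        also have "\<dots> = (\<Sum>i<n. entry (G r) (u mod p) i * cnj (entry (D r * adj (fs X)) v (u div p * n + i)))"
          using r True by (intro sum.cong refl) (simp add: GY DX entry_adj Y')
        also have "\<dots> = entry (D r * (fs X * adj (D r))) u v"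
          unfolding entry_mult_adj[of "fs X" "D r", symmetric] using True by (simp only: DX)
        finally show "entry (G r * fs ?Y * adj (G r)) (u mod p) (v mod p) = entry (D r * fs X * adj (D r)) u v"
          by (simp add: mult.assoc)
      qed
      finally show ?thesis by (simp add: entry_sum)
    next
      case False
      have "entry (D r * Y * adj (D r)) u v = 0" for r Y
      proof -
        have "idp (m * p) * D r = D r" by (rule fsmat_eqI) (auto simp: entry_idp_mult D_def entry_fsmat_of)
        moreover from this have "adj (D r) * idp (m * p) = adj (D r)" by (metis adj_idp adj_mult)
        ultimately have "D r * Y * adj (D r) = idp (m * p) * (D r * Y * adj (D r)) * idp (m * p)"
          by (simp add: mult.assoc) (simp add: mult.assoc[symmetric])
        also have "entry \<dots> u v = 0" using False by (simp only: entry_mult_idp entry_idp_mult) auto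
        finally show ?thesis .
      qed
      then show ?thesis using False by (auto simp: entry_sum entry_fs ampliation_def)
    qed
  qed
  have "pos (fs X)" using X psd_iff_pos[OF Xc] by simp
  then have "pos (fs (ampliation m n p \<Phi> X))" unfolding eq by (intro pos_sum pos_conj')
  then show "psd (m * p) (ampliation m n p \<Phi> X)"
    by (subst psd_iff_pos) (auto simp: ampliation_def)
qed

section \<open>Density matrices and index arithmetic of tensor products\<close>

lemma density_iff: "A \<in> density n \<longleftrightarrow> A \<in> carrier_mat n n \<and> pos (fs A) \<and> tr (fs A) = 1"
  unfolding density_def using psd_iff_pos[of A n] tr_fs[of A n] by (auto simp: psd_def)

text \<open>A positive matrix of trace zero vanishes, yet a density operator has to stand next to
  its zero weight; the rank-one projection \<open>mu 0 0\<close> is supplied as the default.\<close>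

lemma psd_normalize:
  assumes A: "psd n A" and n: "0 < n"
  shows "\<exists>t \<sigma>. 0 \<le> t \<and> \<sigma> \<in> density n \<and> A = complex_of_real t \<cdot>\<^sub>m \<sigma> \<and> complex_of_real t = mtrace A"
proof -
  have Ac: "A \<in> carrier_mat n n" using A by (simp add: psd_def)
  have pA: "pos (fs A)" using A psd_iff_pos[OF Ac] by blast
  define t where "t = Re (tr (fs A))"
  have t: "tr (fs A) = complex_of_real t" "0 \<le> t"
    using pos_tr[OF pA] by (auto simp: t_def less_eq_complex_def complex_eq_iff)
  show ?thesis
  proof (cases "t = 0")
    case True
    then have "fs A = 0" using pos_tr_eq_0[OF pA] t by simp
    define \<sigma> where "\<sigma> = of_fs n (mu 0 0)"
    have "bounded_by n (mu 0 0)" using n by (auto simp: bounded_by_def entry_mu)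
    then have fs\<sigma>: "fs \<sigma> = mu 0 0" unfolding \<sigma>_def by (rule fs_of_fs)
    have "pos (mu 0 0)" using pos_adj_mult[of "mu 0 0"] by (simp add: mu_mult_mu)
    then have "\<sigma> \<in> density n" by (simp add: density_iff fs\<sigma> tr_mu) (simp add: \<sigma>_def)
    moreover have "A = complex_of_real t \<cdot>\<^sub>m \<sigma>"
      by (rule fs_inject[of _ n]) (use True \<open>fs A = 0\<close> Ac in \<open>auto simp: fs_smult \<sigma>_def\<close>)
    ultimately show ?thesis using t tr_fs[OF Ac] by (intro exI[of _ t] exI[of _ \<sigma>]) auto
  next
    case False
    define \<sigma> where "\<sigma> = complex_of_real (1 / t) \<cdot>\<^sub>m A"
    have "\<sigma> \<in> density n" unfolding density_iff \<sigma>_def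
      using Ac pos_sc[OF pA, of "1 / t"] t False by (auto simp: fs_smult tr_sc)
    moreover have "A = complex_of_real t \<cdot>\<^sub>m \<sigma>"
      by (rule fs_inject[of _ n]) (use False Ac in \<open>auto simp: fs_smult \<sigma>_def\<close>)
    ultimately show ?thesis using t tr_fs[OF Ac] by (intro exI[of _ t] exI[of _ \<sigma>]) auto
  qed
qed

lemma tensor_index:
  assumes "i < dim_row A" "j < dim_col A" "x < dim_row B" "y < dim_col B"
  shows "tensor_mat A B $$ (i * dim_row B + x, j * dim_col B + y) = A $$ (i, j) * B $$ (x, y)"
  using assms pair_index_less[of i "dim_row A" x "dim_row B"] pair_index_less[of j "dim_col A" y "dim_col B"]
  by (simp add: tensor_mat_def)

lemma tensor_dim [simp]:
  "dim_row (tensor_mat A B) = dim_row A * dim_row B" "dim_col (tensor_mat A B) = dim_col A * dim_col B"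
  by (simp_all add: tensor_mat_def)

text \<open>The groupings \<open>((l, (i1, b)), y)\<close> and \<open>((l, i1), (b, y))\<close>
  encode the same number, so the tensor product of a left and a right state fits between the
  isometries as it stands. The two identity factors collapse the sums over \<open>l\<close> and
  \<open>y\<close>.\<close>

lemma sum_tensor_row:
  assumes W: "W \<in> carrier_mat dS (aL * aR)" and l: "l < m" and i: "i < dS" and x: "x < dE"
  shows "(\<Sum>p<m * (aL * aR) * dE. tensor_mat (tensor_mat (1\<^sub>m m) W) (1\<^sub>m dE) $$ ((l * dS + i) * dE + x, p) * g p) =
    (\<Sum>i1<aL. \<Sum>b<aR. W $$ (i, i1 * aR + b) * g ((l * aL + i1) * (aR * dE) + (b * dE + x)))"
proof -
  let ?Wt = "tensor_mat (tensor_mat (1\<^sub>m m) W) (1\<^sub>m dE)"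
  have Wd: "dim_row W = dS" "dim_col W = aL * aR" using W by auto
  have ent: "?Wt $$ ((l * dS + i) * dE + x, (l' * (aL * aR) + q) * dE + y) = (if l = l' \<and> x = y then W $$ (i, q) else 0)"
    if "l' < m" "q < aL * aR" "y < dE" for l' q y
  proof -
    have "?Wt $$ ((l * dS + i) * dE + x, (l' * (aL * aR) + q) * dE + y) =
      tensor_mat (1\<^sub>m m) W $$ (l * dS + i, l' * (aL * aR) + q) * 1\<^sub>m dE $$ (x, y)"
      using tensor_index[of "l * dS + i" "tensor_mat (1\<^sub>m m) W" "l' * (aL * aR) + q" x "1\<^sub>m dE" y]
        pair_index_less[OF l i] pair_index_less[OF that(1,2)] x that Wd by simp
    also have "tensor_mat (1\<^sub>m m) W $$ (l * dS + i, l' * (aL * aR) + q) = 1\<^sub>m m $$ (l, l') * W $$ (i, q)"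
      using tensor_index[of l "1\<^sub>m m" l' i W q] l i that Wd by simp
    finally show ?thesis using l x that by simp
  qed
  have "(\<Sum>p<m * (aL * aR) * dE. ?Wt $$ ((l * dS + i) * dE + x, p) * g p) =
    (\<Sum>l'<m. \<Sum>q<aL * aR. \<Sum>y<dE. ?Wt $$ ((l * dS + i) * dE + x, (l' * (aL * aR) + q) * dE + y) * g ((l' * (aL * aR) + q) * dE + y))"
    unfolding sum_lessThan_mult ..
  also have "\<dots> = (\<Sum>l'<m. \<Sum>q<aL * aR. \<Sum>y<dE. if x = y then (if l = l' then W $$ (i, q) * g ((l' * (aL * aR) + q) * dE + y) else 0) else 0)"
    by (intro sum.cong refl) (auto simp: ent)
  also have "\<dots> = (\<Sum>l'<m. if l = l' then (\<Sum>q<aL * aR. W $$ (i, q) * g ((l' * (aL * aR) + q) * dE + x)) else 0)"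
    using x by (intro sum.cong refl) auto
  also have "\<dots> = (\<Sum>q<aL * aR. W $$ (i, q) * g ((l * (aL * aR) + q) * dE + x))"
    using l by simp
  also have "\<dots> = (\<Sum>i1<aL. \<Sum>b<aR. W $$ (i, i1 * aR + b) * g ((l * aL + i1) * (aR * dE) + (b * dE + x)))"
    unfolding sum_lessThan_mult by (simp add: distrib_right distrib_left mult.assoc add.assoc)
  finally show ?thesis .
qed

lemma tensor_sandwich:
  assumes W: "W \<in> carrier_mat dS (aL * aR)" and l: "l < m" "l' < m" and i: "i < dS" "j < dS" and x: "x < dE" "y < dE"
    and T: "T \<in> carrier_mat (m * (aL * aR) * dE) (m * (aL * aR) * dE)"
  defines "Wt \<equiv> tensor_mat (tensor_mat (1\<^sub>m m) W) (1\<^sub>m dE)"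
  shows "(Wt * T * mat_adjoint Wt) $$ ((l * dS + i) * dE + x, (l' * dS + j) * dE + y) =
    (\<Sum>i1<aL. \<Sum>b<aR. \<Sum>i2<aL. \<Sum>b'<aR. W $$ (i, i1 * aR + b) *
      T $$ ((l * aL + i1) * (aR * dE) + (b * dE + x), (l' * aL + i2) * (aR * dE) + (b' * dE + y)) * cnj (W $$ (j, i2 * aR + b')))"
proof -
  define D where "D = m * (aL * aR) * dE"
  define r where "r = (l * dS + i) * dE + x"
  define c where "c = (l' * dS + j) * dE + y"
  have Wt: "dim_row Wt = m * dS * dE" "dim_col Wt = D" using W by (auto simp: Wt_def D_def)
  have rc: "r < m * dS * dE" "c < m * dS * dE" unfolding r_def c_def
    using pair_index_less[OF pair_index_less[OF l(1) i(1)] x(1)] pair_index_less[OF pair_index_less[OF l(2) i(2)] x(2)] by auto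
  have TD: "dim_row T = D" "dim_col T = D" using T by (auto simp: D_def)
  have 1: "(Wt * T) $$ (r, q) = (\<Sum>p<D. Wt $$ (r, p) * T $$ (p, q))" if "q < D" for q
    using rc Wt TD that by (simp add: scalar_prod_def lessThan_atLeast0)
  have "(Wt * T * mat_adjoint Wt) $$ (r, c) = (\<Sum>q<D. (Wt * T) $$ (r, q) * cnj (Wt $$ (c, q)))"
    using rc Wt TD by (simp add: scalar_prod_def lessThan_atLeast0 mat_adjoint_index del: index_mult_mat(1))
      (simp add: scalar_prod_def lessThan_atLeast0 mat_adjoint_index)
  \<comment> \<open>Conjugation turns the sum against the adjoint into a row sum, so the same lemma
    serves both sides.\<close>
  also have "\<dots> = cnj (\<Sum>q<D. Wt $$ (c, q) * cnj ((Wt * T) $$ (r, q)))"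
    by (simp add: mult.commute)
  also have "(\<Sum>q<D. Wt $$ (c, q) * cnj ((Wt * T) $$ (r, q))) =
    (\<Sum>i2<aL. \<Sum>b'<aR. W $$ (j, i2 * aR + b') * cnj ((Wt * T) $$ (r, (l' * aL + i2) * (aR * dE) + (b' * dE + y))))"
    unfolding c_def D_def Wt_def by (rule sum_tensor_row[OF W l(2) i(2) x(2)])
  also have "cnj \<dots> = (\<Sum>i2<aL. \<Sum>b'<aR. (Wt * T) $$ (r, (l' * aL + i2) * (aR * dE) + (b' * dE + y)) * cnj (W $$ (j, i2 * aR + b')))"
    by (simp add: mult.commute)
  also have "\<dots> = (\<Sum>i2<aL. \<Sum>b'<aR. (\<Sum>i1<aL. \<Sum>b<aR. W $$ (i, i1 * aR + b) *
      T $$ ((l * aL + i1) * (aR * dE) + (b * dE + x), (l' * aL + i2) * (aR * dE) + (b' * dE + y))) * cnj (W $$ (j, i2 * aR + b')))"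
  proof (intro sum.cong refl arg_cong2[where f = "(*)"])
    fix i2 b' assume "i2 \<in> {..<aL}" "b' \<in> {..<aR}"
    then have "(l' * aL + i2) * (aR * dE) + (b' * dE + y) < (m * aL) * (aR * dE)"
      using l x by (intro pair_index_less) auto
    then have q: "(l' * aL + i2) * (aR * dE) + (b' * dE + y) < D" by (simp add: D_def mult.assoc)
    show "(Wt * T) $$ (r, (l' * aL + i2) * (aR * dE) + (b' * dE + y)) = (\<Sum>i1<aL. \<Sum>b<aR. W $$ (i, i1 * aR + b) *
      T $$ ((l * aL + i1) * (aR * dE) + (b * dE + x), (l' * aL + i2) * (aR * dE) + (b' * dE + y)))"
      unfolding 1[OF q] unfolding r_def D_def Wt_def by (rule sum_tensor_row[OF W l(1) i(1) x(1)])
  qed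
  also have "\<dots> = (\<Sum>i2<aL. \<Sum>b'<aR. \<Sum>i1<aL. \<Sum>b<aR. W $$ (i, i1 * aR + b) *
      T $$ ((l * aL + i1) * (aR * dE) + (b * dE + x), (l' * aL + i2) * (aR * dE) + (b' * dE + y)) * cnj (W $$ (j, i2 * aR + b')))"
    by (simp only: sum_distrib_right)
  also have "\<dots> = (\<Sum>i2<aL. \<Sum>i1<aL. \<Sum>b<aR. \<Sum>b'<aR. W $$ (i, i1 * aR + b) *
      T $$ ((l * aL + i1) * (aR * dE) + (b * dE + x), (l' * aL + i2) * (aR * dE) + (b' * dE + y)) * cnj (W $$ (j, i2 * aR + b')))"
    by (rule sum.cong[OF refl], rule trans[OF sum.swap], rule sum.cong[OF refl], rule sum.swap)
  also have "\<dots> = (\<Sum>i1<aL. \<Sum>b<aR. \<Sum>i2<aL. \<Sum>b'<aR. W $$ (i, i1 * aR + b) *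
      T $$ ((l * aL + i1) * (aR * dE) + (b * dE + x), (l' * aL + i2) * (aR * dE) + (b' * dE + y)) * cnj (W $$ (j, i2 * aR + b')))"
    by (rule trans[OF sum.swap], rule sum.cong[OF refl], rule sum.swap)
  finally show ?thesis unfolding r_def c_def .
qed

lemma entry_column_outer:
  assumes "u * mu 0 0 = u" "w * mu 0 0 = w"
  shows "entry (u * adj w) i j = entry u i 0 * cnj (entry w j 0)"
proof -
  have "entry u i k = 0" if "1 \<le> k" for k
    using that arg_cong[OF assms(1), of "\<lambda>x. entry x i k"] by (simp add: entry_mult_mu)
  then have "entry (u * adj w) i j = (\<Sum>k<1. entry u i k * entry (adj w) k j)"
    by (rule entry_times_row)
  then show ?thesis by (simp add: entry_adj)
qed

text \<open>The matrix describes a classical register attached to the family \<open>L l\<close>; its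
  form is the sum of the forms of the blocks.\<close>

lemma psd_block_diagonal:
  assumes "\<And>l. l < m \<Longrightarrow> pos_form n (L l)"
  shows "psd (m * n) (mat (m * n) (m * n) (\<lambda>(r, c). if r div n = c div n then L (r div n) (r mod n) (c mod n) else 0))"
proof (subst psd_iff_pos_form)
  let ?M = "mat (m * n) (m * n) (\<lambda>(r, c). if r div n = c div n then L (r div n) (r mod n) (c mod n) else 0)"
  show "?M \<in> carrier_mat (m * n) (m * n)" by simp
  show "pos_form (m * n) (\<lambda>i j. ?M $$ (i, j))"
    unfolding pos_form_def
  proof
    fix \<xi> :: "nat \<Rightarrow> complex"
    have "(\<Sum>r<m * n. \<Sum>c<m * n. cnj (\<xi> r) * ?M $$ (r, c) * \<xi> c) =
      (\<Sum>l<m. \<Sum>i<n. \<Sum>l'<m. \<Sum>j<n. cnj (\<xi> (l * n + i)) * ?M $$ (l * n + i, l' * n + j) * \<xi> (l' * n + j))"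
      unfolding sum_lessThan_mult ..
    also have "\<dots> = (\<Sum>l<m. \<Sum>i<n. \<Sum>l'<m. if l = l' then (\<Sum>j<n. cnj (\<xi> (l * n + i)) * L l i j * \<xi> (l' * n + j)) else 0)"
      by (intro sum.cong refl) (auto simp: pair_index_less)
    also have "\<dots> = (\<Sum>l<m. \<Sum>i<n. \<Sum>j<n. cnj (\<xi> (l * n + i)) * L l i j * \<xi> (l * n + j))" by simp
    also have "0 \<le> \<dots>"
    proof (rule sum_nonneg)
      fix l assume "l \<in> {..<m}"
      then show "0 \<le> (\<Sum>i<n. \<Sum>j<n. cnj (\<xi> (l * n + i)) * L l i j * \<xi> (l * n + j))"
        using assms[of l, unfolded pos_form_def, rule_format, of "\<lambda>i. \<xi> (l * n + i)"] by simp
    qed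
    finally show "0 \<le> (\<Sum>r<m * n. \<Sum>c<m * n. cnj (\<xi> r) * ?M $$ (r, c) * \<xi> c)" .
  qed
qed

lemma psd_pos_form2:
  assumes "pos_form2 n d R"
  shows "psd (n * d) (mat (n * d) (n * d) (\<lambda>(r, c). R (r div d) (r mod d) (c div d) (c mod d)))"
proof (subst psd_iff_pos_form)
  let ?M = "mat (n * d) (n * d) (\<lambda>(r, c). R (r div d) (r mod d) (c div d) (c mod d))"
  show "?M \<in> carrier_mat (n * d) (n * d)" by simp
  show "pos_form (n * d) (\<lambda>i j. ?M $$ (i, j))"
    unfolding pos_form_def
  proof
    fix \<xi> :: "nat \<Rightarrow> complex"
    have "(\<Sum>r<n * d. \<Sum>c<n * d. cnj (\<xi> r) * ?M $$ (r, c) * \<xi> c) =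
      (\<Sum>b<n. \<Sum>x<d. \<Sum>b'<n. \<Sum>y<d. cnj (\<xi> (b * d + x)) * ?M $$ (b * d + x, b' * d + y) * \<xi> (b' * d + y))"
      unfolding sum_lessThan_mult ..
    also have "\<dots> = (\<Sum>b<n. \<Sum>x<d. \<Sum>b'<n. \<Sum>y<d. cnj (\<xi> (b * d + x)) * R b x b' y * \<xi> (b' * d + y))"
      by (intro sum.cong refl) (auto simp: pair_index_less)
    also have "0 \<le> \<dots>"
      using assms[unfolded pos_form2_def, rule_format, of "\<lambda>b x. \<xi> (b * d + x)"] by simp
    finally show "0 \<le> (\<Sum>r<n * d. \<Sum>c<n * d. cnj (\<xi> r) * ?M $$ (r, c) * \<xi> c)" .
  qed
qed

subsection \<open>The Markov decomposition\<close>

lemma column_scaled: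
  assumes w: "w * mu 0 0 = w" "w' * mu 0 0 = w'" and Z: "adj w * Z * w' = r *\<^sub>C mu 0 0"
  shows "w * adj w * Z * (w' * adj w') = r *\<^sub>C (w * adj w')"
proof -
  have "w * adj w * Z * (w' * adj w') = w * (adj w * Z * w') * adj w'" by (simp add: mult.assoc)
  then show ?thesis using w unfolding Z by simp
qed

text \<open>The columns of \<open>W k\<close> are the \<open>w k i b\<close>. In summand
  \<open>k\<close> the left state is proportional to the classical register carrying the matrices
  \<open>L l k\<close>, the right state is proportional to \<open>R k\<close>, and the weight is the
  product of their traces divided by \<open>m\<close>.\<close>

lemma markov_state_of_basis:
  assumes dE: "0 < dE" and m: "0 < m"
    and \<rho>: "\<And>l. l \<in> {1..m} \<Longrightarrow> \<rho> l \<in> density (dS * dE)"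
    and basis: "markov_basis (idp dS) dE (incl dS dE) {1..m} (\<lambda>l. fs (\<rho> l)) K aL aR w L R"
  shows "markov_state m dS dE (msum (m * (dS * dE))
             (\<lambda>l. (1 / of_nat m) \<cdot>\<^sub>m tensor_mat (ketbra m (l - 1)) (\<rho> l)) {1..m})"
proof -
  interpret bipartite "idp dS" "idp (dS * dE)" dE "incl dS dE" using dE by (rule bipartite_incl)
  note conjs = basis[unfolded markov_basis_def]
  have aLR: "0 < aL k" "0 < aR k" if "k < K" for k
    using conjs[THEN conjunct1] that by auto
  have wmu: "w k i b * mu 0 0 = w k i b" if "k < K" "i < aL k" "b < aR k" for k i b
    using conjs[THEN conjunct2, THEN conjunct1] that by blast
  have orth: "adj (w k i b) * w k' i' b' = (if k = k' \<and> i = i' \<and> b = b' then mu 0 0 else 0)"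
    if "k < K" "i < aL k" "b < aR k" "k' < K" "i' < aL k'" "b' < aR k'" for k i b k' i' b'
    using conjs[THEN conjunct2, THEN conjunct2, THEN conjunct1] that by blast
  have sumw: "(\<Sum>k<K. \<Sum>i<aL k. \<Sum>b<aR k. w k i b * adj (w k i b)) = idp dS"
    using conjs[THEN conjunct2, THEN conjunct2, THEN conjunct2, THEN conjunct1] .
  have L: "pos_form (aL k) (L l k)" if "l \<in> {1..m}" "k < K" for l k
    using conjs[THEN conjunct2, THEN conjunct2, THEN conjunct2, THEN conjunct2, THEN conjunct1] that by blast
  have R: "pos_form2 (aR k) dE (R k)" if "k < K" for k
    using conjs[THEN conjunct2, THEN conjunct2, THEN conjunct2, THEN conjunct2, THEN conjunct2, THEN conjunct1] that by blast
  define Z where "Z l x y = adj (incl dS dE x) * fs (\<rho> l) * incl dS dE y" for l x y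
  have wZ: "adj (w k i b) * Z l x y * w k' i' b' = (if k = k' then (L l k i i' * R k b x b' y) *\<^sub>C mu 0 0 else 0)"
    if "l \<in> {1..m}" "x < dE" "y < dE" "k < K" "i < aL k" "b < aR k" "k' < K" "i' < aL k'" "b' < aR k'" for l x y k i b k' i' b'
    unfolding Z_def
    using conjs[THEN conjunct2, THEN conjunct2, THEN conjunct2, THEN conjunct2, THEN conjunct2, THEN conjunct2] that by blast
  have IZ: "idp dS * Z l x y = Z l x y" "Z l x y * idp dS = Z l x y" if "x < dE" "y < dE" for l x y
    using IJ[OF that(1)] JI[OF that(2)] by (simp_all add: Z_def mult.assoc) (simp add: mult.assoc[symmetric])
  have Iw: "idp dS * w k i b = w k i b" if "k < K" "i < aL k" "b < aR k" for k i b
  proof -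
    have "idp dS * w k i b = (\<Sum>k'<K. \<Sum>i'<aL k'. \<Sum>b'<aR k'. w k' i' b' * (adj (w k' i' b') * w k i b))"
      unfolding sumw[symmetric] by (simp add: sum_distrib_right mult.assoc)
    also have "\<dots> = (\<Sum>k'<K. \<Sum>i'<aL k'. \<Sum>b'<aR k'. if b' = b then (if i' = i then (if k' = k then w k i b else 0) else 0) else 0)"
      by (intro sum.cong refl) (use that in \<open>auto simp: orth wmu\<close>)
    also have "\<dots> = (\<Sum>k'<K. if k' = k then w k i b else 0)"
      by (intro sum.cong refl) (use that in \<open>auto cong: if_cong\<close>)
    finally show ?thesis using that by simp
  qed
  define W where "W k = mat dS (aL k * aR k) (\<lambda>(r, q). entry (w k (q div aR k) (q mod aR k)) r 0)" for k
  have Wc: "W k \<in> carrier_mat dS (aL k * aR k)" for k by (simp add: W_def)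
  have Wi: "W k $$ (r, i * aR k + b) = entry (w k i b) r 0" if "r < dS" "i < aL k" "b < aR k" for k r i b
    using that pair_index_less[of i "aL k" b "aR k"] by (simp add: W_def)
  have divmod: "q div aR k < aL k" "q mod aR k < aR k" if "q < aL k * aR k" for q k
    using that by (auto simp: less_mult_imp_div_less) (metis mod_less_divisor mult_0_right neq0_conv not_less_zero)
  have W_orth: "mat_adjoint (W k) * W l = (if k = l then 1\<^sub>m (aL k * aR k) else 0\<^sub>m (aL k * aR k) (aL l * aR l))"
    if k: "k < K" "l < K" for k l
  proof (rule eq_matI)
    show "dim_row (mat_adjoint (W k) * W l) = dim_row (if k = l then 1\<^sub>m (aL k * aR k) else 0\<^sub>m (aL k * aR k) (aL l * aR l))"
      "dim_col (mat_adjoint (W k) * W l) = dim_col (if k = l then 1\<^sub>m (aL k * aR k) else 0\<^sub>m (aL k * aR k) (aL l * aR l))"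
      using Wc[of k] Wc[of l] by auto
    fix q q' assume "q < dim_row (if k = l then 1\<^sub>m (aL k * aR k) else (0\<^sub>m (aL k * aR k) (aL l * aR l) :: complex mat))"
      "q' < dim_col (if k = l then 1\<^sub>m (aL k * aR k) else (0\<^sub>m (aL k * aR k) (aL l * aR l) :: complex mat))"
    then have q: "q < aL k * aR k" "q' < aL l * aR l" by (auto split: if_splits)
    note d = divmod[OF q(1)] divmod[OF q(2)]
    have "(mat_adjoint (W k) * W l) $$ (q, q') =
      (\<Sum>r<dS. cnj (entry (w k (q div aR k) (q mod aR k)) r 0) * entry (w l (q' div aR l) (q' mod aR l)) r 0)"
      using q Wc[of k] Wc[of l] by (simp add: scalar_prod_def lessThan_atLeast0 mat_adjoint_index) (simp add: W_def)
    also have "\<dots> = entry (adj (w k (q div aR k) (q mod aR k)) * w l (q' div aR l) (q' mod aR l)) 0 0"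
    proof -
      have "entry (adj (w k (q div aR k) (q mod aR k))) 0 r = 0" if "dS \<le> r" for r
        using arg_cong[OF Iw[OF k(1) d(1,2)], of "\<lambda>x. entry x r 0"] that by (simp add: entry_idp_mult entry_adj)
      then show ?thesis by (simp add: entry_times_row[of dS] entry_adj)
    qed
    also have "\<dots> = (if k = l \<and> q div aR k = q' div aR l \<and> q mod aR k = q' mod aR l then 1 else 0)"
      unfolding orth[OF k(1) d(1,2) k(2) d(3,4)] by (auto simp: entry_mu)
    also have "\<dots> = (if k = l \<and> q = q' then 1 else 0)" by (metis div_mult_mod_eq)
    finally show "(mat_adjoint (W k) * W l) $$ (q, q') = (if k = l then 1\<^sub>m (aL k * aR k) else 0\<^sub>m (aL k * aR k) (aL l * aR l)) $$ (q, q')"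
      using q by auto
  qed
  have W_sum: "msum dS (\<lambda>k. W k * mat_adjoint (W k)) {..<K} = 1\<^sub>m dS"
  proof (rule eq_matI)
    fix i j assume "i < dim_row (1\<^sub>m dS :: complex mat)" "j < dim_col (1\<^sub>m dS :: complex mat)"
    then have ij: "i < dS" "j < dS" by auto
    have "msum dS (\<lambda>k. W k * mat_adjoint (W k)) {..<K} $$ (i, j) = (\<Sum>k<K. \<Sum>q<aL k * aR k. W k $$ (i, q) * cnj (W k $$ (j, q)))"
      using ij carrier_matD[OF Wc] by (simp add: msum_def scalar_prod_def lessThan_atLeast0 mat_adjoint_index)
    also have "\<dots> = (\<Sum>k<K. \<Sum>a<aL k. \<Sum>b<aR k. entry (w k a b * adj (w k a b)) i j)"
      unfolding sum_lessThan_mult by (intro sum.cong refl) (use ij in \<open>simp add: Wi entry_column_outer wmu\<close>)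
    also have "\<dots> = entry (idp dS) i j" unfolding sumw[symmetric] by (simp add: entry_sum)
    finally show "msum dS (\<lambda>k. W k * mat_adjoint (W k)) {..<K} $$ (i, j) = 1\<^sub>m dS $$ (i, j)" using ij by (simp add: entry_idp)
  qed (auto simp: msum_def)
  \<comment> \<open>Register indices start at 0 and the states are numbered from 1, hence
    \<open>Suc\<close>.\<close>
  define NL where "NL k = mat (m * aL k) (m * aL k)
    (\<lambda>(r, c). if r div aL k = c div aL k then L (Suc (r div aL k)) k (r mod aL k) (c mod aL k) else 0)" for k
  define NR where "NR k = mat (aR k * dE) (aR k * dE)
    (\<lambda>(r, c). R k (r div dE) (r mod dE) (c div dE) (c mod dE))" for k
  have "\<exists>t \<sigma>. 0 \<le> t \<and> \<sigma> \<in> density (m * aL k) \<and> NL k = complex_of_real t \<cdot>\<^sub>m \<sigma> \<and> complex_of_real t = mtrace (NL k)" if "k < K" for k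
    using aLR[OF that] m L that unfolding NL_def by (intro psd_normalize psd_block_diagonal) auto
  then obtain tL \<sigma>L where tL: "\<And>k. k < K \<Longrightarrow> 0 \<le> tL k" "\<And>k. k < K \<Longrightarrow> \<sigma>L k \<in> density (m * aL k)"
    "\<And>k. k < K \<Longrightarrow> NL k = complex_of_real (tL k) \<cdot>\<^sub>m \<sigma>L k" "\<And>k. k < K \<Longrightarrow> complex_of_real (tL k) = mtrace (NL k)" by metis
  have "\<exists>t \<sigma>. 0 \<le> t \<and> \<sigma> \<in> density (aR k * dE) \<and> NR k = complex_of_real t \<cdot>\<^sub>m \<sigma> \<and> complex_of_real t = mtrace (NR k)" if "k < K" for k
    using aLR[OF that] dE R[OF that] unfolding NR_def by (intro psd_normalize psd_pos_form2) auto
  then obtain tR \<sigma>R where tR: "\<And>k. k < K \<Longrightarrow> 0 \<le> tR k" "\<And>k. k < K \<Longrightarrow> \<sigma>R k \<in> density (aR k * dE)"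
    "\<And>k. k < K \<Longrightarrow> NR k = complex_of_real (tR k) \<cdot>\<^sub>m \<sigma>R k" "\<And>k. k < K \<Longrightarrow> complex_of_real (tR k) = mtrace (NR k)" by metis
  define lam where "lam k = tL k * tR k / real m" for k
  have trL: "complex_of_real (tL k) = (\<Sum>l<m. \<Sum>i<aL k. L (Suc l) k i i)" if "k < K" for k
    unfolding tL(4)[OF that] mtrace_def by (simp add: NL_def sum_lessThan_mult pair_index_less)
  have trR: "complex_of_real (tR k) = (\<Sum>b<aR k. \<Sum>x<dE. R k b x b x)" if "k < K" for k
    unfolding tR(4)[OF that] mtrace_def by (simp add: NR_def sum_lessThan_mult pair_index_less)
  \<comment> \<open>The trace of \<open>\<rho> l\<close>, computed in the adapted basis, is 1 for
    each \<open>l\<close>. The sum over all \<open>l\<close> is therefore \<open>m\<close>, which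
    the division by \<open>m\<close> in the weights compensates.\<close>
  have lam_sum: "(\<Sum>k<K. lam k) = 1"
  proof -
    have "(\<Sum>x<dE. \<Sum>k<K. \<Sum>i<aL k. \<Sum>b<aR k. L l k i i * R k b x b x) = 1" if l: "l \<in> {1..m}" for l
    proof -
      have "(\<Sum>k<K. \<Sum>i<aL k. \<Sum>b<aR k. L l k i i * R k b x b x) = tr (Z l x x)" if x: "x < dE" for x
      proof -
        have "tr (Z l x x) = tr (Z l x x * idp dS)" using IZ x by simp
        also have "\<dots> = (\<Sum>k<K. \<Sum>i<aL k. \<Sum>b<aR k. tr (Z l x x * (w k i b * adj (w k i b))))"
          unfolding sumw[symmetric] by (simp add: sum_distrib_left tr_sum)
        also have "\<dots> = (\<Sum>k<K. \<Sum>i<aL k. \<Sum>b<aR k. L l k i i * R k b x b x)"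
        proof (intro sum.cong refl)
          fix k i b assume "k \<in> {..<K}" "i \<in> {..<aL k}" "b \<in> {..<aR k}"
          then have kib: "k < K" "i < aL k" "b < aR k" by auto
          have "tr (Z l x x * (w k i b * adj (w k i b))) = tr (adj (w k i b) * Z l x x * w k i b)"
            using tr_mult_commute[of "Z l x x * w k i b" "adj (w k i b)"] by (simp add: mult.assoc)
          then show "tr (Z l x x * (w k i b * adj (w k i b))) = L l k i i * R k b x b x"
            unfolding wZ[OF l x x kib kib] by (simp add: tr_sc tr_mu)
        qed
        finally show ?thesis by simp
      qed
      then have "(\<Sum>x<dE. \<Sum>k<K. \<Sum>i<aL k. \<Sum>b<aR k. L l k i i * R k b x b x) = (\<Sum>x<dE. tr (Z l x x))" by simp
      also have "\<dots> = tr (ptr (fs (\<rho> l)))" by (simp add: ptr_def Z_def tr_sum)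
      also have "\<dots> = tr (idp dS * ptr (fs (\<rho> l)))" by (simp add: I_ptr)
      also have "\<dots> = tr (idp (dS * dE) * fs (\<rho> l))" by (simp add: tr_amp_mult[symmetric] amp_I)
      also have "\<dots> = tr (fs (\<rho> l))"
        using \<rho>[OF l] fs_bounded[of "\<rho> l"] unfolding density_iff bounded_by_iff_idp by simp
      finally show ?thesis using \<rho>[OF l] by (simp add: density_iff)
    qed
    then have "(\<Sum>l<m. \<Sum>x<dE. \<Sum>k<K. \<Sum>i<aL k. \<Sum>b<aR k. L (Suc l) k i i * R k b x b x) = of_nat m" by simp
    moreover have "(\<Sum>l<m. \<Sum>x<dE. \<Sum>k<K. \<Sum>i<aL k. \<Sum>b<aR k. L (Suc l) k i i * R k b x b x) =
      (\<Sum>k<K. complex_of_real (tL k) * complex_of_real (tR k))"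
    proof -
      have "(\<Sum>k<K. complex_of_real (tL k) * complex_of_real (tR k)) =
        (\<Sum>k<K. \<Sum>l<m. \<Sum>x<dE. \<Sum>i<aL k. \<Sum>b<aR k. L (Suc l) k i i * R k b x b x)"
      proof (rule sum.cong[OF refl])
        fix k assume "k \<in> {..<K}"
        then have k: "k < K" by simp
        have "complex_of_real (tL k) * complex_of_real (tR k) = (\<Sum>l<m. (\<Sum>i<aL k. L (Suc l) k i i) * (\<Sum>x<dE. \<Sum>b<aR k. R k b x b x))"
          unfolding trL[OF k] trR[OF k] sum_distrib_right by (subst sum.swap[of _ "{..<aR k}"]) simp
        also have "\<dots> = (\<Sum>l<m. \<Sum>x<dE. (\<Sum>i<aL k. L (Suc l) k i i) * (\<Sum>b<aR k. R k b x b x))"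
          by (simp only: sum_distrib_left)
        also have "\<dots> = (\<Sum>l<m. \<Sum>x<dE. \<Sum>i<aL k. \<Sum>b<aR k. L (Suc l) k i i * R k b x b x)"
          by (simp only: sum_product)
        finally show "complex_of_real (tL k) * complex_of_real (tR k) = (\<Sum>l<m. \<Sum>x<dE. \<Sum>i<aL k. \<Sum>b<aR k. L (Suc l) k i i * R k b x b x)" .
      qed
      also have "\<dots> = (\<Sum>l<m. \<Sum>x<dE. \<Sum>k<K. \<Sum>i<aL k. \<Sum>b<aR k. L (Suc l) k i i * R k b x b x)"
        by (rule trans[OF sum.swap], rule sum.cong[OF refl], rule sum.swap)
      finally show ?thesis by simp
    qed
    ultimately have "complex_of_real (\<Sum>k<K. tL k * tR k) = complex_of_real (real m)" by simp
    then have "(\<Sum>k<K. tL k * tR k) = real m" by (simp only: of_real_eq_iff)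
    then show ?thesis unfolding lam_def sum_divide_distrib[symmetric] using m by simp
  qed
  \<comment> \<open>The resolution of the identity by the \<open>w k i b\<close> is inserted on both
    sides of the block.\<close>
  have entry_\<rho>: "\<rho> l $$ (i * dE + x, j * dE + y) =
      (\<Sum>k<K. \<Sum>i1<aL k. \<Sum>b<aR k. \<Sum>i2<aL k. \<Sum>b'<aR k.
        W k $$ (i, i1 * aR k + b) * (L l k i1 i2 * R k b x b' y) * cnj (W k $$ (j, i2 * aR k + b')))"
    if l: "l \<in> {1..m}" and ij: "i < dS" "j < dS" and xy: "x < dE" "y < dE" for l i j x y
  proof -
    have \<rho>c: "\<rho> l \<in> carrier_mat (dS * dE) (dS * dE)" using \<rho>[OF l] by (simp add: density_iff)
    have "\<rho> l $$ (i * dE + x, j * dE + y) = entry (Z l x y) i j"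
      unfolding Z_def using ij xy \<rho>c pair_index_less[of i dS x dE] pair_index_less[of j dS y dE]
      by (simp add: entry_mult_incl entry_adj_incl_mult entry_fs)
    also have "Z l x y = idp dS * Z l x y * idp dS" using IZ xy by simp
    also have "\<dots> = (\<Sum>k<K. \<Sum>i1<aL k. \<Sum>b<aR k. \<Sum>k'<K. \<Sum>i2<aL k'. \<Sum>b'<aR k'.
      w k i1 b * adj (w k i1 b) * Z l x y * (w k' i2 b' * adj (w k' i2 b')))"
      unfolding sumw[symmetric] sum_distrib_right unfolding sum_distrib_left ..
    also have "\<dots> = (\<Sum>k<K. \<Sum>i1<aL k. \<Sum>b<aR k. \<Sum>k'<K. if k = k' then (\<Sum>i2<aL k'. \<Sum>b'<aR k'.
      (L l k i1 i2 * R k b x b' y) *\<^sub>C (w k i1 b * adj (w k' i2 b'))) else 0)"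
    proof (intro sum.cong refl)
      fix k i1 b k' assume "k \<in> {..<K}" "i1 \<in> {..<aL k}" "b \<in> {..<aR k}" "k' \<in> {..<K}"
      then have k: "k < K" "i1 < aL k" "b < aR k" "k' < K" by auto
      have "w k i1 b * adj (w k i1 b) * Z l x y * (w k' i2 b' * adj (w k' i2 b')) =
        (if k = k' then (L l k i1 i2 * R k b x b' y) *\<^sub>C (w k i1 b * adj (w k' i2 b')) else 0)"
        if "i2 < aL k'" "b' < aR k'" for i2 b'
        using column_scaled[OF wmu[OF k(1-3)] wmu[OF k(4) that], of "Z l x y" "if k = k' then L l k i1 i2 * R k b x b' y else 0"]
          wZ[OF l xy k that] by (cases "k = k'") simp_all
      then show "(\<Sum>i2<aL k'. \<Sum>b'<aR k'. w k i1 b * adj (w k i1 b) * Z l x y * (w k' i2 b' * adj (w k' i2 b'))) =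
        (if k = k' then (\<Sum>i2<aL k'. \<Sum>b'<aR k'. (L l k i1 i2 * R k b x b' y) *\<^sub>C (w k i1 b * adj (w k' i2 b'))) else 0)"
        by simp
    qed
    also have "\<dots> = (\<Sum>k<K. \<Sum>i1<aL k. \<Sum>b<aR k. \<Sum>i2<aL k. \<Sum>b'<aR k.
      (L l k i1 i2 * R k b x b' y) *\<^sub>C (w k i1 b * adj (w k i2 b')))"
      by simp
    also have "entry \<dots> i j = (\<Sum>k<K. \<Sum>i1<aL k. \<Sum>b<aR k. \<Sum>i2<aL k. \<Sum>b'<aR k.
        W k $$ (i, i1 * aR k + b) * (L l k i1 i2 * R k b x b' y) * cnj (W k $$ (j, i2 * aR k + b')))"
      unfolding entry_sum by (intro sum.cong refl) (use ij in \<open>simp add: Wi entry_sc entry_column_outer wmu\<close>)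
    finally show ?thesis .
  qed
  let ?\<omega> = "msum (m * (dS * dE)) (\<lambda>l. (1 / of_nat m) \<cdot>\<^sub>m tensor_mat (ketbra m (l - 1)) (\<rho> l)) {1..m}"
  let ?T = "\<lambda>k. let Wt = tensor_mat (tensor_mat (1\<^sub>m m) (W k)) (1\<^sub>m dE) in
              complex_of_real (lam k) \<cdot>\<^sub>m (Wt * tensor_mat (\<sigma>L k) (\<sigma>R k) * mat_adjoint Wt)"
  have "?\<omega> = msum (m * dS * dE) ?T {..<K}"
  proof (rule eq_matI)
    show "dim_row ?\<omega> = dim_row (msum (m * dS * dE) ?T {..<K})" "dim_col ?\<omega> = dim_col (msum (m * dS * dE) ?T {..<K})"
      by (simp_all add: msum_def mult.assoc)
    fix r c assume "r < dim_row (msum (m * dS * dE) ?T {..<K})" "c < dim_col (msum (m * dS * dE) ?T {..<K})"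
    then have rc: "r < m * dS * dE" "c < m * dS * dE" by (auto simp: msum_def)
    have split: "\<exists>l i x. l < m \<and> i < dS \<and> x < dE \<and> r = (l * dS + i) * dE + x" if r: "r < m * dS * dE" for r
    proof -
      have 1: "r div dE < m * dS" "r mod dE < dE" using r dE by (auto simp: less_mult_imp_div_less)
      then have 2: "r div dE div dS < m" "r div dE mod dS < dS"
        by (auto simp: less_mult_imp_div_less) (metis mod_less_divisor mult_0_right neq0_conv not_less_zero)
      show ?thesis using 1 2 by (intro exI[of _ "r div dE div dS"] exI[of _ "r div dE mod dS"] exI[of _ "r mod dE"]) simp
    qed
    obtain l i x where r: "l < m" "i < dS" "x < dE" "r = (l * dS + i) * dE + x" using split[OF rc(1)] by blast
    obtain l' j y where c: "l' < m" "j < dS" "y < dE" "c = (l' * dS + j) * dE + y" using split[OF rc(2)] by blast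
    have r': "r = l * (dS * dE) + (i * dE + x)" and c': "c = l' * (dS * dE) + (j * dE + y)"
      by (simp_all add: r(4) c(4) distrib_right mult.assoc)
    have ix: "i * dE + x < dS * dE" "j * dE + y < dS * dE" using pair_index_less r c by blast+
    have \<rho>c: "\<rho> t \<in> carrier_mat (dS * dE) (dS * dE)" if "t \<in> {1..m}" for t using \<rho>[OF that] by (simp add: density_iff)
    have "?\<omega> $$ (r, c) = (\<Sum>t\<in>{1..m}. ((1 / of_nat m) \<cdot>\<^sub>m tensor_mat (ketbra m (t - 1)) (\<rho> t)) $$ (r, c))"
      using rc by (simp add: msum_def mult.assoc)
    also have "\<dots> = (\<Sum>t\<in>{1..m}. if t = Suc l then (if l = l' then 1 / of_nat m * \<rho> t $$ (i * dE + x, j * dE + y) else 0) else 0)"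
    proof (rule sum.cong[OF refl])
      fix t assume t: "t \<in> {1..m}"
      have "tensor_mat (ketbra m (t - 1)) (\<rho> t) $$ (r, c) = ketbra m (t - 1) $$ (l, l') * \<rho> t $$ (i * dE + x, j * dE + y)"
        using tensor_index[of l "ketbra m (t - 1)" l' "i * dE + x" "\<rho> t" "j * dE + y"] r(1) c(1) ix carrier_matD[OF \<rho>c[OF t]]
        unfolding r' c' by (simp add: ketbra_def)
      moreover have "r < dim_row (tensor_mat (ketbra m (t - 1)) (\<rho> t))" "c < dim_col (tensor_mat (ketbra m (t - 1)) (\<rho> t))"
        using rc carrier_matD[OF \<rho>c[OF t]] by (simp_all add: ketbra_def mult.assoc)
      ultimately show "((1 / of_nat m) \<cdot>\<^sub>m tensor_mat (ketbra m (t - 1)) (\<rho> t)) $$ (r, c) =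
        (if t = Suc l then (if l = l' then 1 / of_nat m * \<rho> t $$ (i * dE + x, j * dE + y) else 0) else 0)"
        using t r(1) c(1) by (auto simp: ketbra_def)
    qed
    also have "\<dots> = (if l = l' then 1 / of_nat m * \<rho> (Suc l) $$ (i * dE + x, j * dE + y) else 0)" using r(1) by simp
    also have "\<dots> = (\<Sum>k<K. \<Sum>i1<aL k. \<Sum>b<aR k. \<Sum>i2<aL k. \<Sum>b'<aR k. W k $$ (i, i1 * aR k + b) *
      (if l = l' then 1 / of_nat m * (L (Suc l) k i1 i2 * R k b x b' y) else 0) * cnj (W k $$ (j, i2 * aR k + b')))"
    proof (cases "l = l'")
      case True
      show ?thesis using entry_\<rho>[of "Suc l" i j x y] r c True
        by (simp add: sum_divide_distrib)
    qed simp
    also have "\<dots> = (\<Sum>k<K. ?T k $$ (r, c))"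
    proof (rule sum.cong[OF refl])
      fix k assume "k \<in> {..<K}"
      then have k: "k < K" by simp
      let ?Wt = "tensor_mat (tensor_mat (1\<^sub>m m) (W k)) (1\<^sub>m dE)"
      have \<sigma>c: "\<sigma>L k \<in> carrier_mat (m * aL k) (m * aL k)" "\<sigma>R k \<in> carrier_mat (aR k * dE) (aR k * dE)"
        using tL(2)[OF k] tR(2)[OF k] by (auto simp: density_iff)
      have Tc: "tensor_mat (\<sigma>L k) (\<sigma>R k) \<in> carrier_mat (m * (aL k * aR k) * dE) (m * (aL k * aR k) * dE)"
        using \<sigma>c by (intro carrier_matI) (auto simp: mult.assoc)
      have "?T k $$ (r, c) = complex_of_real (lam k) * (?Wt * tensor_mat (\<sigma>L k) (\<sigma>R k) * mat_adjoint ?Wt) $$ (r, c)"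
        using rc carrier_matD[OF Wc[of k]] by (simp add: Let_def del: index_mult_mat(1))
      also have "\<dots> = complex_of_real (lam k) * (\<Sum>i1<aL k. \<Sum>b<aR k. \<Sum>i2<aL k. \<Sum>b'<aR k. W k $$ (i, i1 * aR k + b) *
        tensor_mat (\<sigma>L k) (\<sigma>R k) $$ ((l * aL k + i1) * (aR k * dE) + (b * dE + x), (l' * aL k + i2) * (aR k * dE) + (b' * dE + y)) *
        cnj (W k $$ (j, i2 * aR k + b')))"
        unfolding r(4) c(4) by (subst tensor_sandwich[OF Wc r(1) c(1) r(2) c(2) r(3) c(3) Tc]) (rule refl)
      also have "\<dots> = (\<Sum>i1<aL k. \<Sum>b<aR k. \<Sum>i2<aL k. \<Sum>b'<aR k. W k $$ (i, i1 * aR k + b) *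
        (if l = l' then 1 / of_nat m * (L (Suc l) k i1 i2 * R k b x b' y) else 0) * cnj (W k $$ (j, i2 * aR k + b')))"
        unfolding sum_distrib_left
      proof (intro sum.cong refl)
        fix i1 b i2 b' assume "i1 \<in> {..<aL k}" "b \<in> {..<aR k}" "i2 \<in> {..<aL k}" "b' \<in> {..<aR k}"
        then have ib: "i1 < aL k" "b < aR k" "i2 < aL k" "b' < aR k" by auto
        have idx: "l * aL k + i1 < m * aL k" "l' * aL k + i2 < m * aL k" "b * dE + x < aR k * dE" "b' * dE + y < aR k * dE"
          using pair_index_less ib r c by blast+
        have "tensor_mat (\<sigma>L k) (\<sigma>R k) $$ ((l * aL k + i1) * (aR k * dE) + (b * dE + x), (l' * aL k + i2) * (aR k * dE) + (b' * dE + y))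
          = \<sigma>L k $$ (l * aL k + i1, l' * aL k + i2) * \<sigma>R k $$ (b * dE + x, b' * dE + y)"
          using tensor_index[of "l * aL k + i1" "\<sigma>L k" "l' * aL k + i2" "b * dE + x" "\<sigma>R k" "b' * dE + y"] idx
            carrier_matD[OF \<sigma>c(1)] carrier_matD[OF \<sigma>c(2)] by simp
        moreover have "complex_of_real (tL k) * \<sigma>L k $$ (l * aL k + i1, l' * aL k + i2) = (if l = l' then L (Suc l) k i1 i2 else 0)"
        proof -
          have "complex_of_real (tL k) * \<sigma>L k $$ (l * aL k + i1, l' * aL k + i2) = NL k $$ (l * aL k + i1, l' * aL k + i2)"
            unfolding tL(3)[OF k] using idx carrier_matD[OF \<sigma>c(1)] by simp
          then show ?thesis using idx ib by (simp add: NL_def)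
        qed
        moreover have "complex_of_real (tR k) * \<sigma>R k $$ (b * dE + x, b' * dE + y) = R k b x b' y"
        proof -
          have "complex_of_real (tR k) * \<sigma>R k $$ (b * dE + x, b' * dE + y) = NR k $$ (b * dE + x, b' * dE + y)"
            unfolding tR(3)[OF k] using idx carrier_matD[OF \<sigma>c(2)] by simp
          then show ?thesis using idx r(3) c(3) by (simp add: NR_def)
        qed
        moreover have "complex_of_real (lam k) * (u * (p * q) * v) = u * (1 / of_nat m * ((complex_of_real (tL k) * p) * (complex_of_real (tR k) * q))) * v" for u p q v
          by (simp add: lam_def)
        ultimately show "complex_of_real (lam k) * (W k $$ (i, i1 * aR k + b) *
          tensor_mat (\<sigma>L k) (\<sigma>R k) $$ ((l * aL k + i1) * (aR k * dE) + (b * dE + x), (l' * aL k + i2) * (aR k * dE) + (b' * dE + y)) *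
          cnj (W k $$ (j, i2 * aR k + b'))) = W k $$ (i, i1 * aR k + b) *
          (if l = l' then 1 / of_nat m * (L (Suc l) k i1 i2 * R k b x b' y) else 0) * cnj (W k $$ (j, i2 * aR k + b'))"
          by (simp only:) simp
      qed
      finally show "(\<Sum>i1<aL k. \<Sum>b<aR k. \<Sum>i2<aL k. \<Sum>b'<aR k. W k $$ (i, i1 * aR k + b) *
        (if l = l' then 1 / of_nat m * (L (Suc l) k i1 i2 * R k b x b' y) else 0) * cnj (W k $$ (j, i2 * aR k + b'))) = ?T k $$ (r, c)" by (rule sym)
    qed
    also have "\<dots> = msum (m * dS * dE) ?T {..<K} $$ (r, c)" using rc by (simp add: msum_def)
    finally show "?\<omega> $$ (r, c) = msum (m * dS * dE) ?T {..<K} $$ (r, c)" .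
  qed
  moreover have "0 \<le> lam k" if "k < K" for k using tL(1) tR(1) that by (simp add: lam_def)
  ultimately show ?thesis
    unfolding markov_state_def using Wc W_orth W_sum lam_sum tL(2) tR(2)
    by (intro exI[of _ K] exI[of _ lam] exI[of _ aL] exI[of _ aR] exI[of _ W] exI[of _ \<sigma>L] exI[of _ \<sigma>R]) auto
qed

lemma (in bipartite) ptr_sum: "ptr (sum h S) = (\<Sum>x\<in>S. ptr (h x))"
  unfolding ptr_def sum_distrib_left sum_distrib_right by (rule sum.swap)

lemma (in bipartite) ptr_sc: "ptr (r *\<^sub>C X) = r *\<^sub>C ptr X"
  unfolding ptr_def by (simp add: fsvs.scale_sum_right)

subsection \<open>Positive maps and the Petz channel\<close>

locale positive_tp =
  fixes n p :: nat and \<Lambda> :: "complex mat \<Rightarrow> complex mat"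
  assumes lin: "linear_map n p \<Lambda>" and tp: "trace_preserving n \<Lambda>" and positive: "positive_map n p \<Lambda>"
begin

definition lift :: "fsmat \<Rightarrow> fsmat" where "lift X = fs (\<Lambda> (of_fs n X))"

text \<open>The adjoint for the trace pairing: its entry at \<open>(i, j)\<close> has to be the
  pairing with the matrix unit \<open>mu j i\<close>.\<close>

definition dual :: "fsmat \<Rightarrow> fsmat" where "dual Y = fsmat_of n n (\<lambda>i j. tr (lift (mu j i) * Y))"

lemma L_carrier: "X \<in> carrier_mat n n \<Longrightarrow> \<Lambda> X \<in> carrier_mat p p"
  using lin unfolding linear_map_def by blast

lemma lift_comb: "lift (x *\<^sub>C X + y *\<^sub>C Y) = x *\<^sub>C lift X + y *\<^sub>C lift Y"
proof -
  have "of_fs n (x *\<^sub>C X + y *\<^sub>C Y) = x \<cdot>\<^sub>m of_fs n X + y \<cdot>\<^sub>m of_fs n Y"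
    by (rule eq_matI) (auto simp: of_fs_def entry_add entry_sc)
  then have "\<Lambda> (of_fs n (x *\<^sub>C X + y *\<^sub>C Y)) = x \<cdot>\<^sub>m \<Lambda> (of_fs n X) + y \<cdot>\<^sub>m \<Lambda> (of_fs n Y)"
    using lin unfolding linear_map_def by simp
  then show ?thesis unfolding lift_def
    using fs_add[of "x \<cdot>\<^sub>m \<Lambda> (of_fs n X)" p p "y \<cdot>\<^sub>m \<Lambda> (of_fs n Y)"] L_carrier by (simp add: fs_smult)
qed

lemma lift_add: "lift (X + Y) = lift X + lift Y" using lift_comb[of 1 X 1 Y] by simp
lemma lift_sc: "lift (x *\<^sub>C X) = x *\<^sub>C lift X" using lift_comb[of x X 0 0] by simp
lemma lift_0: "lift 0 = 0" using lift_sc[of 0 0] by simp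
lemma lift_diff: "lift (X - Y) = lift X - lift Y" using lift_comb[of 1 X "-1" Y] by simp
lemma lift_sum: "lift (sum h S) = (\<Sum>x\<in>S. lift (h x))"
  by (induction S rule: infinite_finite_induct) (auto simp: lift_0 lift_add)

lemma lift_bounded: "bounded_by p (lift X)"
  unfolding lift_def by (rule fs_bounded[OF L_carrier]) simp

lemma lift_fs: "X \<in> carrier_mat n n \<Longrightarrow> lift (fs X) = fs (\<Lambda> X)"
  by (simp add: lift_def of_fs_fs)

lemma bounded_sandwich: "idp n * X * idp n = X \<Longrightarrow> bounded_by n X"
  unfolding bounded_by_iff_idp by (metis idp_idp mult.assoc)

lemma lift_pos:
  assumes "idp n * X * idp n = X" "pos X"
  shows "pos (lift X)"
proof -
  have "psd n (of_fs n X)" using assms fs_of_fs[OF bounded_sandwich[OF assms(1)]] by (simp add: psd_iff_pos)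
  then have "psd p (\<Lambda> (of_fs n X))" using positive unfolding positive_map_def by blast
  then show ?thesis unfolding lift_def using psd_iff_pos[OF L_carrier[of "of_fs n X"]] by simp
qed

lemma tr_lift: "bounded_by n X \<Longrightarrow> tr (lift X) = tr X"
  unfolding lift_def using tp tr_fs[OF L_carrier[of "of_fs n X"]] tr_fs[of "of_fs n X" n] fs_of_fs[of n X]
  unfolding trace_preserving_def by simp

lemma dual_bounded: "bounded_by n (dual Y)"
  unfolding dual_def by (rule bounded_by_fsmat_of) auto

lemma dual_diff: "dual (X - Y) = dual X - dual Y"
  by (rule fsmat_eqI) (simp add: dual_def entry_fsmat_of entry_diff right_diff_distrib tr_diff)

lemma lift_dual:
  assumes "idp n * X * idp n = X"
  shows "tr (lift X * Y) = tr (X * dual Y)"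
proof -
  have X: "X = (\<Sum>i<n. \<Sum>j<n. entry X i j *\<^sub>C mu i j)"
    using bounded_by_eq_sum_mu[OF bounded_sandwich[OF assms]] .
  have "tr (lift X * Y) = (\<Sum>i<n. \<Sum>j<n. entry X i j * tr (lift (mu i j) * Y))"
    by (subst X) (simp add: lift_sum lift_sc sum_distrib_right tr_sum tr_sc)
  also have "\<dots> = (\<Sum>i<n. \<Sum>j<n. entry X i j * tr (mu i j * dual Y))"
    by (intro sum.cong refl) (simp add: tr_mult_commute[of "mu _ _"] tr_mult_mu dual_def entry_fsmat_of)
  also have "\<dots> = tr (X * dual Y)"
    using arg_cong[OF X, of "\<lambda>Z. tr (Z * dual Y)"] by (simp add: sum_distrib_right tr_sum tr_sc)
  finally show ?thesis .
qed

text \<open>Pairing \<open>dual Y\<close> with \<open>C * adj C\<close> is pairing \<open>Y\<close>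
  with the image of a positive operator. \<open>B\<close> is first compressed by
  \<open>idp n\<close>, because the duality is available in that corner.\<close>

lemma dual_pos:
  assumes "pos Y"
  shows "pos (dual Y)"
proof (rule posI_tr[OF dual_bounded])
  fix B
  let ?C = "idp n * B"
  have I: "idp n * dual Y * idp n = dual Y" using dual_bounded unfolding bounded_by_iff_idp by metis
  have "tr (adj B * dual Y * B) = tr (B * (adj B * dual Y))" by (rule tr_mult_commute)
  also have "\<dots> = tr (B * adj B * idp n * dual Y * idp n)" by (subst I[symmetric]) (simp add: mult.assoc)
  also have "\<dots> = tr (idp n * (B * adj B * idp n * dual Y))" by (rule tr_mult_commute)
  also have "\<dots> = tr ((?C * adj ?C) * dual Y)" by (simp add: mult.assoc)
  also have "\<dots> = tr (lift (?C * adj ?C) * Y)"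
    by (rule lift_dual[symmetric]) (simp add: mult.assoc, simp add: mult.assoc[symmetric])
  also have "0 \<le> \<dots>"
    by (intro tr_mult_pos lift_pos assms pos_mult_adj) (simp add: mult.assoc, simp add: mult.assoc[symmetric])
  finally show "0 \<le> tr (adj B * dual Y * B)" .
qed

text \<open>Trace preservation of a map is unitality of its adjoint. Together with positivity it
  makes the adjoint respect the order interval below the identity.\<close>

lemma dual_idp: "dual (idp p) = idp n"
proof (rule fsmat_eqI)
  fix i j
  have "tr (lift (mu j i) * idp p) = tr (mu j i)" if "i < n" "j < n"
  proof -
    have "bounded_by n (mu j i)" using that by (auto simp: bounded_by_def entry_mu)
    then show ?thesis using lift_bounded[of "mu j i"] tr_lift unfolding bounded_by_iff_idp by simp
  qed
  then show "entry (dual (idp p)) i j = entry (idp n) i j"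
    by (auto simp: dual_def entry_fsmat_of entry_idp tr_mu)
qed

end

text \<open>The Petz map, made trace preserving off the support \<open>e\<close> of \<open>a\<close> by preparing the state
  \<open>\<tau> = r * r\<close> there.\<close>

definition petz_kraus :: "(nat \<Rightarrow> fsmat) \<Rightarrow> fsmat \<Rightarrow> fsmat \<Rightarrow> fsmat \<Rightarrow> fsmat \<Rightarrow> nat + nat \<times> nat \<Rightarrow> fsmat" where
  "petz_kraus J f s r e' q = (case q of Inl k \<Rightarrow> f * J k * s | Inr (i, j) \<Rightarrow> r * mu i j * e')"

text \<open>The sum of \<open>mu i j * Y * mu j i\<close> over all \<open>i\<close> and
  \<open>j\<close> is the trace of \<open>Y\<close> times an identity, so the second family of Kraus
  operators discards its input and prepares \<open>r * r\<close>.\<close>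

lemma petz_kraus_sums:
  assumes dE: "0 < dE" and f: "adj f = f" and s: "adj s = s" and r: "adj r = r" "bounded_by (dS * dE) r"
    and e: "adj e' = e'" "e' * e' = e'" "bounded_by dS e'"
  defines "G \<equiv> petz_kraus (incl dS dE) f s r e'" and "S \<equiv> {..<dE} <+> ({..<dS * dE} \<times> {..<dS})"
  shows "(\<Sum>q\<in>S. G q * X * adj (G q)) =
      f * bipartite.amp dE (incl dS dE) (s * X * s) * f + tr (e' * X * e') *\<^sub>C (r * r)"
    and "(\<Sum>q\<in>S. adj (G q) * G q) = s * bipartite.ptr dE (incl dS dE) (f * f) * s + tr (r * r) *\<^sub>C e'"
proof -
  interpret bipartite "idp dS" "idp (dS * dE)" dE "incl dS dE" using dE by (rule bipartite_incl)
  have fin: "finite {..<dE}" "finite ({..<dS * dE} \<times> {..<dS})" by auto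
  have mu_mu: "mu i j * Y * mu j i = entry Y j j *\<^sub>C mu i i" for i j Y
  proof -
    have "mu i j * Y * mu j i = mu i j * (mu j j * Y * mu j j) * mu j i"
      by (simp add: mult.assoc mu_mult_mu) (simp add: mult.assoc[symmetric] mu_mult_mu)
    then show ?thesis unfolding mu_sandwich by (simp add: mu_mult_mu)
  qed
  have rI: "r * idp (dS * dE) = r" using r unfolding bounded_by_iff_idp by simp
  have eI: "e' * idp dS = e'" "idp dS * e' = e'" using e unfolding bounded_by_iff_idp by simp_all
  have "(\<Sum>q\<in>S. G q * X * adj (G q)) = (\<Sum>k<dE. f * (incl dS dE k * (s * X * s) * adj (incl dS dE k)) * f) +
    (\<Sum>i<dS * dE. \<Sum>j<dS. r * (mu i j * (e' * X * e') * mu j i) * r)"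
    unfolding S_def sum.Plus[OF fin] sum.cartesian_product
    by (simp add: G_def petz_kraus_def f s r e mult.assoc case_prod_unfold)
  also have "(\<Sum>i<dS * dE. \<Sum>j<dS. r * (mu i j * (e' * X * e') * mu j i) * r) =
    (\<Sum>j<dS. entry (e' * X * e') j j) *\<^sub>C (r * (\<Sum>i<dS * dE. mu i i) * r)"
    unfolding mu_mu by (simp add: sum_distrib_left sum_distrib_right fsvs.scale_sum_left fsvs.scale_sum_right)
  also have "(\<Sum>j<dS. entry (e' * X * e') j j) = tr (e' * X * e')"
  proof (rule tr_eq[symmetric])
    show "bounded_by dS (e' * X * e')" unfolding bounded_by_iff_idp
      by (simp add: mult.assoc eI) (simp add: mult.assoc[symmetric] eI)
  qed
  finally show "(\<Sum>q\<in>S. G q * X * adj (G q)) = f * amp (s * X * s) * f + tr (e' * X * e') *\<^sub>C (r * r)"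
    by (simp add: amp_def sum_distrib_left sum_distrib_right idp_eq_sum_mu[symmetric] rI)
  have "(\<Sum>q\<in>S. adj (G q) * G q) = (\<Sum>k<dE. s * (adj (incl dS dE k) * (f * f) * incl dS dE k) * s) +
    (\<Sum>i<dS * dE. \<Sum>j<dS. e' * (mu j i * (r * r) * mu i j) * e')"
    unfolding S_def sum.Plus[OF fin] sum.cartesian_product
    by (simp add: G_def petz_kraus_def f s r e mult.assoc case_prod_unfold)
  also have "(\<Sum>i<dS * dE. \<Sum>j<dS. e' * (mu j i * (r * r) * mu i j) * e') =
    (\<Sum>i<dS * dE. entry (r * r) i i) *\<^sub>C (e' * (\<Sum>j<dS. mu j j) * e')"
    unfolding mu_mu by (subst sum.swap) (simp add: sum_distrib_left sum_distrib_right fsvs.scale_sum_left fsvs.scale_sum_right)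
  also have "(\<Sum>i<dS * dE. entry (r * r) i i) = tr (r * r)"
    by (rule tr_eq[symmetric]) (intro bounded_by_mult r)
  finally show "(\<Sum>q\<in>S. adj (G q) * G q) = s * ptr (f * f) * s + tr (r * r) *\<^sub>C e'"
    by (simp add: ptr_def sum_distrib_left sum_distrib_right idp_eq_sum_mu[symmetric] eI e)
qed

lemma kraus_ptrace_conj:
  assumes U: "U \<in> carrier_mat (dS * dE) (dS * dE)" and dE: "0 < dE"
  shows "kraus (dS * dE) dS (\<lambda>k. adj (incl dS dE k) * fs U) {..<dE} (\<lambda>X. ptrace_E dS dE (U * X * mat_adjoint U))"
  unfolding kraus_def
proof (intro conjI ballI)
  interpret bipartite "idp dS" "idp (dS * dE)" dE "incl dS dE" using dE by (rule bipartite_incl)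
  have fU: "fs U * idp (dS * dE) = fs U" using fs_bounded[OF U] unfolding bounded_by_iff_idp by simp
  fix k assume "k \<in> {..<dE}"
  then show "idp dS * (adj (incl dS dE k) * fs U) = adj (incl dS dE k) * fs U"
    by (simp add: IJ mult.assoc[symmetric])
  show "adj (incl dS dE k) * fs U * idp (dS * dE) = adj (incl dS dE k) * fs U"
    by (simp add: mult.assoc fU)
next
  fix X :: "complex mat" assume X: "X \<in> carrier_mat (dS * dE) (dS * dE)"
  show "ptrace_E dS dE (U * X * mat_adjoint U) \<in> carrier_mat dS dS" by simp
  have c: "U * X * mat_adjoint U \<in> carrier_mat (dS * dE) (dS * dE)"
    using U X carrier_matI[of "mat_adjoint U" "dS * dE" "dS * dE"] by (metis carrier_matD mat_adjoint_dim mult_carrier_mat)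
  have "fs (U * X * mat_adjoint U) = fs U * fs X * adj (fs U)"
    using U X by (simp add: fs_mult fs_adjoint)
  then show "fs (ptrace_E dS dE (U * X * mat_adjoint U)) =
    (\<Sum>k<dE. adj (incl dS dE k) * fs U * fs X * adj (adj (incl dS dE k) * fs U))"
    unfolding fs_ptrace[OF c] by (simp add: mult.assoc)
qed

theorem theorem4p1:
  fixes dS dE M m :: nat
    and \<S> :: "complex mat set"
    and \<rho> :: "nat \<Rightarrow> complex mat"
    and \<Lambda>P :: "complex mat \<Rightarrow> complex mat"
  defines "\<V> \<equiv> cspan (dS * dE) \<S>"
  defines "\<V>S \<equiv> ptrace_E dS dE ` \<V>"
  defines "\<V>hat \<equiv> cspan (dS * dE) (\<rho> ` {1..m})"
  defines "\<G> \<equiv> {U. unitary_mat (dS * dE) U \<and>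
             (\<forall>X\<in>\<V>. \<forall>Y\<in>\<V>. ptrace_E dS dE X = ptrace_E dS dE Y \<longrightarrow>
                 ptrace_E dS dE (U * X * mat_adjoint U) = ptrace_E dS dE (U * Y * mat_adjoint U))}"
  defines "\<omega> \<equiv> msum (m * (dS * dE))
             (\<lambda>l. (1 / of_nat m) \<cdot>\<^sub>m tensor_mat (ketbra m (l - 1)) (\<rho> l)) {1..m}"
  assumes S_nonempty: "\<S> \<noteq> {}"
    and S_density: "\<S> \<subseteq> density (dS * dE)"
    and S'_sub: "\<rho> ` {1..M} \<subseteq> \<S>"
    and S'_indep: "lin_indep_fam (dS * dE) \<rho> {1..M}"
    and S'_maximal: "\<forall>T. \<rho> ` {1..M} \<subset> T \<longrightarrow> T \<subseteq> \<S> \<longrightarrow> \<not> lin_indep_set (dS * dE) T"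
    and m_le: "m \<le> M"
    and red_indep: "lin_indep_fam dS (\<lambda>i. ptrace_E dS dE (\<rho> i)) {1..m}"
    and red_span: "cspan dS ((\<lambda>i. ptrace_E dS dE (\<rho> i)) ` {1..m}) = \<V>S"
    and LP_linear: "linear_map dS (dS * dE) \<Lambda>P"
    and LP_tp: "trace_preserving dS \<Lambda>P"
    and LP_pos: "positive_map dS (dS * dE) \<Lambda>P"
    and LP_maps: "\<forall>i\<in>{1..m}. \<Lambda>P (ptrace_E dS dE (\<rho> i)) = \<rho> i"
  shows "markov_state m dS dE \<omega> \<and>
    (\<exists>\<Lambda>CP. linear_map dS (dS * dE) \<Lambda>CP \<and> trace_preserving dS \<Lambda>CP \<and>
       completely_positive dS (dS * dE) \<Lambda>CP \<and>
       (\<forall>i\<in>{1..m}. \<Lambda>CP (ptrace_E dS dE (\<rho> i)) = \<rho> i) \<and>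
       (\<forall>U\<in>\<G>.
          completely_positive dS dS (\<lambda>X. ptrace_E dS dE (U * \<Lambda>CP X * mat_adjoint U)) \<and>
          (\<forall>\<rho>SE\<in>density (dS * dE) \<inter> \<V>.
             ptrace_E dS dE (U * \<Lambda>CP (ptrace_E dS dE \<rho>SE) * mat_adjoint U)
               = ptrace_E dS dE (U * \<rho>SE * mat_adjoint U)))) \<and>
    ptrace_E dS dE ` (density (dS * dE) \<inter> \<V>) = density dS \<inter> \<V>S"
proof -
  define N where "N = dS * dE"
  obtain D where D: "D \<in> \<S>" "D \<in> density N" using S_nonempty S_density by (auto simp: N_def)
  then have Dc: "D \<in> carrier_mat N N" "tr (fs D) = 1" by (auto simp: density_iff)
  \<comment> \<open>An operator of trace 1 excludes dimension 0; this provides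
    \<open>dE > 0\<close>, on which the isometries \<open>incl\<close> rely.\<close>
  have "N \<noteq> 0"
  proof
    assume "N = 0"
    then have "tr (fs D) = 0" using Dc(1) by (subst tr_fs[OF Dc(1)]) (simp add: mtrace_def)
    then show False using Dc by simp
  qed
  then have dE: "0 < dE" by (auto simp: N_def)
  interpret bipartite "idp dS" "idp N" dE "incl dS dE" unfolding N_def using dE by (rule bipartite_incl)
  interpret P: positive_tp dS N \<Lambda>P
    using LP_linear LP_tp LP_pos by unfold_locales (auto simp: N_def)
  have fs_ptr: "fs (ptrace_E dS dE X) = ptr (fs X)" if "X \<in> carrier_mat N N" for X
    using fs_ptrace[of X dS dE] that by (simp add: ptr_def N_def)
  have tr_ptr: "tr (ptr X) = tr X" if "bounded_by N X" for X
  proof -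
    have "tr (ptr X) = tr (idp dS * ptr X)" by (simp add: I_ptr)
    also have "\<dots> = tr (idp N * X)" by (simp add: tr_amp_mult[symmetric] amp_I)
    finally show ?thesis using that unfolding bounded_by_iff_idp by simp
  qed
  have ptrace_density: "ptrace_E dS dE X \<in> density dS" if "X \<in> density N" for X
    using that pos_ptr tr_ptr fs_bounded by (auto simp: density_iff fs_ptr)
  have VD: "D \<in> \<V>"
  proof -
    have "fs (msum N (\<lambda>Y. 1 \<cdot>\<^sub>m Y) {D}) = (\<Sum>Y\<in>{D}. fs (1 \<cdot>\<^sub>m Y))"
      by (rule fs_msum) (use Dc in auto)
    then have "D = msum N (\<lambda>Y. 1 \<cdot>\<^sub>m Y) {D}"
      by (intro fs_inject[OF Dc(1)]) (simp_all add: fs_smult)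
    then show ?thesis unfolding \<V>_def cspan_def N_def using D(1)
      by (intro CollectI exI[of _ "{D}"] exI[of _ "\<lambda>_. 1"]) auto
  qed
  \<comment> \<open>With \<open>m = 0\<close> the reduced states would span the zero space, which
    contains no operator of trace 1.\<close>
  have m: "0 < m"
  proof (rule ccontr)
    assume "\<not> 0 < m"
    then have "ptrace_E dS dE D \<in> cspan dS {}" using red_span VD by (auto simp: \<V>S_def)
    then have "ptrace_E dS dE D = msum dS (\<lambda>Y. Y) {}" unfolding cspan_def msum_def by auto
    moreover have "fs (msum dS (\<lambda>Y. Y) {}) = (\<Sum>Y\<in>{}. fs Y)" by (rule fs_msum) simp
    ultimately have "fs (ptrace_E dS dE D) = 0" by simp
    moreover have "tr (fs (ptrace_E dS dE D)) = 1" using ptrace_density[OF D(2)] by (simp add: density_iff)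
    ultimately show False by simp
  qed
  have \<rho>S: "\<rho> l \<in> \<S>" if "l \<in> {1..m}" for l using S'_sub m_le that by auto
  then have \<rho>: "\<rho> l \<in> density N" if "l \<in> {1..m}" for l using S_density that by (auto simp: N_def)
  have \<rho>c: "\<rho> l \<in> carrier_mat N N" if "l \<in> {1..m}" for l using \<rho>[OF that] by (simp add: density_iff)
  define B where "B l = fs (\<rho> l)" for l
  define A where "A l = ptr (B l)" for l
  have B: "pos (B l)" "bounded_by N (B l)" "tr (B l) = 1" if "l \<in> {1..m}" for l
    using \<rho>[OF that] fs_bounded by (auto simp: B_def density_iff)
  have A: "pos (A l)" "bounded_by dS (A l)" "P.lift (A l) = B l" "A l = fs (ptrace_E dS dE (\<rho> l))" if "l \<in> {1..m}" for l
  proof -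
    show "pos (A l)" using B[OF that] pos_ptr by (simp add: A_def)
    show Al: "A l = fs (ptrace_E dS dE (\<rho> l))" using fs_ptr[OF \<rho>c[OF that]] by (simp add: A_def B_def)
    then show "bounded_by dS (A l)" by (simp add: fs_bounded)
    show "P.lift (A l) = B l" using LP_maps that by (simp add: Al P.lift_fs B_def)
  qed
  define a where "a = (\<Sum>l\<in>{1..m}. A l)"
  define b where "b = (\<Sum>l\<in>{1..m}. B l)"
  have pa: "pos a" unfolding a_def by (intro pos_sum A)
  have pb: "pos b" unfolding b_def by (intro pos_sum B)
  have ba: "bounded_by dS a" using A(2) unfolding a_def bounded_by_iff_idp by (simp add: sum_distrib_left sum_distrib_right)
  have bb: "bounded_by N b" using B(2) unfolding b_def bounded_by_iff_idp by (simp add: sum_distrib_left sum_distrib_right)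
  have "P.lift a = b" unfolding a_def b_def P.lift_sum by (intro sum.cong refl A(3))
  moreover have "ptr b = a" unfolding a_def b_def ptr_sum A_def ..
  ultimately have ab: "P.lift a = b" "ptr b = a" .
  obtain c s e where r: "root_pinv a c s e" using root_pinv_exists[OF pa] by blast
  obtain f t g where r': "root_pinv b f t g" using root_pinv_exists[OF pb] by blast
  have ce: "adj s = s" "adj e = e" "e * e = e" "proj e" "c * s = e" "c * c = a" "s * c = e" "s * e = s" "e * s = s"
    using r by (auto simp: root_pinv_def pos_def proj_def)
  have fg: "adj f = f" "f * f = b" "pos f" using r' by (auto simp: root_pinv_def pos_def)
  note bound = root_pinv_bounded[OF r ba] root_pinv_bounded[OF r' bb]
  have aA: "pos (a - A l)" if l: "l \<in> {1..m}" for l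
  proof -
    have "a - A l = (\<Sum>k\<in>{1..m} - {l}. A k)" unfolding a_def using l by (simp add: sum.remove)
    also have "pos \<dots>" by (intro pos_sum A(1)) simp
    finally show ?thesis .
  qed
  have rec: "B l = f * amp (s * A l * s) * f" if l: "l \<in> {1..m}" for l
  proof (rule recovery[where Lam = P.lift and Lam' = P.dual and a = a and b = b])
    show "pos (idp dS - P.dual Y)" if "pos (idp N - Y)" for Y
      using P.dual_pos[OF that] by (simp add: P.dual_diff P.dual_idp)
    show "idp dS * a = a" "idp N * b = b" using ba bb unfolding bounded_by_iff_idp by auto
    show "ptr (B l) = A l" by (simp add: A_def)
  qed (use P.lift_dual P.lift_diff P.lift_pos P.dual_pos r r' ab A(1-3)[OF l] aA[OF l] in auto)
  have markov: "markov_state m dS dE \<omega>"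
  proof -
    have fN: "idp N * f = f" using bound(4) unfolding bounded_by_iff_idp by simp
    have "\<exists>K aL aR w L R. markov_basis (idp dS) dE (incl dS dE) {1..m} B K aL aR w L R"
    proof (rule markov_basis_exists[OF r _ fg(3,2) fN ab(2), where A = A])
      show "idp dS * a = a" using ba unfolding bounded_by_iff_idp by simp
      fix l assume l: "l \<in> {1..m}"
      show "pos (A l)" "B l = f * amp (s * A l * s) * f" using A(1)[OF l] rec[OF l] by blast+
      show "ptr (B l) = A l" by (simp only: A_def)
    qed
    then obtain K aL aR w L R where "markov_basis (idp dS) dE (incl dS dE) {1..m} B K aL aR w L R" by blast
    then show ?thesis unfolding \<omega>_def B_def using \<rho> unfolding N_def by (intro markov_state_of_basis dE m)
  qed
  have one: "1 \<in> {1..m}" using m by simp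
  \<comment> \<open>Off the support of \<open>a\<close> any fixed density operator can be prepared.
    The first of the given states is at hand, and its root enters the Kraus operators.\<close>
  obtain q t' g' where rq: "root_pinv (B 1) q t' g'" using root_pinv_exists B one by blast
  then have q: "adj q = q" "q * q = B 1" "bounded_by N q"
    using root_pinv_bounded[OF rq B(2)[OF one]] by (auto simp: root_pinv_def pos_def)
  define e' where "e' = idp dS - e"
  have e': "adj e' = e'" "e' * e' = e'" "bounded_by dS e'" "e' + e = idp dS"
    using ce bound(3) unfolding e'_def bounded_by_iff_idp by (simp_all add: left_diff_distrib right_diff_distrib)
  define G where "G = petz_kraus (incl dS dE) f s q e'"
  define S where "S = {..<dE} <+> ({..<dS * dE} \<times> {..<dS})"
  define \<Phi> where "\<Phi> Y = (\<Sum>x\<in>S. G x * Y * adj (G x))" for Y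
  note sums = petz_kraus_sums[OF dE fg(1) ce(1) q(1) q(3)[unfolded N_def] e'(1-3), folded G_def S_def]
  have GI: "idp N * G x = G x \<and> G x * idp dS = G x" if "x \<in> S" for x
  proof -
    have i: "idp N * f = f" "s * idp dS = s" "idp N * q = q" "e' * idp dS = e'"
      using bound e' q unfolding bounded_by_iff_idp by auto
    show ?thesis unfolding G_def petz_kraus_def
      by (cases x) (auto simp: mult.assoc i split: prod.splits, simp_all add: mult.assoc[symmetric] i)
  qed
  have \<Phi>b: "bounded_by N (\<Phi> Y)" for Y
  proof -
    have "adj (G x) * idp N = adj (G x)" if "x \<in> S" for x using GI[OF that] by (metis adj_idp adj_mult)
    then show ?thesis unfolding bounded_by_iff_idp \<Phi>_def sum_distrib_left sum_distrib_right using GI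
      by (auto intro!: sum.cong simp: mult.assoc) (simp add: mult.assoc[symmetric])
  qed
  define \<Lambda> where "\<Lambda> X = of_fs N (\<Phi> (fs X))" for X
  have fs\<Lambda>: "fs (\<Lambda> X) = \<Phi> (fs X)" for X unfolding \<Lambda>_def by (rule fs_of_fs[OF \<Phi>b])
  have \<Lambda>c: "\<Lambda> X \<in> carrier_mat N N" for X by (simp add: \<Lambda>_def)
  have k: "kraus dS N G S \<Lambda>" unfolding kraus_def using GI \<Lambda>c fs\<Lambda> by (simp add: \<Phi>_def)
  \<comment> \<open>The Petz part contributes \<open>s * a * s = e\<close>, the preparing part
    contributes \<open>e'\<close> with the factor \<open>tr (B 1) = 1\<close>.\<close>
  have GG: "(\<Sum>x\<in>S. adj (G x) * G x) = idp dS"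
  proof -
    have "s * a * s = e" using ce by (metis mult.assoc)
    then show ?thesis unfolding sums(2) using e' B(3)[OF one] by (simp add: fg ab q add.commute)
  qed
  \<comment> \<open>The preparing part acts off the support of \<open>a\<close>, where every
    \<open>A l\<close> vanishes; the Petz part is the recovery formula.\<close>
  have \<Phi>A: "\<Phi> (A l) = B l" if l: "l \<in> {1..m}" for l
  proof -
    have "e * A l = A l" using root_pinv_support[OF r A(1)[OF l] aA[OF l]] by blast
    moreover have "idp dS * A l = A l" using A(2)[OF l] unfolding bounded_by_iff_idp by simp
    ultimately have "e' * A l = 0" by (simp add: e'_def left_diff_distrib)
    then show ?thesis unfolding \<Phi>_def sums(1) rec[OF l, symmetric] by simp
  qed
  have \<Lambda>\<rho>: "\<Lambda> (ptrace_E dS dE (\<rho> l)) = \<rho> l" if l: "l \<in> {1..m}" for l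
    by (rule fs_inject[OF \<Lambda>c \<rho>c[OF l]]) (simp add: fs\<Lambda> A(4)[OF l, symmetric] \<Phi>A[OF l] B_def)
  \<comment> \<open>On \<open>\<V>S\<close> the channel is a section of the partial trace with
    values in \<open>\<V>\<close>. The statements on evolutions and on density operators both rest
    on this.\<close>
  have span: "\<Lambda> X \<in> \<V> \<and> ptrace_E dS dE (\<Lambda> X) = X" if X: "X \<in> \<V>S" for X
  proof -
    obtain F u where F: "X = msum dS (\<lambda>Y. u Y \<cdot>\<^sub>m Y) F" "finite F" "F \<subseteq> (\<lambda>i. ptrace_E dS dE (\<rho> i)) ` {1..m}"
      using X unfolding red_span[symmetric] cspan_def by blast
    have FZ: "Z \<in> carrier_mat dS dS" "\<Lambda> Z \<in> \<S>" "ptrace_E dS dE (\<Lambda> Z) = Z" if "Z \<in> F" for Z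
      using F(3) that \<Lambda>\<rho> \<rho>S by auto
    \<comment> \<open>\<open>cspan\<close> sums over sets of matrices, so coefficients can be
      transported along \<open>\<Lambda>\<close> only if no two members of \<open>F\<close> are
      merged; the partial trace is a left inverse there.\<close>
    have inj: "inj_on \<Lambda> F" by (rule inj_on_inverseI[of _ "ptrace_E dS dE"]) (rule FZ)
    have "fs X = (\<Sum>Z\<in>F. u Z *\<^sub>C fs Z)" unfolding F(1) using FZ(1) by (simp add: fs_msum fs_smult)
    then have fX: "fs (\<Lambda> X) = (\<Sum>Z\<in>F. u Z *\<^sub>C fs (\<Lambda> Z))"
      unfolding fs\<Lambda> \<Phi>_def by (simp add: sum_distrib_left sum_distrib_right fsvs.scale_sum_right) (rule sum.swap)
    define T where "T = msum N (\<lambda>Y. u (ptrace_E dS dE Y) \<cdot>\<^sub>m Y) (\<Lambda> ` F)"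
    have "fs T = (\<Sum>Y\<in>\<Lambda> ` F. u (ptrace_E dS dE Y) *\<^sub>C fs Y)"
      unfolding T_def using \<Lambda>c by (subst fs_msum) (auto simp: fs_smult)
    also have "\<dots> = (\<Sum>Z\<in>F. u Z *\<^sub>C fs (\<Lambda> Z))" unfolding sum.reindex[OF inj] by (simp add: FZ)
    finally have "\<Lambda> X = T" using fX by (intro fs_inject[OF \<Lambda>c]) (auto simp: T_def)
    moreover have "T \<in> \<V>" unfolding T_def \<V>_def cspan_def N_def[symmetric]
      using F(2) FZ(2) by (intro CollectI exI[of _ "\<Lambda> ` F"] exI[of _ "\<lambda>Y. u (ptrace_E dS dE Y)"]) auto
    moreover have "ptrace_E dS dE (\<Lambda> X) = X"
    proof (rule fs_inject[of _ dS])
      show "X \<in> carrier_mat dS dS" by (simp add: F(1))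
      have "fs (ptrace_E dS dE (\<Lambda> X)) = (\<Sum>Z\<in>F. u Z *\<^sub>C fs (ptrace_E dS dE (\<Lambda> Z)))"
        by (simp add: fs_ptr[OF \<Lambda>c] fX ptr_sum ptr_sc)
      also have "\<dots> = fs X" unfolding F(1) using FZ by (simp add: fs_msum fs_smult)
      finally show "fs (ptrace_E dS dE (\<Lambda> X)) = fs X" .
    qed simp
    ultimately show ?thesis by simp
  qed
  have lin: "linear_map dS N \<Lambda>" by (rule kraus_linear[OF k])
  have tp: "trace_preserving dS \<Lambda>" by (rule kraus_trace_preserving[OF k GG])
  have "completely_positive dS dS (\<lambda>X. ptrace_E dS dE (U * \<Lambda> X * mat_adjoint U))" if "U \<in> \<G>" for U
  proof -
    have "U \<in> carrier_mat (dS * dE) (dS * dE)" using that by (simp add: \<G>_def unitary_mat_def)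
    then have "kraus N dS (\<lambda>k. adj (incl dS dE k) * fs U) {..<dE} (\<lambda>X. ptrace_E dS dE (U * X * mat_adjoint U))"
      unfolding N_def by (rule kraus_ptrace_conj[OF _ dE])
    from kraus_compose[OF k this] show ?thesis by (intro kraus_completely_positive) (auto simp: S_def)
  qed
  \<comment> \<open>\<open>X\<close> and the lift of its reduced state both lie in
    \<open>\<V>\<close> and have the same partial trace, so \<open>U\<close>-consistency identifies
    their reduced evolutions.\<close>
  moreover have "ptrace_E dS dE (U * \<Lambda> (ptrace_E dS dE X) * mat_adjoint U) = ptrace_E dS dE (U * X * mat_adjoint U)"
    if "U \<in> \<G>" "X \<in> \<V>" for U X
    using that span[of "ptrace_E dS dE X"] unfolding \<G>_def \<V>S_def by blast
  moreover have "ptrace_E dS dE ` (density N \<inter> \<V>) = density dS \<inter> \<V>S"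
  proof
    show "ptrace_E dS dE ` (density N \<inter> \<V>) \<subseteq> density dS \<inter> \<V>S"
      using ptrace_density by (auto simp: \<V>S_def)
    \<comment> \<open>The preimage of a density operator is its lift by \<open>\<Lambda>\<close>,
      which is positive and of trace 1 because \<open>\<Lambda>\<close> is a channel.\<close>
    show "density dS \<inter> \<V>S \<subseteq> ptrace_E dS dE ` (density N \<inter> \<V>)"
    proof
      fix X assume X: "X \<in> density dS \<inter> \<V>S"
      then have Xd: "X \<in> carrier_mat dS dS" "pos (fs X)" "tr (fs X) = 1" by (auto simp: density_iff)
      have "pos (fs (\<Lambda> X))" unfolding fs\<Lambda> \<Phi>_def using Xd by (intro pos_sum pos_conj')
      moreover have "tr (fs (\<Lambda> X)) = 1"
        using tp Xd tr_fs[OF \<Lambda>c[of X]] tr_fs[OF Xd(1)] unfolding trace_preserving_def by simp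
      ultimately have "\<Lambda> X \<in> density N" using \<Lambda>c by (simp add: density_iff)
      then show "X \<in> ptrace_E dS dE ` (density N \<inter> \<V>)" using span[of X] X by (metis IntD2 IntI image_eqI)
    qed
  qed
  ultimately show ?thesis
    using markov lin tp kraus_completely_positive[OF k] \<Lambda>\<rho> unfolding N_def by blast
qed

end
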